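(* Let $\mathbf{A}$ be a finite set, $H$ and $H'$ finite-dimensional complex Hilbert spaces, $\theta=\{1,\ldots,T\}$ a finite set, and let $\{(W_t,V_t): t\in\theta\}$ be an arbitrarily varying classical-quantum wiretap channel, where $W_t: P(\mathbf{A})\to\mathcal{S}(H)$ is the channel to the legitimate receiver and $V_t: P(\mathbf{A})\to\mathcal{S}(H')$ is the channel to the wiretapper. Let $\mathbf{X}$ and $\mathbf{Y}$ be finite sets and let $(X,Y)$ be a random variable distributed according to a joint probability distribution $p\in P(\mathbf{X}\times\mathbf{Y})$. If the mutual information satisfies $I(X;Y)>0$, then the randomness-assisted secrecy capacity is equal to the $m$-$a$-$(X,Y)$ correlation-assisted secrecy capacity: $$C_s(\{(W_t,V_t): t\in\theta\};r)=C_s(\{(W_t,V_t): t\in\theta\};corr(X,Y)).$$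
   Context: Notation. All logarithms are to base 2. For a finite set $\mathbf{A}$, $P(\mathbf{A})$ is the set of probability distributions on $\mathbf{A}$. For a finite-dimensional complex Hilbert space $H$, $\mathcal{S}(H)$ is the set of density operators on $H$. A classical-quantum channel is a linear (i.e. convex-combination preserving) map $W:P(\mathbf{A})\to\mathcal{S}(H)$; $W(a)$ denotes the value at the point mass at $a\in\mathbf{A}$, so $W(P)=\sum_a P(a)W(a)$. For a family $\{W_t:t\in\theta\}$ of such channels and $t^n=(t_1,\ldots,t_n)\in\theta^n$, $W_{t^n}:P(\mathbf{A}^n)\to\mathcal{S}(H^{\otimes n})$ is the linear map with $W_{t^n}(a^n)=W_{t_1}(a_1)\otimes\cdots\otimes W_{t_n}(a_n)$ for $a^n=(a_1,\ldots,a_n)\in\mathbf{A}^n$; similarly $V_{t^n}$. The mutual information is $I(X;Y)=\sum_{x,y}p(x,y)\log\frac{p(x,y)}{p(x)p(y)}$. von Neumann entropy: $S(\rho)=-\mathrm{tr}(\rho\log\rho)$. For a finite set of states $\Phi=\{\rho_x:x\in\mathbf{B}\}$ labeled by $\mathbf{B}$ and $Q\in P(\mathbf{B})$, the Holevo quantity is $\chi(Q;\Phi)=S\bigl(\sum_x Q(x)\rho_x\bigr)-\sum_x Q(x)S(\rho_x)$. A finite set of pairs $\{(W_t,V_t):t\in\theta\}$ of classical-quantum channels $W_t:P(\mathbf{A})\to\mathcal{S}(H)$, $V_t:P(\mathbf{A})\to\mathcal{S}(H')$ is called an arbitrarily varying classical-quantum wiretap channel. Codes. For positive integers $n,J_n$,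 an $(n,J_n)$ (deterministic) code $\mathcal{C}=(E,\{D_j:j=1,\ldots,J_n\})$ consists of a stochastic encoder $E:\{1,\ldots,J_n\}\to P(\mathbf{A}^n)$, $j\mapsto E(\cdot|j)$, and positive semi-definite operators $D_1,\ldots,D_{J_n}$ on $H^{\otimes n}$ with $\sum_{j}D_j=\mathrm{id}_{H^{\otimes n}}$. For $t^n\in\theta^n$ put $$P_e(\mathcal{C},t^n)=1-\frac1{J_n}\sum_{j=1}^{J_n}\mathrm{tr}\bigl(W_{t^n}(E(\cdot|j))D_j\bigr),\qquad Z_{\mathcal{C},t^n}=\{V_{t^n}(E(\cdot|j)):j\in\{1,\ldots,J_n\}\}.$$ $R_{\mathrm{uni}}$ is the uniform distribution on $\{1,\ldots,J_n\}$. Randomness-assisted secrecy capacity. Let $\{\mathcal{C}^\gamma:\gamma\in\Lambda\}$ be the set of $(n,J_n)$ deterministic codes, labeled by a set $\Lambda$. An $(n,J_n)$ randomness-assisted code is a probability distribution $G$ on $(\Lambda,\sigma)$, where $\sigma$ is a sigma-algebra such that for every $t^n\in\theta^n$ the functions $\gamma\mapsto P_e(\mathcal{C}^\gamma,t^n)$ and $\gamma\mapsto\chi(R_{\mathrm{uni}};Z_{\mathcal{C}^\gamma,t^n})$ are measurable. $R\ge0$ is achievable under randomness-assisted coding if for every $\epsilon,\delta,\zeta>0$ and all sufficiently large $n$ there is an $(n,J_n)$ randomness-assisted code with $\frac{\log J_n}{n}>R-\delta$, $\max_{t^n}\int_\Lambda P_e(\mathcal{C}^\gamma,t^n)\,dG(\gamma)<\epsilon$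 and $\max_{t^n}\int_\Lambda\chi(R_{\mathrm{uni}};Z_{\mathcal{C}^\gamma,t^n})\,dG(\gamma)<\zeta$. $C_s(\{(W_t,V_t):t\in\theta\};r)$ is the supremum of all such rates. Correlation-assisted secrecy capacity. An $(X,Y)$-correlation-assisted $(n,J_n)$ code $\mathcal{C}(X,Y)$ consists of stochastic encoders $E_{\mathbf{x}^n}:\{1,\ldots,J_n\}\to P(\mathbf{A}^n)$, one for each $\mathbf{x}^n\in\mathbf{X}^n$, and, for each $\mathbf{y}^n\in\mathbf{Y}^n$, positive semi-definite operators $D_1^{(\mathbf{y}^n)},\ldots,D_{J_n}^{(\mathbf{y}^n)}$ on $H^{\otimes n}$ with $\sum_j D_j^{(\mathbf{y}^n)}=\mathrm{id}_{H^{\otimes n}}$. Put $p(\mathbf{x}^n,\mathbf{y}^n)=\prod_{i=1}^n p(\mathbf{x}_i,\mathbf{y}_i)$, $$P_e(\mathcal{C}(\mathbf{x}^n,\mathbf{y}^n),t^n)=1-\frac1{J_n}\sum_{j=1}^{J_n}\mathrm{tr}\bigl(W_{t^n}(E_{\mathbf{x}^n}(\cdot|j))D_j^{(\mathbf{y}^n)}\bigr),\qquad Z_{t^n,\mathbf{x}^n}=\{V_{t^n}(E_{\mathbf{x}^n}(\cdot|j)):j\in\{1,\ldots,J_n\}\}.$$ $R\ge0$ is an achievable $m$-$a$-$(X,Y)$ secrecy rate if for every $\epsilon,\delta,\zeta>0$ and all sufficiently large $n$ there is an $(X,Y)$-correlation-assisted $(n,J_n)$ code with $\frac{\log J_n}{n}>R-\delta$,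 $$\max_{t^n\in\theta^n}\sum_{\mathbf{x}^n\in\mathbf{X}^n}\sum_{\mathbf{y}^n\in\mathbf{Y}^n}p(\mathbf{x}^n,\mathbf{y}^n)P_e(\mathcal{C}(\mathbf{x}^n,\mathbf{y}^n),t^n)<\epsilon,$$ $$\max_{t^n\in\theta^n}\sum_{\mathbf{x}^n\in\mathbf{X}^n}\sum_{\mathbf{y}^n\in\mathbf{Y}^n}p(\mathbf{x}^n,\mathbf{y}^n)\,\chi(R_{\mathrm{uni}};Z_{t^n,\mathbf{x}^n})<\zeta.$$ The $m$-$a$-$(X,Y)$ (correlation-assisted) secrecy capacity $C_s(\{(W_t,V_t):t\in\theta\};corr(X,Y))$ is the supremum of all achievable $m$-$a$-$(X,Y)$ secrecy rates. *)

theory Defs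
  imports
    "HOL-Probability.Probability"
    "HOL-Library.NList"
    "Jordan_Normal_Form.Schur_Decomposition"
begin

text \<open>
  A \<open>d\<close>-dimensional complex Hilbert space is \<open>\<complex>\<close> to the power \<open>d\<close>, and operators on it are
  complex \<open>d \<times> d\<close> matrices.  Finite alphabets are types of class \<open>finite\<close>, so that
  \<open>P(A)\<close> is \<open>'a pmf\<close>; a word of length \<open>n\<close> over a set \<open>S\<close> is an element of \<open>nlists n S\<close>.
\<close>

section \<open>Operators\<close>

definition mat_trace :: "complex mat \<Rightarrow> complex" where
  "mat_trace A = (\<Sum>i<dim_row A. A $$ (i, i))"

text \<open>
  The order on complex numbers is that of \<open>Complex_Order\<close>, so \<open>0 \<le> z\<close> includes that \<open>z\<close> is
  real; over the complex numbers this makes \<open>A\<close> Hermitian.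
\<close>

definition positive_op :: "nat \<Rightarrow> complex mat \<Rightarrow> bool" where
  "positive_op d A \<longleftrightarrow>
     A \<in> carrier_mat d d \<and> (\<forall>v \<in> carrier_vec d. 0 \<le> (A *\<^sub>v v) \<bullet>c v)"

definition density_op :: "nat \<Rightarrow> complex mat \<Rightarrow> bool" where
  "density_op d \<rho> \<longleftrightarrow> positive_op d \<rho> \<and> mat_trace \<rho> = 1"

definition mat_lincomb ::
    "nat \<Rightarrow> 'i set \<Rightarrow> ('i \<Rightarrow> real) \<Rightarrow> ('i \<Rightarrow> complex mat) \<Rightarrow> complex mat" where
  "mat_lincomb d I c M =
     Matrix.mat d d (\<lambda>ij. \<Sum>x\<in>I. complex_of_real (c x) * M x $$ ij)"

definition kron :: "complex mat \<Rightarrow> complex mat \<Rightarrow> complex mat" where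
  "kron A B = Matrix.mat (dim_row A * dim_row B) (dim_col A * dim_col B)
     (\<lambda>(i, j). A $$ (i div dim_row B, j div dim_col B) * B $$ (i mod dim_row B, j mod dim_col B))"

definition kron_list :: "complex mat list \<Rightarrow> complex mat" where
  "kron_list Ms = foldr kron Ms (1\<^sub>m 1)"

text \<open>
  Functional calculus \<open>f(A)\<close> for a Hermitian matrix \<open>A\<close>: if \<open>A = U diag(e) U\<^sup>*\<close> with \<open>U\<close>
  unitary and \<open>e\<close> real, then \<open>f(A) = U diag(f \<circ> e) U\<^sup>*\<close>, which does not depend on the choice
  of the diagonalisation.
\<close>

definition hermitian_fun :: "(real \<Rightarrow> real) \<Rightarrow> complex mat \<Rightarrow> complex mat" where
  "hermitian_fun f A = (let d = dim_row A in
     THE B. \<exists>U (e :: nat \<Rightarrow> real).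
       U \<in> carrier_mat d d \<and> mat_adjoint U * U = 1\<^sub>m d \<and>
       A = U * mat_diag d (\<lambda>i. complex_of_real (e i)) * mat_adjoint U \<and>
       B = U * mat_diag d (\<lambda>i. complex_of_real (f (e i))) * mat_adjoint U)"

section \<open>Entropic quantities\<close>

text \<open>
  The convention \<open>0 log 0 = 0\<close> holds because \<open>log 2 0 = 0\<close> in the library.  The real part only
  turns the trace, which is real, into a number of type \<open>real\<close>.
\<close>

definition vn_entropy :: "complex mat \<Rightarrow> real" where
  "vn_entropy \<rho> = - Re (mat_trace (\<rho> * hermitian_fun (log 2) \<rho>))"

definition holevo :: "nat \<Rightarrow> 'b set \<Rightarrow> 'b pmf \<Rightarrow> ('b \<Rightarrow> complex mat) \<Rightarrow> real" where
  "holevo d B Q \<rho> =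
     vn_entropy (mat_lincomb d B (pmf Q) \<rho>) - (\<Sum>x\<in>B. pmf Q x * vn_entropy (\<rho> x))"

definition mutual_info :: "('x::finite \<times> 'y::finite) pmf \<Rightarrow> real" where
  "mutual_info p =
     prob_space.mutual_information (measure_pmf p) 2 (count_space UNIV) (count_space UNIV) fst snd"

lemma mutual_info_eq_sum:
  fixes p :: "('x::finite \<times> 'y::finite) pmf"
  shows
  "mutual_info p =
     (\<Sum>x\<in>UNIV. \<Sum>y\<in>UNIV. pmf p (x, y) *
        log 2 (pmf p (x, y) / (pmf (map_pmf fst p) x * pmf (map_pmf snd p) y)))"
proof -
  interpret information_space "measure_pmf p" 2
    by standard simp
  have d: "distributed (measure_pmf q) (count_space UNIV) f (\<lambda>x. ennreal (pmf (map_pmf f q) x))"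
    for q :: "('x \<times> 'y) pmf" and f :: "'x \<times> 'y \<Rightarrow> 'z"
    unfolding distributed_def
    by (simp add: map_pmf_rep_eq[symmetric] measure_pmf_eq_density[symmetric])
  have cs: "count_space (UNIV::'x set) \<Otimes>\<^sub>M count_space (UNIV::'y set) = count_space UNIV"
    using pair_measure_count_space[of "UNIV::'x set" "UNIV::'y set"] by simp
  have sf: "sigma_finite_measure (count_space (UNIV :: 'x set))" "sigma_finite_measure (count_space (UNIV :: 'y set))"
    by (simp_all add: sigma_finite_measure_count_space_finite)
  have "mutual_info p = (\<integral>(x,y). pmf p (x,y) *
      log 2 (pmf p (x,y) / (pmf (map_pmf fst p) x * pmf (map_pmf snd p) y))
      \<partial>(count_space UNIV \<Otimes>\<^sub>M count_space UNIV))"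
    unfolding mutual_info_def
    apply (subst mutual_information_distr[OF sf d _ d _, where Pxy = "pmf p"])
    using d[of p "\<lambda>x. x"] by (simp_all add: cs case_prod_unfold)
  also have "\<dots> = (\<Sum>z\<in>UNIV. case z of (x,y) \<Rightarrow> pmf p (x,y) *
      log 2 (pmf p (x,y) / (pmf (map_pmf fst p) x * pmf (map_pmf snd p) y)))"
    unfolding cs by (simp add: lebesgue_integral_count_space_finite)
  also have "\<dots> = (\<Sum>x\<in>UNIV. \<Sum>y\<in>UNIV. pmf p (x, y) *
        log 2 (pmf p (x, y) / (pmf (map_pmf fst p) x * pmf (map_pmf snd p) y)))"
    by (simp add: sum.cartesian_product)
  finally show ?thesis .
qed

section \<open>Arbitrarily varying classical-quantum wiretap channels\<close>

definition cq_channel :: "nat \<Rightarrow> ('a::finite pmf \<Rightarrow> complex mat) \<Rightarrow> bool" where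
  "cq_channel d W \<longleftrightarrow>
     (\<forall>P. density_op d (W P)) \<and>
     (\<forall>P Q R. \<forall>c\<in>{0..1::real}.
        (\<forall>a. pmf R a = c * pmf P a + (1 - c) * pmf Q a) \<longrightarrow>
        W R = complex_of_real c \<cdot>\<^sub>m W P + complex_of_real (1 - c) \<cdot>\<^sub>m W Q)"

definition avcq_wiretap ::
    "nat \<Rightarrow> nat \<Rightarrow> nat set \<Rightarrow> (nat \<Rightarrow> 'a::finite pmf \<Rightarrow> complex mat) \<Rightarrow>
     (nat \<Rightarrow> 'a pmf \<Rightarrow> complex mat) \<Rightarrow> bool" where
  "avcq_wiretap d d' \<theta> W V \<longleftrightarrow> finite \<theta> \<and> (\<forall>t\<in>\<theta>. cq_channel d (W t) \<and> cq_channel d' (V t))"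

text \<open>
  \<open>word_channel d W ts\<close> is the linear map on distributions on words of length \<open>n = length ts\<close>
  that sends the point mass at \<open>as\<close> to the tensor product of the \<open>W (ts ! i) (as ! i)\<close>, an
  operator on a space of dimension \<open>d ^ n\<close>.
\<close>

definition word_channel ::
    "nat \<Rightarrow> (nat \<Rightarrow> 'a::finite pmf \<Rightarrow> complex mat) \<Rightarrow> nat list \<Rightarrow> 'a list pmf \<Rightarrow> complex mat" where
  "word_channel d W ts P =
     mat_lincomb (d ^ length ts) (nlists (length ts) UNIV) (pmf P)
       (\<lambda>as. kron_list (map2 (\<lambda>t a. W t (return_pmf a)) ts as))"

section \<open>Codes\<close>

definition encoders :: "nat \<Rightarrow> nat \<Rightarrow> (nat \<Rightarrow> 'a::finite list pmf) set" where
  "encoders n J = {1..J} \<rightarrow>\<^sub>E {P. set_pmf P \<subseteq> nlists n UNIV}"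

definition decoders :: "nat \<Rightarrow> nat \<Rightarrow> nat \<Rightarrow> (nat \<Rightarrow> complex mat) set" where
  "decoders d n J =
     {D \<in> {1..J} \<rightarrow>\<^sub>E {M. positive_op (d ^ n) M}.
        mat_lincomb (d ^ n) {1..J} (\<lambda>_. 1) D = 1\<^sub>m (d ^ n)}"

text \<open>
  The error depends on an encoder and a decoder, the leakage only on an encoder, so both serve
  for deterministic codes and for the pairs \<open>(x\<^sup>n, y\<^sup>n)\<close> of a correlation-assisted code.
\<close>

definition code_error ::
    "nat \<Rightarrow> (nat \<Rightarrow> 'a::finite pmf \<Rightarrow> complex mat) \<Rightarrow> nat \<Rightarrow> nat list \<Rightarrow>
     (nat \<Rightarrow> 'a list pmf) \<Rightarrow> (nat \<Rightarrow> complex mat) \<Rightarrow> real" where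
  "code_error d W J ts E D =
     1 - 1 / real J * (\<Sum>j\<in>{1..J}. Re (mat_trace (word_channel d W ts (E j) * D j)))"

definition code_leakage ::
    "nat \<Rightarrow> (nat \<Rightarrow> 'a::finite pmf \<Rightarrow> complex mat) \<Rightarrow> nat \<Rightarrow> nat list \<Rightarrow>
     (nat \<Rightarrow> 'a list pmf) \<Rightarrow> real" where
  "code_leakage d' V J ts E =
     holevo (d' ^ length ts) {1..J} (pmf_of_set {1..J}) (\<lambda>j. word_channel d' V ts (E j))"

type_synonym 'a det_code = "(nat \<Rightarrow> 'a list pmf) \<times> (nat \<Rightarrow> complex mat)"

text \<open>The set of deterministic codes is used as its own label set \<open>\<Lambda>\<close>.\<close>

definition rand_code ::
    "nat \<Rightarrow> nat \<Rightarrow> nat set \<Rightarrow> (nat \<Rightarrow> 'a::finite pmf \<Rightarrow> complex mat) \<Rightarrow>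
     (nat \<Rightarrow> 'a pmf \<Rightarrow> complex mat) \<Rightarrow> nat \<Rightarrow> nat \<Rightarrow> 'a det_code measure \<Rightarrow> bool" where
  "rand_code d d' \<theta> W V n J G \<longleftrightarrow>
     prob_space G \<and> space G = encoders n J \<times> decoders d n J \<and>
     (\<forall>ts \<in> nlists n \<theta>.
        (\<lambda>(E, D). code_error d W J ts E D) \<in> borel_measurable G \<and>
        (\<lambda>(E, D). code_leakage d' V J ts E) \<in> borel_measurable G)"

definition corr_code ::
    "nat \<Rightarrow> nat \<Rightarrow> nat \<Rightarrow> ('x::finite list \<Rightarrow> nat \<Rightarrow> 'a::finite list pmf) \<Rightarrow>
     ('y::finite list \<Rightarrow> nat \<Rightarrow> complex mat) \<Rightarrow> bool" where
  "corr_code d n J E D \<longleftrightarrow>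
     (\<forall>xs \<in> nlists n UNIV. E xs \<in> encoders n J) \<and>
     (\<forall>ys \<in> nlists n UNIV. D ys \<in> decoders d n J)"

definition word_prob :: "('x \<times> 'y) pmf \<Rightarrow> 'x list \<Rightarrow> 'y list \<Rightarrow> real" where
  "word_prob p xs ys = (\<Prod>i<length xs. pmf p (xs ! i, ys ! i))"

section \<open>Capacities\<close>

definition rand_achievable ::
    "nat \<Rightarrow> nat \<Rightarrow> nat set \<Rightarrow> (nat \<Rightarrow> 'a::finite pmf \<Rightarrow> complex mat) \<Rightarrow>
     (nat \<Rightarrow> 'a pmf \<Rightarrow> complex mat) \<Rightarrow> real \<Rightarrow> bool" where
  "rand_achievable d d' \<theta> W V R \<longleftrightarrow> 0 \<le> R \<and>
     (\<forall>\<epsilon>>0. \<forall>\<delta>>0. \<forall>\<zeta>>0. \<forall>\<^sub>F n in sequentially. \<exists>J\<ge>1. \<exists>G.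
        rand_code d d' \<theta> W V n J G \<and>
        log 2 (real J) / real n > R - \<delta> \<and>
        (MAX ts\<in>nlists n \<theta>. \<integral>(E, D). code_error d W J ts E D \<partial>G) < \<epsilon> \<and>
        (MAX ts\<in>nlists n \<theta>. \<integral>(E, D). code_leakage d' V J ts E \<partial>G) < \<zeta>)"

definition corr_achievable ::
    "nat \<Rightarrow> nat \<Rightarrow> nat set \<Rightarrow> (nat \<Rightarrow> 'a::finite pmf \<Rightarrow> complex mat) \<Rightarrow>
     (nat \<Rightarrow> 'a pmf \<Rightarrow> complex mat) \<Rightarrow> ('x::finite \<times> 'y::finite) pmf \<Rightarrow> real \<Rightarrow> bool" where
  "corr_achievable d d' \<theta> W V p R \<longleftrightarrow> 0 \<le> R \<and>
     (\<forall>\<epsilon>>0. \<forall>\<delta>>0. \<forall>\<zeta>>0. \<forall>\<^sub>F n in sequentially. \<exists>J\<ge>1. \<exists>E D.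
        corr_code d n J E D \<and>
        log 2 (real J) / real n > R - \<delta> \<and>
        (MAX ts\<in>nlists n \<theta>. \<Sum>xs\<in>nlists n UNIV. \<Sum>ys\<in>nlists n UNIV.
           word_prob p xs ys * code_error d W J ts (E xs) (D ys)) < \<epsilon> \<and>
        (MAX ts\<in>nlists n \<theta>. \<Sum>xs\<in>nlists n UNIV. \<Sum>ys\<in>nlists n UNIV.
           word_prob p xs ys * code_leakage d' V J ts (E xs)) < \<zeta>)"

text \<open>The suprema are taken in the extended reals, where they exist without a boundedness proof.\<close>

definition rand_secrecy_capacity ::
    "nat \<Rightarrow> nat \<Rightarrow> nat set \<Rightarrow> (nat \<Rightarrow> 'a::finite pmf \<Rightarrow> complex mat) \<Rightarrow>
     (nat \<Rightarrow> 'a pmf \<Rightarrow> complex mat) \<Rightarrow> ereal" where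
  "rand_secrecy_capacity d d' \<theta> W V = (SUP R\<in>{R. rand_achievable d d' \<theta> W V R}. ereal R)"

definition corr_secrecy_capacity ::
    "nat \<Rightarrow> nat \<Rightarrow> nat set \<Rightarrow> (nat \<Rightarrow> 'a::finite pmf \<Rightarrow> complex mat) \<Rightarrow>
     (nat \<Rightarrow> 'a pmf \<Rightarrow> complex mat) \<Rightarrow> ('x::finite \<times> 'y::finite) pmf \<Rightarrow> ereal" where
  "corr_secrecy_capacity d d' \<theta> W V p = (SUP R\<in>{R. corr_achievable d d' \<theta> W V p R}. ereal R)"

end

theory Submission
  imports Defs
begin

text \<open>
  A correlation-assisted code is a randomness-assisted one whose random index is the pair of source
  words, so only the converse inequality needs an argument, and only at rates \<open>R > 0\<close>.

  A positive randomness-assisted rate forces that no mixture \<open>\<Sum>\<^sub>t q\<^sub>t W\<^sub>t\<close> has constant output.  A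
  minimiser of the Gram quadratic form of the centred channels over the simplex of mixtures then
  yields Hermitian \<open>M\<^sub>a\<close> with \<open>\<Sum>\<^sub>a M\<^sub>a = 0\<close> and \<open>\<Sum>\<^sub>a tr (W\<^sub>t(a) M\<^sub>a) \<ge> c > 0\<close> for all \<open>t\<close>.
  Since \<open>I(X;Y) > 0\<close>, there are bounded centred functions \<open>f\<close>, \<open>g\<close> with \<open>E f(X) g(Y) > 0\<close>.  Using one
  correlated pair of letters per input letter \<open>a\<close>, the sender perturbs the uniform input
  distribution by \<open>\<plusminus> f(x\<^sub>a)\<close> and the receiver measures a perturbation of \<open>1/2\<close> by
  \<open>\<Sum>\<^sub>a g(y\<^sub>a) M\<^sub>a\<close>; the outcome is biased towards the transmitted bit whatever the jammer does.
  Repetition and a majority vote transmit a bit with exponentially small error.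

  The sender draws \<open>k \<approx> n\<^sup>1\<^sup>/\<^sup>4\<close> key bits from his own source letters and transmits them in this way on
  a prefix of \<open>O(k\<^sup>2) = o(n)\<close> letters.  The key selects one of \<open>2\<^sup>k\<close> codes drawn from the
  randomness-assisted code; as the collision probability of the key is exponentially small in \<open>k\<close>
  and the leakage is at most linear in \<open>n\<close>, Hoeffding's lemma shows that a suitable choice of codes
  works for all \<open>t\<^sup>n\<close> at once.  Because the key is a function of \<open>x\<^sup>n\<close>, the leakage is averaged
  over it, and additivity of the entropy on product states removes the prefix from the leakage.
\<close>

section \<open>Matrices\<close>

text \<open>The obstacle is the jammer. A deterministic code can fail at positive
  randomness-assisted capacity, namely when jamming imitates valid inputs, and positive mutual
  information need not give even one bit on which both parties agree from the source alone. The
  source is therefore used twice: letters of the sender provide the key, and further letter pairs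
  give the detector a reference that is independent of the jamming word. The key may be public: the
  leakage criterion averages over source words, so it already grants the wiretapper the key, and
  only the selected code has to hide the message.

  The key length is squeezed from both sides. One choice of codes must serve all jamming words of
  length n. The union bound costs the logarithm of their number, linear in n, and the squared range
  of the leakage contributes n^2, so the collision probability has to beat n^3 and k has to dominate
  log n. Each key bit is repeated about k times to make the whole key reliable, so the prefix has
  order k^2 and k must stay below the order of sqrt n. The exponent 1/4 meets both demands and keeps
  n polynomially bounded in k.\<close>

lemma mat_mult_entry:
  assumes "i < dim_row A" "j < dim_col B" "dim_col A = dim_row B"
  shows "(A * B) $$ (i, j) = (\<Sum>k<dim_row B. A $$ (i, k) * B $$ (k, j))"
  using assms by (simp add: scalar_prod_def atLeast0LessThan)

lemma mat_mult_entry_carrier: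
  assumes "A \<in> carrier_mat n m" "B \<in> carrier_mat m l" "i < n" "j < l"
  shows "(A * B) $$ (i, j) = (\<Sum>k<m. A $$ (i, k) * B $$ (k, j))"
  using assms mat_mult_entry[of i A j B] by auto

lemma dim_mat_adjoint [simp]: "dim_row (mat_adjoint A) = dim_col A" "dim_col (mat_adjoint A) = dim_row A"
  by (auto simp: mat_adjoint_def)

lemma mat_adjoint_carrier [simp, intro]: "A \<in> carrier_mat n m \<Longrightarrow> mat_adjoint A \<in> carrier_mat m n"
  by (auto intro!: carrier_matI)

lemma mat_adjoint_entry [simp]:
  "i < dim_col A \<Longrightarrow> j < dim_row A \<Longrightarrow> mat_adjoint A $$ (i, j) = conjugate (A $$ (j, i))"
  by (auto simp: mat_adjoint_def mat_of_rows_index)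

lemma mat_adjoint_mult:
  fixes A B :: "complex mat"
  assumes "A \<in> carrier_mat n m" "B \<in> carrier_mat m l"
  shows "mat_adjoint (A * B) = mat_adjoint B * mat_adjoint A"
proof (rule eq_matI)
  fix i j assume "i < dim_row (mat_adjoint B * mat_adjoint A)" "j < dim_col (mat_adjoint B * mat_adjoint A)"
  with assms have ij: "i < l" "j < n" by auto
  have "mat_adjoint (A * B) $$ (i, j) = cnj (\<Sum>k<m. A $$ (j, k) * B $$ (k, i))"
    using assms ij by (subst mat_adjoint_entry) (auto simp: mat_mult_entry simp del: index_mult_mat(1))
  also have "\<dots> = (\<Sum>k<m. mat_adjoint B $$ (i, k) * mat_adjoint A $$ (k, j))"
    using assms ij by (auto simp: mult.commute intro!: sum.cong)
  also have "\<dots> = (mat_adjoint B * mat_adjoint A) $$ (i, j)"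
    using assms ij by (intro mat_mult_entry_carrier[symmetric]) auto
  finally show "mat_adjoint (A * B) $$ (i, j) = (mat_adjoint B * mat_adjoint A) $$ (i, j)" .
qed (use assms in auto)

lemma mat_adjoint_adjoint [simp]: "mat_adjoint (mat_adjoint A) = (A :: complex mat)"
  by (rule eq_matI) auto

lemma mat_trace_mult:
  assumes "A \<in> carrier_mat n m" "B \<in> carrier_mat m n"
  shows "mat_trace (A * B) = (\<Sum>i<n. \<Sum>k<m. A $$ (i, k) * B $$ (k, i))"
  unfolding mat_trace_def using assms by (auto intro!: sum.cong simp: mat_mult_entry simp del: index_mult_mat(1))

lemma mat_trace_mult_comm:
  assumes "A \<in> carrier_mat n m" "B \<in> carrier_mat m n"
  shows "mat_trace (A * B) = mat_trace (B * A)"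
proof -
  have "mat_trace (A * B) = (\<Sum>i<n. \<Sum>k<m. B $$ (k, i) * A $$ (i, k))"
    using mat_trace_mult[OF assms] by (simp add: mult.commute)
  also have "\<dots> = mat_trace (B * A)"
    unfolding mat_trace_mult[OF assms(2,1)] by (rule sum.swap)
  finally show ?thesis .
qed

subsection \<open>The spectral theorem\<close>

text \<open>This is the condition under the description operator in \<open>hermitian_fun\<close>,
  with real \<open>e\<close>, so each diagonalisation feeds the functional calculus. One-sided
  unitarity implies the two-sided one, as the matrices are square.\<close>

definition diagonalizes :: "nat \<Rightarrow> complex mat \<Rightarrow> complex mat \<Rightarrow> (nat \<Rightarrow> real) \<Rightarrow> bool" where
  "diagonalizes d A U e \<longleftrightarrow> U \<in> carrier_mat d d \<and> mat_adjoint U * U = 1\<^sub>m d \<and>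
     A = U * mat_diag d (\<lambda>i. complex_of_real (e i)) * mat_adjoint U"

lemma unitary_right_inverse:
  assumes "U \<in> carrier_mat d d" "mat_adjoint U * U = 1\<^sub>m d"
  shows "U * mat_adjoint U = (1\<^sub>m d :: complex mat)"
  using assms by (intro mat_mult_left_right_inverse[of "mat_adjoint U" d U]) auto

text \<open>Sums over entries are the form in which index 0 can be split off, as the induction of
  the spectral theorem requires.\<close>

lemma diagonalizes_iff_entries:
  assumes "A \<in> carrier_mat d d" "U \<in> carrier_mat d d"
  shows "diagonalizes d A U e \<longleftrightarrow>
    (\<forall>i<d. \<forall>j<d. (\<Sum>k<d. cnj (U $$ (k, i)) * U $$ (k, j)) = of_bool (i = j)) \<and>
    (\<forall>i<d. \<forall>j<d. A $$ (i, j) = (\<Sum>k<d. U $$ (i, k) * complex_of_real (e k) * cnj (U $$ (j, k))))"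
proof -
  let ?D = "mat_diag d (\<lambda>i. complex_of_real (e i))"
  have ent: "(mat_adjoint U * U) $$ (i, j) = (\<Sum>k<d. cnj (U $$ (k, i)) * U $$ (k, j))"
    if "i < d" "j < d" for i j
    using that assms by (subst mat_mult_entry_carrier[of _ d d _ d]) (auto intro!: sum.cong)
  have one: "mat_adjoint U * U = 1\<^sub>m d \<longleftrightarrow>
    (\<forall>i<d. \<forall>j<d. (\<Sum>k<d. cnj (U $$ (k, i)) * U $$ (k, j)) = of_bool (i = j))"
  proof
    assume "mat_adjoint U * U = 1\<^sub>m d"
    thus "\<forall>i<d. \<forall>j<d. (\<Sum>k<d. cnj (U $$ (k, i)) * U $$ (k, j)) = of_bool (i = j)"
      using ent by (auto simp: of_bool_def)
  next
    assume *: "\<forall>i<d. \<forall>j<d. (\<Sum>k<d. cnj (U $$ (k, i)) * U $$ (k, j)) = of_bool (i = j)"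
    show "mat_adjoint U * U = 1\<^sub>m d"
      by (rule eq_matI) (use * ent assms in \<open>auto simp del: index_mult_mat(1)\<close>)
  qed
  have D: "U * ?D \<in> carrier_mat d d" "U * ?D * mat_adjoint U \<in> carrier_mat d d"
    using assms by auto
  have ent2: "(U * ?D * mat_adjoint U) $$ (i, j) =
      (\<Sum>k<d. U $$ (i, k) * complex_of_real (e k) * cnj (U $$ (j, k)))"
    if "i < d" "j < d" for i j
    using that assms D(1)
    by (subst mat_mult_entry_carrier[of _ d d _ d])
       (auto intro!: sum.cong simp: mat_diag_mult_right[of U d d])
  have two: "A = U * ?D * mat_adjoint U \<longleftrightarrow>
    (\<forall>i<d. \<forall>j<d. A $$ (i, j) = (\<Sum>k<d. U $$ (i, k) * complex_of_real (e k) * cnj (U $$ (j, k))))"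
  proof
    assume *: "\<forall>i<d. \<forall>j<d. A $$ (i, j) = (\<Sum>k<d. U $$ (i, k) * complex_of_real (e k) * cnj (U $$ (j, k)))"
    show "A = U * ?D * mat_adjoint U"
      by (rule eq_matI) (use * ent2 D assms in \<open>auto simp del: index_mult_mat(1)\<close>)
  qed (use ent2 in auto)
  show ?thesis unfolding diagonalizes_def using one two assms(2) by blast
qed

lemma diagonalizes_conj:
  assumes U: "U \<in> carrier_mat d d" "mat_adjoint U * U = 1\<^sub>m d" and A: "A \<in> carrier_mat d d"
    and "diagonalizes d (mat_adjoint U * A * U) V e"
  shows "diagonalizes d A (U * V) e"
proof -
  let ?D = "mat_diag d (\<lambda>i. complex_of_real (e i))"
  have V: "V \<in> carrier_mat d d" "mat_adjoint V * V = 1\<^sub>m d" "mat_adjoint U * A * U = V * ?D * mat_adjoint V"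
    using assms(4) by (auto simp: diagonalizes_def)
  note [simp] = U(1) V(1) A mult_carrier_mat[of _ d d _ d] right_mult_one_mat[of _ d d] left_mult_one_mat[of _ d d]
  note assoc = assoc_mult_mat[of _ d d _ d _ d]
  have UU: "U * mat_adjoint U = 1\<^sub>m d" using unitary_right_inverse[OF U] .
  have adj: "mat_adjoint (U * V) = mat_adjoint V * mat_adjoint U"
    by (rule mat_adjoint_mult[of _ d d _ d]) auto
  have "mat_adjoint (U * V) * (U * V) = mat_adjoint V * (mat_adjoint U * U) * V"
    by (simp add: adj assoc)
  also have "\<dots> = 1\<^sub>m d" using U(2) V(2) by simp
  finally have 1: "mat_adjoint (U * V) * (U * V) = 1\<^sub>m d" .
  have "(U * V) * ?D * mat_adjoint (U * V) = U * (V * ?D * mat_adjoint V) * mat_adjoint U"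
    by (simp add: adj assoc)
  also have "\<dots> = (U * mat_adjoint U) * A * (U * mat_adjoint U)"
    unfolding V(3)[symmetric] by (simp add: assoc)
  also have "\<dots> = A" unfolding UU by simp
  finally show ?thesis using 1 by (simp add: diagonalizes_def)
qed

text \<open>A root of the characteristic polynomial gives an eigenvector; completing it to a basis
  and orthogonalising keeps it as the first vector.\<close>

lemma eigenvector_unitary_completion:
  fixes A :: "complex mat"
  assumes A: "A \<in> carrier_mat (Suc n) (Suc n)"
  shows "\<exists>U e. U \<in> carrier_mat (Suc n) (Suc n) \<and> mat_adjoint U * U = 1\<^sub>m (Suc n) \<and>
    (\<forall>i\<le>n. (A * U) $$ (i, 0) = e * U $$ (i, 0))"
proof -
  let ?d = "Suc n"
  obtain es where es: "char_poly A = (\<Prod>a\<leftarrow>es. [:- a, 1:])" "length es = ?d"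
    using char_poly_factorized[OF A] by auto
  then obtain e es' where "es = e # es'" by (cases es) auto
  hence "poly (char_poly A) e = 0" using es by simp
  hence "eigenvalue A e" using eigenvalue_root_char_poly[OF A] by simp
  then obtain v where "eigenvector A v e" by (auto simp: eigenvalue_def)
  hence v: "v \<in> carrier_vec ?d" "v \<noteq> 0\<^sub>v ?d" "A *\<^sub>v v = e \<cdot>\<^sub>v v"
    using A by (auto simp: eigenvector_def)
  interpret cof_vec_space ?d "TYPE(complex)" .
  define b where "b = basis_completion v"
  define ws where "ws = gram_schmidt ?d b"
  from basis_completion[OF v(1,2), folded b_def]
  have span_b: "span (set b) = carrier_vec ?d" and dist_b: "distinct b" 
    and indep: "\<not> lin_dep (set b)" and b: "set b \<subseteq> carrier_vec ?d" and hdb: "hd b = v" 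
    and len_b: "length b = ?d" by auto
  from hdb len_b obtain vs where bv: "b = v # vs" by (cases b, auto)
  from gram_schmidt_result[OF b dist_b indep refl, folded ws_def]
  have ws: "set ws \<subseteq> carrier_vec ?d" "corthogonal ws" "length ws = ?d" 
    by (auto simp: len_b)
  from gram_schmidt_hd[OF v(1), of vs, folded bv] have hdws: "hd ws = v" unfolding ws_def .
  \<comment> \<open>The family \<open>ws\<close> is orthogonal but not normalised;
    \<open>r j\<close> is the squared norm of its j-th member, and \<open>U\<close> has the
    normalised vectors as columns.\<close>
  define r where "r j = (\<Sum>k<?d. (cmod ((ws ! j) $ k))\<^sup>2)" for j
  define U where "U = Matrix.mat ?d ?d (\<lambda>(i, j). (ws ! j) $ i / complex_of_real (sqrt (r j)))"
  have wsc: "ws ! j \<in> carrier_vec ?d" if "j < ?d" for j using ws that by auto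
  have ip: "(\<Sum>k<?d. cnj ((ws ! i) $ k) * (ws ! j) $ k) = (if i = j then complex_of_real (r i) else 0)"
    if "i < ?d" "j < ?d" for i j
  proof (cases "i = j")
    case True
    thus ?thesis by (simp add: r_def mult.commute complex_norm_square del: of_real_power sum.lessThan_Suc)
  next
    case False
    have "(\<Sum>k<?d. cnj ((ws ! i) $ k) * (ws ! j) $ k) = (ws ! j) \<bullet>c (ws ! i)"
      using wsc[OF that(1)] wsc[OF that(2)]
      by (auto simp: scalar_prod_def atLeast0LessThan mult.commute simp del: sum.lessThan_Suc intro!: sum.cong)
    also have "\<dots> = 0" using ws(2) that False ws(3) by (auto simp: corthogonal_def)
    finally show ?thesis using False by simp
  qed
  have rpos: "r j > 0" if "j < ?d" for j
  proof -
    have "(ws ! j) \<bullet>c (ws ! j) \<noteq> 0" using ws(2,3) that by (auto simp: corthogonal_def)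
    moreover have "(ws ! j) \<bullet>c (ws ! j) = (\<Sum>k<?d. cnj ((ws ! j) $ k) * (ws ! j) $ k)"
      using wsc[OF that]
      by (auto simp: scalar_prod_def atLeast0LessThan mult.commute simp del: sum.lessThan_Suc intro!: sum.cong)
    ultimately have "r j \<noteq> 0" using ip[OF that that] by auto
    moreover have "r j \<ge> 0" unfolding r_def by (intro sum_nonneg) auto
    ultimately show ?thesis by simp
  qed
  have Uc: "U \<in> carrier_mat ?d ?d" by (simp add: U_def)
  have UU: "mat_adjoint U * U = 1\<^sub>m ?d"
  proof (rule eq_matI)
    fix i j assume "i < dim_row (1\<^sub>m ?d)" "j < dim_col (1\<^sub>m ?d)"
    hence ij: "i < ?d" "j < ?d" by auto
    have "(mat_adjoint U * U) $$ (i, j) = (\<Sum>k<?d. cnj (U $$ (k, i)) * U $$ (k, j))"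
      using ij Uc by (subst mat_mult_entry_carrier[of _ ?d ?d _ ?d]) (auto intro!: sum.cong simp del: sum.lessThan_Suc)
    also have "\<dots> = (\<Sum>k<?d. cnj ((ws ! i) $ k) * (ws ! j) $ k / complex_of_real (sqrt (r i) * sqrt (r j)))"
      using ij by (intro sum.cong) (auto simp: U_def)
    also have "\<dots> = (\<Sum>k<?d. cnj ((ws ! i) $ k) * (ws ! j) $ k) / complex_of_real (sqrt (r i) * sqrt (r j))"
      by (simp only: sum_divide_distrib)
    also have "\<dots> = 1\<^sub>m ?d $$ (i, j)"
      unfolding ip[OF ij] using ij rpos[OF ij(1)] by (auto simp flip: of_real_mult)
    finally show "(mat_adjoint U * U) $$ (i, j) = 1\<^sub>m ?d $$ (i, j)" .
  qed (use Uc in auto)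
  have ws0: "ws ! 0 = v" using hdws ws(3) by (cases ws) auto
  have "(A * U) $$ (i, 0) = e * U $$ (i, 0)" if "i \<le> n" for i
  proof -
    have i: "i < ?d" using that by simp
    have "(A * U) $$ (i, 0) = (\<Sum>k<?d. A $$ (i, k) * (v $ k)) / complex_of_real (sqrt (r 0))"
      using i A Uc ws0 by (subst mat_mult_entry_carrier[of _ ?d ?d _ ?d])
       (auto intro!: sum.cong simp: U_def sum_divide_distrib simp del: sum.lessThan_Suc)
    also have "(\<Sum>k<?d. A $$ (i, k) * (v $ k)) = (A *\<^sub>v v) $ i"
      using A v(1) i by (auto simp: scalar_prod_def atLeast0LessThan intro!: sum.cong simp del: sum.lessThan_Suc)
    also have "\<dots> = e * v $ i" using v i by simp
    finally show ?thesis using i ws0 by (simp add: U_def)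
  qed
  thus ?thesis using Uc UU by blast
qed

text \<open>In a unitary basis beginning with an eigenvector, column 0 of the conjugated matrix
  vanishes below the diagonal. Hermiticity then clears row 0 and makes the eigenvalue real, so the
  remaining block is Hermitian and the induction hypothesis applies to it.\<close>

lemma hermitian_diagonalizable:
  fixes A :: "complex mat"
  assumes "A \<in> carrier_mat d d" "mat_adjoint A = A"
  shows "\<exists>U e. diagonalizes d A U e"
  using assms
proof (induction d arbitrary: A)
  case 0
  hence "diagonalizes 0 A (1\<^sub>m 0) (\<lambda>_. 0)"
    by (subst diagonalizes_iff_entries) auto
  thus ?case by blast
next
  case (Suc n A)
  let ?d = "Suc n"
  note A = Suc.prems(1)
  obtain U e where U: "U \<in> carrier_mat ?d ?d" "mat_adjoint U * U = 1\<^sub>m ?d"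
    and ev: "\<And>i. i \<le> n \<Longrightarrow> (A * U) $$ (i, 0) = e * U $$ (i, 0)"
    using eigenvector_unitary_completion[OF A] by blast
  define A' where "A' = mat_adjoint U * A * U"
  have A': "A' \<in> carrier_mat ?d ?d" using A U(1) by (auto simp: A'_def)
  have herm: "mat_adjoint A' = A'"
  proof -
    have "mat_adjoint A' = mat_adjoint U * mat_adjoint (mat_adjoint U * A)"
      unfolding A'_def using A U by (intro mat_adjoint_mult[of _ ?d ?d _ ?d]) auto
    also have "mat_adjoint (mat_adjoint U * A) = mat_adjoint A * U"
      using A U by (subst mat_adjoint_mult[of _ ?d ?d _ ?d]) auto
    finally show ?thesis using Suc.prems A U assoc_mult_mat[of "mat_adjoint U" ?d ?d A ?d U ?d]
      by (auto simp: A'_def)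
  qed
  have hermE: "A' $$ (i, j) = cnj (A' $$ (j, i))" if "i < ?d" "j < ?d" for i j
    using that A' arg_cong[OF herm, of "\<lambda>M. M $$ (i, j)"] by simp
  have col0: "A' $$ (i, 0) = e * of_bool (i = 0)" if "i < ?d" for i
  proof -
    have "A' = mat_adjoint U * (A * U)" 
      unfolding A'_def using A U by (intro assoc_mult_mat[of _ ?d ?d _ ?d _ ?d]) auto
    hence "A' $$ (i, 0) = (\<Sum>k<?d. mat_adjoint U $$ (i, k) * (A * U) $$ (k, 0))"
      using A U that by (subst mat_mult_entry_carrier[of _ ?d ?d _ ?d, symmetric]) auto
    also have "\<dots> = (\<Sum>k<?d. e * (mat_adjoint U $$ (i, k) * U $$ (k, 0)))"
      by (intro sum.cong) (auto simp: ev)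
    also have "\<dots> = e * (mat_adjoint U * U) $$ (i, 0)"
      using U that by (subst mat_mult_entry_carrier[of _ ?d ?d _ ?d]) (auto simp: sum_distrib_left simp del: sum.lessThan_Suc)
    finally show ?thesis using U that by auto
  qed
  have row0: "A' $$ (0, i) = 0" if "i < ?d" "i \<noteq> 0" for i
    using hermE[of 0 i] col0[of i] that by simp
  define A3 where "A3 = Matrix.mat n n (\<lambda>(i, j). A' $$ (Suc i, Suc j))"
  have "mat_adjoint A3 = A3"
    by (rule eq_matI) (auto simp: A3_def hermE[symmetric])
  then obtain V f where V: "diagonalizes n A3 V f"
    using Suc.IH[of A3] by (auto simp: A3_def)
  have Vc: "V \<in> carrier_mat n n" using V by (simp add: diagonalizes_def)
  have A3c: "A3 \<in> carrier_mat n n" by (simp add: A3_def)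
  from V[unfolded diagonalizes_iff_entries[OF A3c Vc]]
  have V1: "(\<Sum>k<n. cnj (V $$ (k, i)) * V $$ (k, j)) = of_bool (i = j)" 
    and V2: "A3 $$ (i, j) = (\<Sum>k<n. V $$ (i, k) * complex_of_real (f k) * cnj (V $$ (j, k)))"
    if "i < n" "j < n" for i j using that by auto
  define V' where "V' = Matrix.mat ?d ?d (\<lambda>(i, j). if i = 0 \<or> j = 0 then of_bool (i = j) else V $$ (i - 1, j - 1))"
  define f' where "f' i = (if i = 0 then Re e else f (i - 1))" for i
  have e: "complex_of_real (Re e) = e"
    using hermE[of 0 0] col0[of 0] by (simp add: complex_eq_iff)
  have V'0: "V' $$ (0, j) = of_bool (0 = j)" "V' $$ (j, 0) = of_bool (j = 0)" if "j < ?d" for j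
    using that by (auto simp: V'_def)
  have V'S: "V' $$ (Suc i, Suc j) = V $$ (i, j)" if "i < n" "j < n" for i j
    using that by (auto simp: V'_def)
  have "diagonalizes ?d A' V' f'"
  proof (subst diagonalizes_iff_entries[OF A'], goal_cases)
    case 1 show ?case by (simp add: V'_def)
  next
    case 2
    show ?case
    proof (intro conjI allI impI)
      fix i j assume ij: "i < ?d" "j < ?d"
      show "(\<Sum>k<?d. cnj (V' $$ (k, i)) * V' $$ (k, j)) = of_bool (i = j)"
        using ij V1 unfolding sum.lessThan_Suc_shift
        by (cases i; cases j) (auto simp: V'0 V'S cong: sum.cong_simp)
      show "A' $$ (i, j) = (\<Sum>k<?d. V' $$ (i, k) * complex_of_real (f' k) * cnj (V' $$ (j, k)))"
        using ij V2 unfolding sum.lessThan_Suc_shift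
        by (cases i; cases j) (auto simp: V'0 V'S f'_def e col0 row0 A3_def cong: sum.cong_simp)
    qed
  qed
  thus ?case using diagonalizes_conj[OF U A] by (auto simp: A'_def)
qed

section \<open>Positive operators as sums of rank-one terms\<close>

lemma sum_mult_delta:
  fixes f :: "nat \<Rightarrow> complex"
  assumes "i < d"
  shows "(\<Sum>l<d. f l * of_bool (l = i)) = f i" "(\<Sum>l<d. of_bool (l = i) * f l) = f i"
proof -
  have "{..<d} \<inter> {l. l = i} = {i}" using assms by auto
  thus "(\<Sum>l<d. f l * of_bool (l = i)) = f i" "(\<Sum>l<d. of_bool (l = i) * f l) = f i"
    by (simp_all add: sum_mult_of_bool_eq sum_of_bool_mult_eq)
qed

lemma cnj_of_bool [simp]: "cnj (of_bool b) = of_bool b"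
  by (simp add: of_bool_def)

lemma quadratic_form_expand:
  assumes "A \<in> carrier_mat d d" "v \<in> carrier_vec d"
  shows "(A *\<^sub>v v) \<bullet>c v = (\<Sum>i<d. \<Sum>j<d. cnj (v $ i) * A $$ (i, j) * v $ j)"
  using assms
  by (auto simp: scalar_prod_def atLeast0LessThan sum_distrib_right sum_distrib_left mult_ac intro!: sum.cong)

text \<open>Arbitrary functions replace carrier vectors, so that test vectors such as
  \<open>\<lambda>k. of_bool (k = i)\<close> can be inserted without side conditions.\<close>

lemma positive_op_iff_sum:
  "positive_op d A \<longleftrightarrow> A \<in> carrier_mat d d \<and>
    (\<forall>v. 0 \<le> (\<Sum>i<d. \<Sum>j<d. cnj (v i) * A $$ (i, j) * v j))"
proof (cases "A \<in> carrier_mat d d")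
  case True
  have "(\<forall>v\<in>carrier_vec d. 0 \<le> (A *\<^sub>v v) \<bullet>c v) \<longleftrightarrow>
        (\<forall>v. 0 \<le> (\<Sum>i<d. \<Sum>j<d. cnj (v i) * A $$ (i, j) * v j))"
  proof (intro iffI allI ballI)
    fix v :: "nat \<Rightarrow> complex" assume "\<forall>v\<in>carrier_vec d. 0 \<le> (A *\<^sub>v v) \<bullet>c v"
    from bspec[OF this, of "Matrix.vec d v"] quadratic_form_expand[OF True, of "Matrix.vec d v"]
    show "0 \<le> (\<Sum>i<d. \<Sum>j<d. cnj (v i) * A $$ (i, j) * v j)" by simp
  next
    fix v :: "complex Matrix.vec"
    assume "\<forall>v. 0 \<le> (\<Sum>i<d. \<Sum>j<d. cnj (v i) * A $$ (i, j) * v j)" "v \<in> carrier_vec d"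
    thus "0 \<le> (A *\<^sub>v v) \<bullet>c v" using quadratic_form_expand[OF True] by simp
  qed
  thus ?thesis using True by (simp add: positive_op_def)
qed (simp add: positive_op_def)

lemma positive_op_carrier: "positive_op d A \<Longrightarrow> A \<in> carrier_mat d d"
  by (simp add: positive_op_def)

text \<open>Polarisation: the quadratic form is real at \<open>e\<^sub>i + e\<^sub>j\<close> and at \<open>e\<^sub>i + \<i> e\<^sub>j\<close>.\<close>

lemma positive_op_hermitian_entry:
  assumes "positive_op d A" "i < d" "j < d"
  shows "A $$ (i, j) = cnj (A $$ (j, i))"
proof (cases "i = j")
  case True
  have *: "(\<Sum>k<d. \<Sum>l<d. cnj (of_bool (k = i)) * A $$ (k, l) * of_bool (l = i)) = A $$ (i, i)"
    by (simp only: cnj_of_bool sum_mult_delta[OF assms(2)])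
  have "0 \<le> A $$ (i, i)" 
    using assms(1)[unfolded positive_op_iff_sum, THEN conjunct2, rule_format, of "\<lambda>k. of_bool (k = i)"]
    unfolding * .
  thus ?thesis using True by (simp add: complex_eq_iff less_eq_complex_def)
next
  case False
  let ?q = "\<lambda>v. \<Sum>k<d. \<Sum>l<d. cnj (v k) * A $$ (k, l) * v l"
  have q: "?q (\<lambda>k. of_bool (k = i) + c * of_bool (k = j)) =
     A $$ (i, i) + cnj c * c * A $$ (j, j) + c * A $$ (i, j) + cnj c * A $$ (j, i)" for c
  proof -
    let ?w = "\<lambda>k. of_bool (k = i) + c * of_bool (k = j)"
    have r: "(\<Sum>l<d. f l * ?w l) = f i + c * f j" for f
    proof -
      have "(\<Sum>l<d. f l * ?w l) = (\<Sum>l<d. f l * of_bool (l = i)) + (\<Sum>l<d. (f l * c) * of_bool (l = j))"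
        unfolding sum.distrib[symmetric] by (intro sum.cong refl) (simp only: distrib_left mult.assoc)
      thus ?thesis using assms sum_mult_delta(1)[of i d f] sum_mult_delta(1)[of j d "\<lambda>l. f l * c"]
        by simp
    qed
    have l: "(\<Sum>l<d. cnj (?w l) * f l) = f i + cnj c * f j" for f
    proof -
      have "(\<Sum>l<d. cnj (?w l) * f l) = cnj (\<Sum>l<d. cnj (f l) * ?w l)"
        by (simp add: mult.commute)
      thus ?thesis unfolding r by simp
    qed
    have "?q ?w = (\<Sum>k<d. cnj (?w k) * (A $$ (k, i) + c * A $$ (k, j)))"
      by (intro sum.cong refl) (simp only: mult.assoc sum_distrib_left[symmetric] r)
    also have "\<dots> = (A $$ (i, i) + c * A $$ (i, j)) + cnj c * (A $$ (j, i) + c * A $$ (j, j))"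
      by (rule l)
    also have "\<dots> = A $$ (i, i) + cnj c * c * A $$ (j, j) + c * A $$ (i, j) + cnj c * A $$ (j, i)"
      by (simp add: algebra_simps)
    finally show ?thesis .
  qed
  have q0: "?q (\<lambda>k. of_bool (k = l)) = A $$ (l, l)" if "l < d" for l
    by (simp only: cnj_of_bool sum_mult_delta[OF that])
  have pos: "Im (?q v) = 0" for v 
    using assms(1) unfolding positive_op_iff_sum less_eq_complex_def by simp
  have d0: "Im (A $$ (l, l)) = 0" if "l < d" for l
    using pos[of "\<lambda>k. of_bool (k = l)"] unfolding q0[OF that] by simp
  from pos[of "\<lambda>k. of_bool (k = i) + 1 * of_bool (k = j)"] 
       pos[of "\<lambda>k. of_bool (k = i) + \<i> * of_bool (k = j)"] d0[OF assms(2)] d0[OF assms(3)]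
  show ?thesis unfolding q by (simp add: complex_eq_iff)
qed

lemma positive_op_hermitian:
  assumes "positive_op d A"
  shows "mat_adjoint A = A"
proof -
  have c: "A \<in> carrier_mat d d" using assms by (rule positive_op_carrier)
  show ?thesis
    by (rule eq_matI) (use c positive_op_hermitian_entry[OF assms, symmetric] in auto)
qed

text \<open>The matrix in the middle is a sum of rank-one operators, one for each
  \<open>u k\<close>; each contributes the squared modulus of its inner product with
  \<open>v\<close>, whence positivity.\<close>

lemma quadratic_form_gram:
  fixes u :: "'k \<Rightarrow> nat \<Rightarrow> complex"
  shows "(\<Sum>i<d. \<Sum>j<d. cnj (v i) * (\<Sum>k\<in>K. u k i * cnj (u k j)) * v j) =
    (\<Sum>k\<in>K. complex_of_real ((cmod (\<Sum>j<d. cnj (u k j) * v j))\<^sup>2))"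
proof -
  have "(\<Sum>i<d. \<Sum>j<d. cnj (v i) * (\<Sum>k\<in>K. u k i * cnj (u k j)) * v j) =
     (\<Sum>i<d. \<Sum>j<d. \<Sum>k\<in>K. (cnj (v i) * u k i) * (cnj (u k j) * v j))"
    by (simp add: sum_distrib_left sum_distrib_right mult_ac)
  also have "\<dots> = (\<Sum>i<d. \<Sum>k\<in>K. \<Sum>j<d. (cnj (v i) * u k i) * (cnj (u k j) * v j))"
    by (intro sum.cong refl sum.swap)
  also have "\<dots> = (\<Sum>k\<in>K. \<Sum>i<d. \<Sum>j<d. (cnj (v i) * u k i) * (cnj (u k j) * v j))"
    by (rule sum.swap)
  also have "\<dots> = (\<Sum>k\<in>K. (\<Sum>i<d. cnj (v i) * u k i) * (\<Sum>j<d. cnj (u k j) * v j))"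
    by (simp only: sum_product)
  also have "\<dots> = (\<Sum>k\<in>K. cnj (\<Sum>j<d. cnj (u k j) * v j) * (\<Sum>j<d. cnj (u k j) * v j))"
    by (simp add: mult.commute)
  also have "\<dots> = (\<Sum>k\<in>K. complex_of_real ((cmod (\<Sum>j<d. cnj (u k j) * v j))\<^sup>2))"
    by (intro sum.cong refl) (simp add: complex_norm_square mult.commute del: of_real_power)
  finally show ?thesis .
qed

lemma positive_op_gramI:
  fixes u :: "'k \<Rightarrow> nat \<Rightarrow> complex"
  assumes "A \<in> carrier_mat d d"
    and "\<And>i j. i < d \<Longrightarrow> j < d \<Longrightarrow> A $$ (i, j) = (\<Sum>k\<in>K. u k i * cnj (u k j))"
  shows "positive_op d A"
  unfolding positive_op_iff_sum
proof (intro conjI allI)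
  fix v :: "nat \<Rightarrow> complex"
  have "(\<Sum>i<d. \<Sum>j<d. cnj (v i) * A $$ (i, j) * v j) =
    (\<Sum>k\<in>K. complex_of_real ((cmod (\<Sum>j<d. cnj (u k j) * v j))\<^sup>2))"
    unfolding quadratic_form_gram[symmetric] using assms(2) by simp
  also have "\<dots> \<ge> 0" by (intro sum_nonneg) (simp add: less_eq_complex_def)
  finally show "(\<Sum>i<d. \<Sum>j<d. cnj (v i) * A $$ (i, j) * v j) \<ge> 0" .
qed (fact assms(1))

lemma positive_op_one: "positive_op d (1\<^sub>m d)"
proof (rule positive_op_gramI[where K = "{..<d}" and u = "\<lambda>k i. of_bool (k = i)"])
  fix i j assume "i < d" "j < d"
  thus "1\<^sub>m d $$ (i, j) = (\<Sum>k<d. of_bool (k = i) * cnj (of_bool (k = j)))"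
    using sum_mult_delta(2)[of i d "\<lambda>k. of_bool (k = j)"] by simp
qed auto

text \<open>Evaluating the quadratic form at the k-th column of \<open>U\<close> isolates the k-th
  eigenvalue; this is how positivity of the operator reaches its spectrum.\<close>

lemma diagonalizes_eigenvalue:
  assumes "diagonalizes d A U e" "k < d"
  shows "(\<Sum>i<d. \<Sum>j<d. cnj (U $$ (i, k)) * A $$ (i, j) * U $$ (j, k)) = complex_of_real (e k)"
proof -
  have U: "U \<in> carrier_mat d d" and A: "A \<in> carrier_mat d d" 
    using assms by (auto simp: diagonalizes_def)
  from assms(1)[unfolded diagonalizes_iff_entries[OF A U]]
  have 1: "(\<Sum>k<d. cnj (U $$ (k, i)) * U $$ (k, j)) = of_bool (i = j)" 
    and 2: "A $$ (i, j) = (\<Sum>k<d. U $$ (i, k) * complex_of_real (e k) * cnj (U $$ (j, k)))"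
    if "i < d" "j < d" for i j using that by auto
  have "(\<Sum>i<d. \<Sum>j<d. cnj (U $$ (i, k)) * A $$ (i, j) * U $$ (j, k)) =
     (\<Sum>i<d. \<Sum>j<d. \<Sum>l<d. complex_of_real (e l) * ((cnj (U $$ (i, k)) * U $$ (i, l)) * (cnj (U $$ (j, l)) * U $$ (j, k))))"
    by (intro sum.cong refl) (simp add: 2 sum_distrib_left sum_distrib_right mult_ac)
  also have "\<dots> = (\<Sum>i<d. \<Sum>l<d. \<Sum>j<d. complex_of_real (e l) * ((cnj (U $$ (i, k)) * U $$ (i, l)) * (cnj (U $$ (j, l)) * U $$ (j, k))))"
    by (intro sum.cong refl sum.swap)
  also have "\<dots> = (\<Sum>l<d. \<Sum>i<d. \<Sum>j<d. complex_of_real (e l) * ((cnj (U $$ (i, k)) * U $$ (i, l)) * (cnj (U $$ (j, l)) * U $$ (j, k))))"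
    by (rule sum.swap)
  also have "\<dots> = (\<Sum>l<d. complex_of_real (e l) * ((\<Sum>i<d. cnj (U $$ (i, k)) * U $$ (i, l)) * (\<Sum>j<d. cnj (U $$ (j, l)) * U $$ (j, k))))"
    by (simp only: sum_product sum_distrib_left[symmetric])
  also have "\<dots> = (\<Sum>l<d. complex_of_real (e l) * of_bool (l = k))"
    using assms(2) 1 by (intro sum.cong) auto
  also have "\<dots> = complex_of_real (e k)"
    by (simp add: sum_mult_delta assms(2))
  finally show ?thesis .
qed

lemma positive_op_diagonalizable:
  assumes "positive_op d A"
  shows "\<exists>U e. diagonalizes d A U e \<and> (\<forall>k<d. 0 \<le> e k)"
proof -
  obtain U e where *: "diagonalizes d A U e"
    using hermitian_diagonalizable[OF positive_op_carrier[OF assms] positive_op_hermitian[OF assms]] by blast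
  have "0 \<le> e k" if "k < d" for k
  proof -
    have "0 \<le> complex_of_real (e k)"
      using assms[unfolded positive_op_iff_sum, THEN conjunct2, rule_format, of "\<lambda>i. U $$ (i, k)"]
      unfolding diagonalizes_eigenvalue[OF * that] .
    thus ?thesis by (simp add: less_eq_complex_def)
  qed
  thus ?thesis using * by blast
qed

text \<open>The Gram vectors are the eigenvectors scaled by the square roots of the eigenvalues.
  Together with \<open>positive_op_gramI\<close> this makes positivity equivalent to having such a
  decomposition.\<close>

lemma positive_op_gramE:
  assumes "positive_op d A"
  obtains u :: "nat \<Rightarrow> nat \<Rightarrow> complex"
  where "\<And>i j. i < d \<Longrightarrow> j < d \<Longrightarrow> A $$ (i, j) = (\<Sum>k<d. u k i * cnj (u k j))"
proof -
  obtain U e where *: "diagonalizes d A U e" "\<And>k. k < d \<Longrightarrow> 0 \<le> e k"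
    using positive_op_diagonalizable[OF assms] by blast
  have U: "U \<in> carrier_mat d d" and A: "A \<in> carrier_mat d d" 
    using *(1) by (auto simp: diagonalizes_def)
  have "A $$ (i, j) = (\<Sum>k<d. (complex_of_real (sqrt (e k)) * U $$ (i, k)) * cnj (complex_of_real (sqrt (e k)) * U $$ (j, k)))"
    if "i < d" "j < d" for i j
  proof -
    have "A $$ (i, j) = (\<Sum>k<d. U $$ (i, k) * complex_of_real (e k) * cnj (U $$ (j, k)))"
      using *(1) that unfolding diagonalizes_iff_entries[OF A U] by blast
    also have "\<dots> = (\<Sum>k<d. (complex_of_real (sqrt (e k)) * U $$ (i, k)) * cnj (complex_of_real (sqrt (e k)) * U $$ (j, k)))"
    proof (intro sum.cong refl)
      fix k assume "k \<in> {..<d}"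
      hence "complex_of_real (sqrt (e k)) * complex_of_real (sqrt (e k)) = complex_of_real (e k)"
        using *(2)[of k] by (simp flip: of_real_mult)
      thus "U $$ (i, k) * complex_of_real (e k) * cnj (U $$ (j, k)) =
         (complex_of_real (sqrt (e k)) * U $$ (i, k)) * cnj (complex_of_real (sqrt (e k)) * U $$ (j, k))"
        by (simp add: mult_ac)
    qed
    finally show ?thesis .
  qed
  thus ?thesis using that[of "\<lambda>k i. complex_of_real (sqrt (e k)) * U $$ (i, k)"] by blast
qed

text \<open>Once \<open>A\<close> is expanded into Gram vectors, the trace is the sum of the
  quadratic form of \<open>B\<close> at these vectors.\<close>

lemma mat_trace_mult_positive:
  assumes "positive_op d A" "positive_op d B"
  shows "0 \<le> mat_trace (A * B)"
proof -
  obtain u where u: "\<And>i j. i < d \<Longrightarrow> j < d \<Longrightarrow> A $$ (i, j) = (\<Sum>k<d. u k i * cnj (u k j))"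
    using positive_op_gramE[OF assms(1)] by blast
  have "mat_trace (A * B) = (\<Sum>i<d. \<Sum>j<d. \<Sum>k<d. cnj (u k j) * B $$ (j, i) * u k i)"
    using mat_trace_mult[OF assms[THEN positive_op_carrier]] u
    by (simp add: sum_distrib_left sum_distrib_right mult_ac)
  also have "\<dots> = (\<Sum>i<d. \<Sum>k<d. \<Sum>j<d. cnj (u k j) * B $$ (j, i) * u k i)"
    by (intro sum.cong refl sum.swap)
  also have "\<dots> = (\<Sum>k<d. \<Sum>i<d. \<Sum>j<d. cnj (u k j) * B $$ (j, i) * u k i)"
    by (rule sum.swap)
  also have "\<dots> = (\<Sum>k<d. \<Sum>j<d. \<Sum>i<d. cnj (u k j) * B $$ (j, i) * u k i)"
    by (intro sum.cong refl sum.swap)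
  also have "\<dots> \<ge> 0"
    by (rule sum_nonneg) (rule assms(2)[unfolded positive_op_iff_sum, THEN conjunct2, rule_format])
  finally show ?thesis .
qed

subsection \<open>Kronecker products\<close>

text \<open>A Kronecker index encodes a pair as quotient and remainder; this turns a sum over such
  indices into a double sum.\<close>

lemma sum_lessThan_mult:
  fixes f :: "nat \<Rightarrow> nat \<Rightarrow> 'b::comm_monoid_add"
  shows "(\<Sum>i<m * n. f (i div n) (i mod n)) = (\<Sum>i<m. \<Sum>j<n. f i j)"
proof -
  have "(\<Sum>i<m * n. f (i div n) (i mod n)) = (\<Sum>i<m. \<Sum>j<n. f ((j + i * n) div n) ((j + i * n) mod n))"
    by (rule sum_mult_product)
  also have "\<dots> = (\<Sum>i<m. \<Sum>j<n. f i j)"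
    by (intro sum.cong refl) auto
  finally show ?thesis .
qed

lemma div_mod_less_mult:
  "i < m * n \<Longrightarrow> i div n < (m :: nat)" "i < m * n \<Longrightarrow> i mod n < (n :: nat)"
  by (auto simp: less_mult_imp_div_less) (metis mod_less_divisor mult_0_right not_less0 gr0I)

lemma dim_kron [simp]: "dim_row (kron A B) = dim_row A * dim_row B" "dim_col (kron A B) = dim_col A * dim_col B"
  by (simp_all add: kron_def)

lemma kron_carrier [simp, intro]:
  "A \<in> carrier_mat m n \<Longrightarrow> B \<in> carrier_mat k l \<Longrightarrow> kron A B \<in> carrier_mat (m * k) (n * l)"
  by (auto intro!: carrier_matI)

lemma kron_entry:
  "i < dim_row A * dim_row B \<Longrightarrow> j < dim_col A * dim_col B \<Longrightarrow>
   kron A B $$ (i, j) = A $$ (i div dim_row B, j div dim_col B) * B $$ (i mod dim_row B, j mod dim_col B)"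
  by (simp add: kron_def)

lemma kron_mult:
  assumes "A \<in> carrier_mat m n" "C \<in> carrier_mat n l" "B \<in> carrier_mat m' n'" "D \<in> carrier_mat n' l'"
  shows "kron A B * kron C D = kron (A * C) (B * D)"
proof (rule eq_matI)
  fix i j assume "i < dim_row (kron (A * C) (B * D))" "j < dim_col (kron (A * C) (B * D))"
  hence ij: "i < m * m'" "j < l * l'" using assms by auto
  note ij' = div_mod_less_mult[OF ij(1)] div_mod_less_mult[OF ij(2)]
  have "(kron A B * kron C D) $$ (i, j) = (\<Sum>k<n * n'. kron A B $$ (i, k) * kron C D $$ (k, j))"
    using assms ij by (intro mat_mult_entry_carrier) auto
  also have "\<dots> = (\<Sum>k<n * n'. (A $$ (i div m', k div n') * C $$ (k div n', j div l')) * (B $$ (i mod m', k mod n') * D $$ (k mod n', j mod l')))"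
    using assms ij by (intro sum.cong refl) (auto simp: kron_entry)
  also have "\<dots> = (\<Sum>k<n. \<Sum>k'<n'. (A $$ (i div m', k) * C $$ (k, j div l')) * (B $$ (i mod m', k') * D $$ (k', j mod l')))"
    by (rule sum_lessThan_mult)
  also have "\<dots> = (\<Sum>k<n. A $$ (i div m', k) * C $$ (k, j div l')) * (\<Sum>k'<n'. B $$ (i mod m', k') * D $$ (k', j mod l'))"
    by (rule sum_product[symmetric])
  also have "\<dots> = (A * C) $$ (i div m', j div l') * (B * D) $$ (i mod m', j mod l')"
    using mat_mult_entry_carrier[OF assms(1,2) ij'(1,3)] mat_mult_entry_carrier[OF assms(3,4) ij'(2,4)] by simp
  also have "\<dots> = kron (A * C) (B * D) $$ (i, j)"
    using assms ij by (subst kron_entry) auto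
  finally show "(kron A B * kron C D) $$ (i, j) = kron (A * C) (B * D) $$ (i, j)" .
qed (use assms in auto)

lemma mat_trace_kron:
  assumes "A \<in> carrier_mat m m" "B \<in> carrier_mat n n"
  shows "mat_trace (kron A B) = mat_trace A * mat_trace B"
proof -
  have "mat_trace (kron A B) = (\<Sum>i<m * n. A $$ (i div n, i div n) * B $$ (i mod n, i mod n))"
    unfolding mat_trace_def using assms by (auto simp: kron_entry)
  also have "\<dots> = (\<Sum>i<m. \<Sum>j<n. A $$ (i, i) * B $$ (j, j))"
    by (rule sum_lessThan_mult)
  finally show ?thesis using assms by (simp add: mat_trace_def sum_product)
qed

lemma kron_one_one: "kron (1\<^sub>m m) (1\<^sub>m n) = 1\<^sub>m (m * n)"
proof (rule eq_matI)
  fix i j assume "i < dim_row (1\<^sub>m (m * n) :: complex mat)" "j < dim_col (1\<^sub>m (m * n) :: complex mat)"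
  hence ij: "i < m * n" "j < m * n" by auto
  have "i = j \<longleftrightarrow> i div n = j div n \<and> i mod n = j mod n"
    by (metis div_mult_mod_eq)
  thus "kron (1\<^sub>m m) (1\<^sub>m n) $$ (i, j) = 1\<^sub>m (m * n) $$ (i, j)"
    using ij div_mod_less_mult[OF ij(1)] div_mod_less_mult[OF ij(2)] by (subst kron_entry) auto
qed auto

lemma kron_one_left [simp]: "kron (1\<^sub>m 1) A = A"
  by (rule eq_matI) (auto simp: kron_entry)

lemma kron_one_right [simp]: "kron A (1\<^sub>m 1) = A"
  by (rule eq_matI) (auto simp: kron_entry)

text \<open>An index below \<open>a * (b * c)\<close> has three mixed-radix digits, and both
  bracketings read off the same three; \<open>aux\<close> collects the digit identities.\<close>

lemma kron_assoc: "kron (kron A B) C = kron A (kron B C)"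
proof (rule eq_matI)
  fix i j assume "i < dim_row (kron A (kron B C))" "j < dim_col (kron A (kron B C))"
  hence i: "i < dim_row A * (dim_row B * dim_row C)" and j: "j < dim_col A * (dim_col B * dim_col C)" by auto
  have aux: "k div c < a * b" "k mod c < c" "k div (b * c) < a" "k mod (b * c) < b * c" 
    "k div c div b = k div (b * c)" "k div c mod b = k mod (b * c) div c" "k mod c = k mod (b * c) mod c"
    if "k < a * (b * c)" for k a b c :: nat
  proof -
    have c: "c > 0" using that by (cases c) auto
    have m: "k mod (b * c) = c * (k div c mod b) + k mod c"
      using mod_mult2_eq[of k c b] by (simp add: mult.commute)
    show "k div c < a * b" "k mod c < c" "k div (b * c) < a" "k mod (b * c) < b * c"
      using that div_mod_less_mult[of k "a * b" c] div_mod_less_mult[of k a "b * c"]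
      by (simp_all add: mult.assoc)
    show "k div c div b = k div (b * c)" by (simp add: div_mult2_eq mult.commute[of b c])
    show "k div c mod b = k mod (b * c) div c" "k mod c = k mod (b * c) mod c"
      unfolding m using c by auto
  qed
  show "kron (kron A B) C $$ (i, j) = kron A (kron B C) $$ (i, j)"
    using i j aux[OF i] aux[OF j] by (simp add: kron_entry mult.assoc)
qed (auto simp: mult.assoc)

lemma mat_adjoint_kron:
  "mat_adjoint (kron A B) = kron (mat_adjoint A) (mat_adjoint B :: complex mat)"
proof (rule eq_matI)
  fix i j assume "i < dim_row (kron (mat_adjoint A) (mat_adjoint B))" "j < dim_col (kron (mat_adjoint A) (mat_adjoint B))"
  hence ij: "i < dim_col A * dim_col B" "j < dim_row A * dim_row B" by auto
  show "mat_adjoint (kron A B) $$ (i, j) = kron (mat_adjoint A) (mat_adjoint B) $$ (i, j)"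
    using ij div_mod_less_mult[OF ij(1)] div_mod_less_mult[OF ij(2)] by (simp add: kron_entry)
qed auto

lemma mat_diag_kron:
  "kron (mat_diag m f) (mat_diag n g) = mat_diag (m * n) (\<lambda>i. f (i div n) * g (i mod n))"
proof (rule eq_matI)
  fix i j assume "i < dim_row (mat_diag (m * n) (\<lambda>i. f (i div n) * g (i mod n)))" 
     "j < dim_col (mat_diag (m * n) (\<lambda>i. f (i div n) * g (i mod n)))"
  hence ij: "i < m * n" "j < m * n" by (auto simp: mat_diag_def)
  have "i = j \<longleftrightarrow> i div n = j div n \<and> i mod n = j mod n"
    by (metis div_mult_mod_eq)
  thus "kron (mat_diag m f) (mat_diag n g) $$ (i, j) = mat_diag (m * n) (\<lambda>i. f (i div n) * g (i mod n)) $$ (i, j)"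
    using ij div_mod_less_mult[OF ij(1)] div_mod_less_mult[OF ij(2)] by (simp add: kron_entry mat_diag_def)
qed (auto simp: mat_diag_def)

lemma kron_diagonalizes:
  assumes "diagonalizes m A U e" "diagonalizes n B V f"
  shows "diagonalizes (m * n) (kron A B) (kron U V) (\<lambda>i. e (i div n) * f (i mod n))"
proof -
  have U: "U \<in> carrier_mat m m" "mat_adjoint U * U = 1\<^sub>m m" "A = U * mat_diag m (\<lambda>i. complex_of_real (e i)) * mat_adjoint U"
   and V: "V \<in> carrier_mat n n" "mat_adjoint V * V = 1\<^sub>m n" "B = V * mat_diag n (\<lambda>i. complex_of_real (f i)) * mat_adjoint V"
    using assms by (auto simp: diagonalizes_def)
  have "mat_adjoint (kron U V) * kron U V = 1\<^sub>m (m * n)"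
    unfolding mat_adjoint_kron using U V kron_mult[of "mat_adjoint U" m m U m "mat_adjoint V" n n V n]
    by (simp add: kron_one_one)
  moreover have "kron A B = kron U V * mat_diag (m * n) (\<lambda>i. complex_of_real (e (i div n) * f (i mod n))) * mat_adjoint (kron U V)"
  proof -
    let ?D = "mat_diag m (\<lambda>i. complex_of_real (e i))" and ?E = "mat_diag n (\<lambda>i. complex_of_real (f i))"
    have "kron U V * mat_diag (m * n) (\<lambda>i. complex_of_real (e (i div n) * f (i mod n))) * mat_adjoint (kron U V)
       = kron U V * kron ?D ?E * kron (mat_adjoint U) (mat_adjoint V)"
      by (simp add: mat_diag_kron mat_adjoint_kron)
    also have "kron U V * kron ?D ?E = kron (U * ?D) (V * ?E)"
      using U V by (intro kron_mult[of _ m m _ m _ n n _ n]) auto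
    also have "\<dots> * kron (mat_adjoint U) (mat_adjoint V) = kron (U * ?D * mat_adjoint U) (V * ?E * mat_adjoint V)"
      using U V by (intro kron_mult[of _ m m _ m _ n n _ n]) auto
    finally show ?thesis using U V by simp
  qed
  ultimately show ?thesis using U(1) V(1) by (auto simp: diagonalizes_def)
qed

text \<open>The Gram vectors of the product are the tensor products of those of the factors.\<close>

lemma kron_positive:
  assumes "positive_op m A" "positive_op n B"
  shows "positive_op (m * n) (kron A B)"
proof -
  have c: "A \<in> carrier_mat m m" "B \<in> carrier_mat n n" using assms by (auto dest: positive_op_carrier)
  obtain u where u: "\<And>i j. i < m \<Longrightarrow> j < m \<Longrightarrow> A $$ (i, j) = (\<Sum>k<m. u k i * cnj (u k j))"
    using positive_op_gramE[OF assms(1)] by blast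
  obtain w where w: "\<And>i j. i < n \<Longrightarrow> j < n \<Longrightarrow> B $$ (i, j) = (\<Sum>k<n. w k i * cnj (w k j))"
    using positive_op_gramE[OF assms(2)] by blast
  show ?thesis
  proof (rule positive_op_gramI[where K = "{..<m} \<times> {..<n}" and u = "\<lambda>(k, l) i. u k (i div n) * w l (i mod n)"])
    show "kron A B \<in> carrier_mat (m * n) (m * n)" using c by auto
    fix i j assume ij: "i < m * n" "j < m * n"
    have "kron A B $$ (i, j) = A $$ (i div n, j div n) * B $$ (i mod n, j mod n)"
      using ij c by (auto simp: kron_entry)
    also have "\<dots> = (\<Sum>k<m. u k (i div n) * cnj (u k (j div n))) * (\<Sum>l<n. w l (i mod n) * cnj (w l (j mod n)))"
      using div_mod_less_mult[OF ij(1)] div_mod_less_mult[OF ij(2)] by (simp add: u w)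
    also have "\<dots> = (\<Sum>(k, l)\<in>{..<m} \<times> {..<n}. (u k (i div n) * cnj (u k (j div n))) * (w l (i mod n) * cnj (w l (j mod n))))"
      by (simp only: sum_product sum.cartesian_product)
    finally show "kron A B $$ (i, j) = (\<Sum>x\<in>{..<m} \<times> {..<n}. (case x of (k, l) \<Rightarrow> \<lambda>i. u k (i div n) * w l (i mod n)) i *
         cnj ((case x of (k, l) \<Rightarrow> \<lambda>i. u k (i div n) * w l (i mod n)) j))"
      by (simp add: case_prod_unfold mult_ac)
  qed
qed

subsection \<open>Linear combinations\<close>

lemma mat_lincomb_carrier [simp, intro]: "mat_lincomb d I c M \<in> carrier_mat d d"
  by (simp add: mat_lincomb_def)

lemma dim_mat_lincomb [simp]: "dim_row (mat_lincomb d I c M) = d" "dim_col (mat_lincomb d I c M) = d"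
  by (simp_all add: mat_lincomb_def)

lemma mat_lincomb_entry [simp]:
  "i < d \<Longrightarrow> j < d \<Longrightarrow> mat_lincomb d I c M $$ (i, j) = (\<Sum>x\<in>I. complex_of_real (c x) * M x $$ (i, j))"
  by (simp add: mat_lincomb_def)

lemma mat_lincomb_cong:
  assumes "\<And>x. x \<in> I \<Longrightarrow> c x = c' x" "\<And>x. x \<in> I \<Longrightarrow> c x \<noteq> 0 \<Longrightarrow> M x = M' x"
  shows "mat_lincomb d I c M = mat_lincomb d I c' M'"
proof (rule eq_matI)
  fix i j assume "i < dim_row (mat_lincomb d I c' M')" "j < dim_col (mat_lincomb d I c' M')"
  hence "i < d" "j < d" by auto
  thus "mat_lincomb d I c M $$ (i, j) = mat_lincomb d I c' M' $$ (i, j)"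
    using assms by (auto intro!: sum.cong) (metis mult_zero_left of_real_0)
qed auto

lemma mat_lincomb_positive:
  assumes "\<And>x. x \<in> I \<Longrightarrow> c x \<ge> 0" "\<And>x. x \<in> I \<Longrightarrow> positive_op d (M x)"
  shows "positive_op d (mat_lincomb d I c M)"
  unfolding positive_op_iff_sum
proof (intro conjI allI)
  fix v :: "nat \<Rightarrow> complex"
  have "(\<Sum>i<d. \<Sum>j<d. cnj (v i) * mat_lincomb d I c M $$ (i, j) * v j) =
    (\<Sum>i<d. \<Sum>j<d. \<Sum>x\<in>I. complex_of_real (c x) * (cnj (v i) * M x $$ (i, j) * v j))"
    by (intro sum.cong refl) (simp add: sum_distrib_left sum_distrib_right mult_ac)
  also have "\<dots> = (\<Sum>i<d. \<Sum>x\<in>I. \<Sum>j<d. complex_of_real (c x) * (cnj (v i) * M x $$ (i, j) * v j))"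
    by (intro sum.cong refl sum.swap)
  also have "\<dots> = (\<Sum>x\<in>I. \<Sum>i<d. \<Sum>j<d. complex_of_real (c x) * (cnj (v i) * M x $$ (i, j) * v j))"
    by (rule sum.swap)
  also have "\<dots> = (\<Sum>x\<in>I. complex_of_real (c x) * (\<Sum>i<d. \<Sum>j<d. cnj (v i) * M x $$ (i, j) * v j))"
    by (simp only: sum_distrib_left)
  also have "\<dots> \<ge> 0"
    using assms(1) assms(2)[unfolded positive_op_iff_sum]
    by (intro sum_nonneg[where A = I] mult_nonneg_nonneg) (simp add: less_eq_complex_def, blast)
  finally show "0 \<le> (\<Sum>i<d. \<Sum>j<d. cnj (v i) * mat_lincomb d I c M $$ (i, j) * v j)" .
qed auto

lemma mat_trace_lincomb:
  assumes "\<And>x. x \<in> I \<Longrightarrow> M x \<in> carrier_mat d d"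
  shows "mat_trace (mat_lincomb d I c M) = (\<Sum>x\<in>I. complex_of_real (c x) * mat_trace (M x))"
proof -
  have "mat_trace (mat_lincomb d I c M) = (\<Sum>x\<in>I. \<Sum>i<d. complex_of_real (c x) * M x $$ (i, i))"
    unfolding mat_trace_def by (simp add: sum.swap[of _ I])
  also have "\<dots> = (\<Sum>x\<in>I. complex_of_real (c x) * mat_trace (M x))"
    using assms by (intro sum.cong refl) (auto simp: mat_trace_def sum_distrib_left)
  finally show ?thesis .
qed

lemma mat_lincomb_mult_right:
  assumes "\<And>x. x \<in> I \<Longrightarrow> M x \<in> carrier_mat d d" "A \<in> carrier_mat d d"
  shows "A * mat_lincomb d I c M = mat_lincomb d I c (\<lambda>x. A * M x)"
proof (rule eq_matI)
  fix i j assume "i < dim_row (mat_lincomb d I c (\<lambda>x. A * M x))" "j < dim_col (mat_lincomb d I c (\<lambda>x. A * M x))"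
  hence ij: "i < d" "j < d" by auto
  have "(A * mat_lincomb d I c M) $$ (i, j) = (\<Sum>k<d. \<Sum>x\<in>I. complex_of_real (c x) * (A $$ (i, k) * M x $$ (k, j)))"
    using assms ij by (subst mat_mult_entry_carrier[of _ d d _ d]) (auto simp: sum_distrib_left mult_ac intro!: sum.cong)
  also have "\<dots> = (\<Sum>x\<in>I. complex_of_real (c x) * (A * M x) $$ (i, j))"
    using assms ij by (subst sum.swap) (auto simp: mat_mult_entry_carrier[of _ d d _ d] sum_distrib_left simp del: index_mult_mat(1) intro!: sum.cong)
  finally show "(A * mat_lincomb d I c M) $$ (i, j) = mat_lincomb d I c (\<lambda>x. A * M x) $$ (i, j)" using ij by simp
qed (use assms in auto)

lemma mat_lincomb_mult_left:
  assumes "\<And>x. x \<in> I \<Longrightarrow> M x \<in> carrier_mat d d" "A \<in> carrier_mat d d"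
  shows "mat_lincomb d I c M * A = mat_lincomb d I c (\<lambda>x. M x * A)"
proof (rule eq_matI)
  fix i j assume "i < dim_row (mat_lincomb d I c (\<lambda>x. M x * A))" "j < dim_col (mat_lincomb d I c (\<lambda>x. M x * A))"
  hence ij: "i < d" "j < d" by auto
  have "(mat_lincomb d I c M * A) $$ (i, j) = (\<Sum>k<d. \<Sum>x\<in>I. complex_of_real (c x) * (M x $$ (i, k) * A $$ (k, j)))"
    using assms ij by (subst mat_mult_entry_carrier[of _ d d _ d]) (auto simp: sum_distrib_right sum_distrib_left mult_ac intro!: sum.cong)
  also have "\<dots> = (\<Sum>x\<in>I. complex_of_real (c x) * (M x * A) $$ (i, j))"
    using assms ij by (subst sum.swap) (auto simp: mat_mult_entry_carrier[of _ d d _ d] sum_distrib_left simp del: index_mult_mat(1) intro!: sum.cong)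
  finally show "(mat_lincomb d I c M * A) $$ (i, j) = mat_lincomb d I c (\<lambda>x. M x * A) $$ (i, j)" using ij by simp
qed (use assms in auto)

lemma mat_trace_mult_lincomb:
  assumes "\<And>x. x \<in> I \<Longrightarrow> M x \<in> carrier_mat d d" "A \<in> carrier_mat d d"
  shows "mat_trace (A * mat_lincomb d I c M) = (\<Sum>x\<in>I. complex_of_real (c x) * mat_trace (A * M x))"
  using assms by (subst mat_lincomb_mult_right) (auto simp: mat_trace_lincomb)

lemma mat_trace_lincomb_mult:
  assumes "\<And>x. x \<in> I \<Longrightarrow> M x \<in> carrier_mat d d" "A \<in> carrier_mat d d"
  shows "mat_trace (mat_lincomb d I c M * A) = (\<Sum>x\<in>I. complex_of_real (c x) * mat_trace (M x * A))"
proof -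
  have "mat_lincomb d I c M * A = mat_lincomb d I c (\<lambda>x. M x * A)"
    using assms by (rule mat_lincomb_mult_left)
  moreover have "M x * A \<in> carrier_mat d d" if "x \<in> I" for x
    using assms(1)[OF that] assms(2) by (rule mult_carrier_mat)
  ultimately show ?thesis using mat_trace_lincomb[of I "\<lambda>x. M x * A" d c] by simp
qed

lemma kron_lincomb:
  assumes "\<And>x. x \<in> I \<Longrightarrow> M x \<in> carrier_mat m m" "\<And>y. y \<in> J \<Longrightarrow> N y \<in> carrier_mat n n"
  shows "kron (mat_lincomb m I c M) (mat_lincomb n J e N) =
    mat_lincomb (m * n) (I \<times> J) (\<lambda>(x, y). c x * e y) (\<lambda>(x, y). kron (M x) (N y))"
proof (rule eq_matI)
  fix i j assume "i < dim_row (mat_lincomb (m * n) (I \<times> J) (\<lambda>(x, y). c x * e y) (\<lambda>(x, y). kron (M x) (N y)))"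
    "j < dim_col (mat_lincomb (m * n) (I \<times> J) (\<lambda>(x, y). c x * e y) (\<lambda>(x, y). kron (M x) (N y)))"
  hence ij: "i < m * n" "j < m * n" by auto
  note [simp] = div_mod_less_mult[OF ij(1)] div_mod_less_mult[OF ij(2)]
  have "kron (mat_lincomb m I c M) (mat_lincomb n J e N) $$ (i, j) =
    (\<Sum>(x, y)\<in>I \<times> J. complex_of_real (c x) * M x $$ (i div n, j div n) * (complex_of_real (e y) * N y $$ (i mod n, j mod n)))"
    using ij by (simp add: kron_entry sum_product sum.cartesian_product)
  also have "\<dots> = mat_lincomb (m * n) (I \<times> J) (\<lambda>(x, y). c x * e y) (\<lambda>(x, y). kron (M x) (N y)) $$ (i, j)"
  proof -
    have "kron (M x) (N y) $$ (i, j) = M x $$ (i div n, j div n) * N y $$ (i mod n, j mod n)" if "x \<in> I" "y \<in> J" for x y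
      using ij assms(1)[OF that(1)] assms(2)[OF that(2)] by (subst kron_entry) auto
    thus ?thesis using ij by (auto intro!: sum.cong)
  qed
  finally show "kron (mat_lincomb m I c M) (mat_lincomb n J e N) $$ (i, j) =
     mat_lincomb (m * n) (I \<times> J) (\<lambda>(x, y). c x * e y) (\<lambda>(x, y). kron (M x) (N y)) $$ (i, j)" .
qed auto

lemma mat_lincomb_reindex:
  assumes "inj_on h I"
  shows "mat_lincomb d (h ` I) c M = mat_lincomb d I (c \<circ> h) (M \<circ> h)"
  by (rule eq_matI) (auto simp: sum.reindex[OF assms])

subsection \<open>Tensor products of lists\<close>

lemma kron_list_Nil [simp]: "kron_list [] = 1\<^sub>m 1"
  and kron_list_Cons [simp]: "kron_list (A # As) = kron A (kron_list As)"
  by (simp_all add: kron_list_def)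

lemma kron_list_append: "kron_list (As @ Bs) = kron (kron_list As) (kron_list Bs)"
  by (induction As) (simp_all add: kron_assoc kron_one_left[unfolded One_nat_def])

subsection \<open>Entropy\<close>

lemma diagonalizes_mult_trace:
  assumes U: "U \<in> carrier_mat d d" "mat_adjoint U * U = 1\<^sub>m d"
  shows "mat_trace (U * mat_diag d e * mat_adjoint U) = (\<Sum>i<d. e i)"
    and "(U * mat_diag d e * mat_adjoint U) * (U * mat_diag d f * mat_adjoint U) =
         U * mat_diag d (\<lambda>i. e i * f i) * mat_adjoint U"
proof -
  note [simp] = U(1) mult_carrier_mat[of _ d d _ d]
  note assoc = assoc_mult_mat[of _ d d _ d _ d]
  have "mat_trace (U * mat_diag d e * mat_adjoint U) = mat_trace (mat_adjoint U * (U * mat_diag d e))"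
    by (rule mat_trace_mult_comm[of _ d d]) auto
  also have "mat_adjoint U * (U * mat_diag d e) = (mat_adjoint U * U) * mat_diag d e"
    by (rule assoc[symmetric]) auto
  also have "mat_trace \<dots> = (\<Sum>i<d. e i)"
    unfolding U(2) by (simp add: left_mult_one_mat[of _ d d]) (simp add: mat_trace_def mat_diag_def)
  finally show "mat_trace (U * mat_diag d e * mat_adjoint U) = (\<Sum>i<d. e i)" .
  have "(U * mat_diag d e * mat_adjoint U) * (U * mat_diag d f * mat_adjoint U) =
     U * mat_diag d e * (mat_adjoint U * U) * mat_diag d f * mat_adjoint U"
    by (simp add: assoc)
  also have "\<dots> = U * (mat_diag d e * mat_diag d f) * mat_adjoint U"
    unfolding U(2) by (simp add: right_mult_one_mat[of _ d d] assoc)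
  finally show "(U * mat_diag d e * mat_adjoint U) * (U * mat_diag d f * mat_adjoint U) =
         U * mat_diag d (\<lambda>i. e i * f i) * mat_adjoint U" by simp
qed

text \<open>
  \<open>X = V\<^sup>* U\<close> intertwines the two diagonal matrices, so \<open>X\<^sub>i\<^sub>j = 0\<close> unless the \<open>i\<close>-th and \<open>j\<close>-th
  eigenvalues agree; hence it also intertwines their images under \<open>f\<close>.
\<close>

lemma diagonalizes_fun_unique:
  assumes "diagonalizes d A U e" "diagonalizes d A V g"
  shows "U * mat_diag d (\<lambda>i. complex_of_real (f (e i))) * mat_adjoint U =
         V * mat_diag d (\<lambda>i. complex_of_real (f (g i))) * mat_adjoint V"
proof -
  let ?D = "\<lambda>h. mat_diag d (\<lambda>i. complex_of_real (h i))"
  have U: "U \<in> carrier_mat d d" "mat_adjoint U * U = 1\<^sub>m d" "A = U * ?D e * mat_adjoint U"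
   and V: "V \<in> carrier_mat d d" "mat_adjoint V * V = 1\<^sub>m d" "A = V * ?D g * mat_adjoint V"
    using assms by (auto simp: diagonalizes_def)
  note [simp] = U(1) V(1) mult_carrier_mat[of _ d d _ d] right_mult_one_mat[of _ d d] left_mult_one_mat[of _ d d]
  note assoc = assoc_mult_mat[of _ d d _ d _ d]
  have UU: "U * mat_adjoint U = 1\<^sub>m d" and VV: "V * mat_adjoint V = 1\<^sub>m d"
    using unitary_right_inverse U(1,2) V(1,2) by auto
  define X where "X = mat_adjoint V * U"
  have X: "X \<in> carrier_mat d d" by (simp add: X_def)
  have "?D g * X = (mat_adjoint V * V) * ?D g * mat_adjoint V * U"
    unfolding V(2) by (simp add: X_def assoc)
  also have "\<dots> = mat_adjoint V * (V * ?D g * mat_adjoint V) * U"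
    by (simp add: assoc)
  also have "V * ?D g * mat_adjoint V = U * ?D e * mat_adjoint U"
    using U(3) V(3) by simp
  also have "mat_adjoint V * (U * ?D e * mat_adjoint U) * U = X * ?D e * (mat_adjoint U * U)"
    by (simp add: X_def assoc)
  also have "\<dots> = X * ?D e" unfolding U(2) using X by simp
  finally have gX: "?D g * X = X * ?D e" .
  have "complex_of_real (g i) * X $$ (i, j) = X $$ (i, j) * complex_of_real (e j)" if "i < d" "j < d" for i j
    using arg_cong[OF gX, of "\<lambda>M. M $$ (i, j)"] that X
    by (simp add: mat_diag_mult_left[of X d d] mat_diag_mult_right[of X d d])
  hence "g i = e j \<or> X $$ (i, j) = 0" if "i < d" "j < d" for i j
    using that by (metis mult.commute mult_right_cancel of_real_eq_iff)
  hence fX: "?D (\<lambda>i. f (g i)) * X = X * ?D (\<lambda>i. f (e i))"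
    using X by (intro eq_matI) (force simp: mat_diag_mult_left[of X d d] mat_diag_mult_right[of X d d])+
  have "V * ?D (\<lambda>i. f (g i)) * mat_adjoint V = V * ?D (\<lambda>i. f (g i)) * mat_adjoint V * (U * mat_adjoint U)"
    unfolding UU by simp
  also have "\<dots> = V * (?D (\<lambda>i. f (g i)) * X) * mat_adjoint U"
    by (simp add: X_def assoc)
  also have "\<dots> = (V * mat_adjoint V) * U * ?D (\<lambda>i. f (e i)) * mat_adjoint U"
    unfolding fX by (simp add: X_def assoc)
  also have "\<dots> = U * ?D (\<lambda>i. f (e i)) * mat_adjoint U" unfolding VV by simp
  finally show ?thesis by simp
qed

text \<open>Uniqueness of the value makes the description operator harmless: any diagonalisation at
  hand may be used to compute it.\<close>

lemma hermitian_fun_diagonalizes: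
  assumes "diagonalizes d A U e"
  shows "hermitian_fun f A = U * mat_diag d (\<lambda>i. complex_of_real (f (e i))) * mat_adjoint U"
proof -
  have d: "dim_row A = d" using assms by (auto simp: diagonalizes_def)
  show ?thesis unfolding hermitian_fun_def Let_def d
  proof (rule the_equality)
    show "\<exists>Ua ea. Ua \<in> carrier_mat d d \<and> mat_adjoint Ua * Ua = 1\<^sub>m d \<and>
       A = Ua * mat_diag d (\<lambda>i. complex_of_real (ea i)) * mat_adjoint Ua \<and>
       U * mat_diag d (\<lambda>i. complex_of_real (f (e i))) * mat_adjoint U =
       Ua * mat_diag d (\<lambda>i. complex_of_real (f (ea i))) * mat_adjoint Ua"
      using assms unfolding diagonalizes_def by blast
  next
    fix B assume "\<exists>Ua ea. Ua \<in> carrier_mat d d \<and> mat_adjoint Ua * Ua = 1\<^sub>m d \<and>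
       A = Ua * mat_diag d (\<lambda>i. complex_of_real (ea i)) * mat_adjoint Ua \<and>
       B = Ua * mat_diag d (\<lambda>i. complex_of_real (f (ea i))) * mat_adjoint Ua"
    then obtain V g where "diagonalizes d A V g" "B = V * mat_diag d (\<lambda>i. complex_of_real (f (g i))) * mat_adjoint V"
      unfolding diagonalizes_def by blast
    thus "B = U * mat_diag d (\<lambda>i. complex_of_real (f (e i))) * mat_adjoint U"
      using diagonalizes_fun_unique[OF assms] by simp
  qed
qed

lemma vn_entropy_diagonalizes:
  assumes "diagonalizes d A U e"
  shows "vn_entropy A = - (\<Sum>i<d. e i * log 2 (e i))"
proof -
  have U: "U \<in> carrier_mat d d" "mat_adjoint U * U = 1\<^sub>m d" "A = U * mat_diag d (\<lambda>i. complex_of_real (e i)) * mat_adjoint U"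
    using assms by (auto simp: diagonalizes_def)
  have "A * hermitian_fun (log 2) A = U * mat_diag d (\<lambda>i. complex_of_real (e i) * complex_of_real (log 2 (e i))) * mat_adjoint U"
    unfolding hermitian_fun_diagonalizes[OF assms] by (subst U(3)) (rule diagonalizes_mult_trace(2)[OF U(1,2)])
  thus ?thesis unfolding vn_entropy_def using diagonalizes_mult_trace(1)[OF U(1,2)]
    by (simp flip: of_real_mult of_real_sum)
qed

lemma density_op_diagonalizable:
  assumes "density_op d \<rho>"
  shows "\<exists>U e. diagonalizes d \<rho> U e \<and> (\<forall>k<d. 0 \<le> e k) \<and> (\<Sum>k<d. e k) = 1"
proof -
  obtain U e where *: "diagonalizes d \<rho> U e" "\<And>k. k < d \<Longrightarrow> 0 \<le> e k"
    using positive_op_diagonalizable assms unfolding density_op_def by blast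
  have "complex_of_real (\<Sum>k<d. e k) = mat_trace \<rho>"
    using *(1) diagonalizes_mult_trace(1)[of U d "\<lambda>i. complex_of_real (e i)"] by (auto simp: diagonalizes_def)
  also have "\<dots> = 1" using assms by (simp add: density_op_def)
  finally have "(\<Sum>k<d. e k) = 1" by (metis of_real_eq_1_iff)
  thus ?thesis using * by blast
qed

lemma density_op_dim_pos: "density_op d \<rho> \<Longrightarrow> d > 0"
  by (auto simp: density_op_def positive_op_def mat_trace_def intro!: gr0I)

text \<open>The spectrum of a tensor product consists of the products of eigenvalues. The logarithm
  splits each term, and since both spectra sum to one, the double sum separates. Zero eigenvalues
  are treated apart, because the logarithm of a product splits only for nonzero factors.\<close>

lemma vn_entropy_kron:
  assumes "density_op m \<rho>" "density_op n \<sigma>"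
  shows "vn_entropy (kron \<rho> \<sigma>) = vn_entropy \<rho> + vn_entropy \<sigma>"
proof -
  obtain U e where e: "diagonalizes m \<rho> U e" "\<And>k. k < m \<Longrightarrow> 0 \<le> e k" "(\<Sum>k<m. e k) = 1"
    using density_op_diagonalizable[OF assms(1)] by blast
  obtain V f where f: "diagonalizes n \<sigma> V f" "\<And>k. k < n \<Longrightarrow> 0 \<le> f k" "(\<Sum>k<n. f k) = 1"
    using density_op_diagonalizable[OF assms(2)] by blast
  have "vn_entropy (kron \<rho> \<sigma>) = - (\<Sum>i<m * n. e (i div n) * f (i mod n) * log 2 (e (i div n) * f (i mod n)))"
    by (rule vn_entropy_diagonalizes[OF kron_diagonalizes[OF e(1) f(1)]])
  also have "\<dots> = - (\<Sum>i<m. \<Sum>j<n. e i * f j * log 2 (e i * f j))"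
    by (simp only: sum_lessThan_mult[of "\<lambda>i j. e i * f j * log 2 (e i * f j)"])
  also have "(\<Sum>i<m. \<Sum>j<n. e i * f j * log 2 (e i * f j)) =
     (\<Sum>i<m. \<Sum>j<n. (e i * log 2 (e i)) * f j + e i * (f j * log 2 (f j)))"
  proof (intro sum.cong refl)
    fix i j assume "i \<in> {..<m}" "j \<in> {..<n}"
    hence "0 \<le> e i" "0 \<le> f j" using e f by auto
    thus "e i * f j * log 2 (e i * f j) = (e i * log 2 (e i)) * f j + e i * (f j * log 2 (f j))"
      by (cases "e i = 0"; cases "f j = 0") (auto simp: log_mult algebra_simps)
  qed
  also have "\<dots> = (\<Sum>i<m. e i * log 2 (e i)) * (\<Sum>j<n. f j) + (\<Sum>i<m. e i) * (\<Sum>j<n. f j * log 2 (f j))"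
    by (simp only: sum.distrib sum_product)
  finally show ?thesis using e(3) f(3) vn_entropy_diagonalizes[OF e(1)] vn_entropy_diagonalizes[OF f(1)] by simp
qed

lemma vn_entropy_bounds:
  assumes "density_op d \<rho>"
  shows "0 \<le> vn_entropy \<rho>" "vn_entropy \<rho> \<le> log 2 (real d)"
proof -
  obtain U e where e: "diagonalizes d \<rho> U e" "\<And>k. k < d \<Longrightarrow> 0 \<le> e k" "(\<Sum>k<d. e k) = 1"
    using density_op_diagonalizable[OF assms] by blast
  have d: "d > 0" using density_op_dim_pos[OF assms] .
  have le1: "e k \<le> 1" if "k < d" for k
    using member_le_sum[of k "{..<d}" e] that e by auto
  have S: "vn_entropy \<rho> = (\<Sum>i<d. - (e i * log 2 (e i)))"
    using vn_entropy_diagonalizes[OF e(1)] by (simp add: sum_negf)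
  have "e i * log 2 (e i) \<le> 0" if "i < d" for i
    using e(2)[OF that] le1[OF that] by (cases "e i = 0") (auto intro: mult_nonneg_nonpos)
  thus "0 \<le> vn_entropy \<rho>" unfolding S by (intro sum_nonneg) auto
  \<comment> \<open>Relative entropy with respect to the uniform distribution is nonnegative:
    \<open>ln x \<le> x - 1\<close> at \<open>x = 1 / (real d * e i)\<close>. The correction terms
    sum to zero.\<close>
  have "- (e i * log 2 (e i)) \<le> e i * log 2 (real d) + (1 / real d - e i) / ln 2" if "i < d" for i
  proof (cases "e i = 0")
    case True thus ?thesis using d by simp
  next
    case False
    hence pos: "e i > 0" using e(2)[OF that] by simp
    have "ln (1 / (real d * e i)) \<le> 1 / (real d * e i) - 1"
      using pos d by (intro ln_le_minus_one) simp
    hence "e i * ln (1 / (real d * e i)) \<le> e i * (1 / (real d * e i) - 1)"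
      using pos by (intro mult_left_mono) auto
    also have "\<dots> = 1 / real d - e i" using pos d by (simp add: field_simps)
    also have "ln (1 / (real d * e i)) = - ln (real d) - ln (e i)"
      using pos d by (simp add: ln_div ln_mult)
    finally have "(e i * (- ln (real d) - ln (e i))) / ln 2 \<le> (1 / real d - e i) / ln 2"
      by (intro divide_right_mono) auto
    moreover have "- (e i * log 2 (e i)) - e i * log 2 (real d) = (e i * (- ln (real d) - ln (e i))) / ln 2"
      by (simp add: log_def field_simps)
    ultimately show ?thesis by linarith
  qed
  hence "vn_entropy \<rho> \<le> (\<Sum>i<d. e i * log 2 (real d) + (1 / real d - e i) / ln 2)"
    unfolding S by (intro sum_mono) auto
  also have "\<dots> = (\<Sum>i<d. e i) * log 2 (real d) + (1 - (\<Sum>i<d. e i)) / ln 2"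
    using d by (simp add: sum.distrib sum_distrib_right sum_subtractf flip: sum_divide_distrib)
  finally show "vn_entropy \<rho> \<le> log 2 (real d)" using e(3) by simp
qed

lemma kron_density:
  assumes "density_op m \<rho>" "density_op n \<sigma>"
  shows "density_op (m * n) (kron \<rho> \<sigma>)"
  using assms kron_positive[of m \<rho> n \<sigma>] mat_trace_kron[of \<rho> m \<sigma> n]
  by (auto simp: density_op_def dest: positive_op_carrier)

lemma mat_lincomb_density:
  assumes "\<And>x. x \<in> I \<Longrightarrow> c x \<ge> 0" "(\<Sum>x\<in>I. c x) = 1" "\<And>x. x \<in> I \<Longrightarrow> density_op d (M x)"
  shows "density_op d (mat_lincomb d I c M)"
proof -
  have "mat_trace (mat_lincomb d I c M) = (\<Sum>x\<in>I. complex_of_real (c x) * mat_trace (M x))"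
    using assms(3) by (intro mat_trace_lincomb) (auto simp: density_op_def dest: positive_op_carrier)
  also have "\<dots> = complex_of_real (\<Sum>x\<in>I. c x)"
    using assms(3) by (simp add: density_op_def)
  finally show ?thesis using assms mat_lincomb_positive[of I c d M] by (auto simp: density_op_def)
qed

lemma kron_lincomb_right:
  assumes "\<And>y. y \<in> J \<Longrightarrow> N y \<in> carrier_mat n n" "A \<in> carrier_mat m m"
  shows "kron A (mat_lincomb n J e N) = mat_lincomb (m * n) J e (\<lambda>y. kron A (N y))"
proof (rule eq_matI)
  fix i j assume "i < dim_row (mat_lincomb (m * n) J e (\<lambda>y. kron A (N y)))" "j < dim_col (mat_lincomb (m * n) J e (\<lambda>y. kron A (N y)))"
  hence ij: "i < m * n" "j < m * n" by auto
  have "kron A (N y) $$ (i, j) = A $$ (i div n, j div n) * N y $$ (i mod n, j mod n)" if "y \<in> J" for y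
    using ij assms(1)[OF that] assms(2) by (subst kron_entry) auto
  moreover have "kron A (mat_lincomb n J e N) $$ (i, j) = A $$ (i div n, j div n) * mat_lincomb n J e N $$ (i mod n, j mod n)"
    using ij assms(2) by (subst kron_entry) auto
  ultimately show "kron A (mat_lincomb n J e N) $$ (i, j) = mat_lincomb (m * n) J e (\<lambda>y. kron A (N y)) $$ (i, j)"
    using ij div_mod_less_mult[OF ij(1)] div_mod_less_mult[OF ij(2)]
    by (auto simp: sum_distrib_left mult_ac intro!: sum.cong)
qed (use assms in auto)

text \<open>The weights sum to one on \<open>B\<close>, so the entropy of the common factor enters
  once in each of the two terms and cancels.\<close>

lemma holevo_kron:
  assumes "density_op m \<sigma>" "\<And>x. x \<in> B \<Longrightarrow> density_op n (\<rho> x)" "finite B" "set_pmf Q \<subseteq> B"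
  shows "holevo (m * n) B Q (\<lambda>x. kron \<sigma> (\<rho> x)) = holevo n B Q \<rho>"
proof -
  have c: "\<And>x. x \<in> B \<Longrightarrow> \<rho> x \<in> carrier_mat n n" "\<sigma> \<in> carrier_mat m m"
    using assms(1,2) by (auto simp: density_op_def dest: positive_op_carrier)
  have 1: "(\<Sum>x\<in>B. pmf Q x) = 1" using assms(3,4) by (rule sum_pmf_eq_1)
  have "mat_lincomb (m * n) B (pmf Q) (\<lambda>x. kron \<sigma> (\<rho> x)) = kron \<sigma> (mat_lincomb n B (pmf Q) \<rho>)"
    using kron_lincomb_right[of B \<rho> n \<sigma> m "pmf Q"] c by simp
  moreover have "vn_entropy (kron \<sigma> (mat_lincomb n B (pmf Q) \<rho>)) = vn_entropy \<sigma> + vn_entropy (mat_lincomb n B (pmf Q) \<rho>)"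
    using assms 1 by (intro vn_entropy_kron[of m _ n] mat_lincomb_density) auto
  moreover have "(\<Sum>x\<in>B. pmf Q x * vn_entropy (kron \<sigma> (\<rho> x))) = vn_entropy \<sigma> + (\<Sum>x\<in>B. pmf Q x * vn_entropy (\<rho> x))"
  proof -
    have "(\<Sum>x\<in>B. pmf Q x * vn_entropy (kron \<sigma> (\<rho> x))) = (\<Sum>x\<in>B. pmf Q x * vn_entropy \<sigma> + pmf Q x * vn_entropy (\<rho> x))"
      using assms by (intro sum.cong refl) (simp add: vn_entropy_kron[of m _ n] distrib_left)
    thus ?thesis using 1 by (simp add: sum.distrib flip: sum_distrib_right)
  qed
  ultimately show ?thesis by (simp add: holevo_def)
qed

text \<open>Each of the two terms lies between 0 and \<open>log 2 (real d)\<close>, so their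
  difference lies in the symmetric interval. This is the range that enters Hoeffding's
  lemma.\<close>

lemma holevo_abs_le:
  assumes "\<And>x. x \<in> B \<Longrightarrow> density_op d (\<rho> x)" "finite B" "set_pmf Q \<subseteq> B"
  shows "\<bar>holevo d B Q \<rho>\<bar> \<le> log 2 (real d)"
proof -
  have 1: "(\<Sum>x\<in>B. pmf Q x) = 1" using assms(2,3) by (rule sum_pmf_eq_1)
  have "density_op d (mat_lincomb d B (pmf Q) \<rho>)" using assms 1 by (intro mat_lincomb_density) auto
  moreover have "0 \<le> (\<Sum>x\<in>B. pmf Q x * vn_entropy (\<rho> x))"
    using assms by (intro sum_nonneg mult_nonneg_nonneg) (auto intro: vn_entropy_bounds(1))
  moreover have "(\<Sum>x\<in>B. pmf Q x * vn_entropy (\<rho> x)) \<le> (\<Sum>x\<in>B. pmf Q x * log 2 (real d))"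
    using assms by (intro sum_mono mult_left_mono) (auto simp: vn_entropy_bounds)
  moreover have "\<dots> = log 2 (real d)" using 1 by (simp flip: sum_distrib_right)
  ultimately show ?thesis using vn_entropy_bounds[of d "mat_lincomb d B (pmf Q) \<rho>"]
    unfolding holevo_def by linarith
qed

section \<open>Word channels\<close>

lemma finite_nlists [simp, intro]: "finite A \<Longrightarrow> finite (nlists n A)"
  unfolding nlists_def using finite_lists_length_eq[of A n] by (simp add: conj_commute)

lemma nlists_append_image:
  "(\<lambda>(a, b). a @ b) ` (nlists m A \<times> nlists n A) = nlists (m + n) A" (is "?L = ?R")
proof
  show "?L \<subseteq> ?R" by (auto intro: nlists_appendI)
  show "?R \<subseteq> ?L"
  proof
    fix xs assume "xs \<in> ?R"
    hence "take m xs \<in> nlists m A" "drop m xs \<in> nlists n A"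
      unfolding nlists_def by (auto dest: in_set_takeD in_set_dropD)
    thus "xs \<in> ?L" by (intro image_eqI[of _ _ "(take m xs, drop m xs)"]) auto
  qed
qed

lemma inj_on_nlists_append: "inj_on (\<lambda>(a, b). a @ b) (nlists m A \<times> nlists n A)"
  unfolding nlists_def by (auto simp: inj_on_def)

lemma sum_nlists_add:
  fixes f :: "'b list \<Rightarrow> 'c::comm_monoid_add"
  shows "(\<Sum>xs\<in>nlists (m + n) A. f xs) = (\<Sum>a\<in>nlists m A. \<Sum>b\<in>nlists n A. f (a @ b))"
  unfolding nlists_append_image[symmetric]
  by (subst sum.reindex[OF inj_on_nlists_append]) (simp add: sum.cartesian_product case_prod_unfold o_def)

lemma sum_nlists_one:
  fixes f :: "'b list \<Rightarrow> 'c::comm_monoid_add"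
  shows "(\<Sum>xs\<in>nlists (Suc 0) A. f xs) = (\<Sum>a\<in>A. f [a])"
proof -
  have "nlists (Suc 0) A = (\<lambda>a. [a]) ` A" by (auto simp: nlists_Suc)
  thus ?thesis by (simp add: sum.reindex inj_on_def)
qed

lemma take_drop_nlists:
  assumes "xs \<in> nlists (m + n) A"
  shows "take m xs \<in> nlists m A" "drop m xs \<in> nlists n A"
  using assms unfolding nlists_def by (auto dest: in_set_takeD in_set_dropD)

definition word_state :: "(nat \<Rightarrow> 'a pmf \<Rightarrow> complex mat) \<Rightarrow> nat list \<Rightarrow> 'a list \<Rightarrow> complex mat" where
  "word_state W ts as = kron_list (map2 (\<lambda>t a. W t (return_pmf a)) ts as)"

lemma word_state_append:
  assumes "length ts = length as"
  shows "word_state W (ts @ ts') (as @ as') = kron (word_state W ts as) (word_state W ts' as')"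
  using assms by (simp add: word_state_def kron_list_append)

lemma word_state_density:
  assumes "\<And>t a. t \<in> \<theta> \<Longrightarrow> density_op d (W t (return_pmf a))" "ts \<in> nlists n \<theta>" "length as = n"
  shows "density_op (d ^ n) (word_state W ts as)"
  using assms(2,3)
proof (induction n arbitrary: ts as)
  case 0
  have "positive_op 1 (1\<^sub>m 1)" by (rule positive_op_gramI[where K = "{0::nat}" and u = "\<lambda>_ _. 1"]) auto
  thus ?case using 0 by (simp add: word_state_def density_op_def mat_trace_def)
next
  case (Suc n)
  then obtain t ts' a as' where [simp]: "ts = t # ts'" "as = a # as'" and *: "t \<in> \<theta>" "ts' \<in> nlists n \<theta>" "length as' = n"
    by (auto simp: in_nlists_Suc_iff length_Suc_conv)
  have "density_op (d * d ^ n) (kron (W t (return_pmf a)) (word_state W ts' as'))"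
    by (intro kron_density assms(1) Suc.IH *)
  thus ?case by (simp add: word_state_def)
qed

lemma word_state_carrier:
  assumes "\<And>t a. t \<in> \<theta> \<Longrightarrow> density_op d (W t (return_pmf a))" "ts \<in> nlists n \<theta>" "length as = n"
  shows "word_state W ts as \<in> carrier_mat (d ^ n) (d ^ n)"
  using word_state_density[of \<theta> d W, OF assms] by (auto simp: density_op_def dest: positive_op_carrier)

lemma word_channel_alt:
  "word_channel d W ts P = mat_lincomb (d ^ length ts) (nlists (length ts) UNIV) (pmf P) (word_state W ts)"
  by (simp add: word_channel_def word_state_def[abs_def])

lemma word_channel_density:
  fixes P :: "'a::finite list pmf"
  assumes "\<And>t a. t \<in> \<theta> \<Longrightarrow> density_op d (W t (return_pmf a))" "ts \<in> nlists n \<theta>" "set_pmf P \<subseteq> nlists n UNIV"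
  shows "density_op (d ^ n) (word_channel d W ts P)"
  unfolding word_channel_alt nlistsE_length[OF assms(2)]
  using assms word_state_density[of \<theta> d W, OF assms(1,2)]
  by (intro mat_lincomb_density) (auto simp: in_nlists_UNIV intro!: sum_pmf_eq_1)

definition append_pmf :: "'a list pmf \<Rightarrow> 'a list pmf \<Rightarrow> 'a list pmf" where
  "append_pmf P Q = map_pmf (\<lambda>(a, b). a @ b) (pair_pmf P Q)"

lemma set_append_pmf:
  assumes "set_pmf P \<subseteq> nlists m UNIV" "set_pmf Q \<subseteq> nlists n UNIV"
  shows "set_pmf (append_pmf P Q) \<subseteq> nlists (m + n) UNIV"
  using assms by (auto simp: append_pmf_def intro!: nlists_appendI)

text \<open>Concatenation is not injective on pairs of words, but \<open>P\<close> lives on words of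
  length \<open>m\<close>, so \<open>(a, b)\<close> is the only split of \<open>a @ b\<close> that
  carries mass.\<close>

lemma pmf_append_pmf:
  assumes "set_pmf P \<subseteq> nlists m UNIV" "length a = m"
  shows "pmf (append_pmf P Q) (a @ b) = pmf P a * pmf Q b"
proof -
  have "pmf (append_pmf P Q) (a @ b) = measure (measure_pmf (pair_pmf P Q)) ((\<lambda>(a, b). a @ b) -` {a @ b})"
    unfolding append_pmf_def by (simp add: pmf_map)
  also have "\<dots> = measure (measure_pmf (pair_pmf P Q)) {(a, b)}"
  proof (rule measure_prob_cong_0)
    fix z assume z: "z \<in> (\<lambda>(a, b). a @ b) -` {a @ b} - {(a, b)}"
    obtain a' b' where [simp]: "z = (a', b')" by force
    have "length a' \<noteq> m" using z assms(2) by auto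
    hence "pmf P a' = 0" using assms(1) unfolding nlists_def by (auto simp: set_pmf_iff)
    thus "pmf (pair_pmf P Q) z = 0" by (simp add: pmf_pair)
  qed auto
  also have "\<dots> = pmf P a * pmf Q b" by (simp add: measure_pmf_single pmf_pair)
  finally show ?thesis .
qed

text \<open>Independent input blocks give a product state, whatever the jamming word, because the
  latter splits at the same place. Every concatenation of protocols and codes below rests on
  this.\<close>

lemma word_channel_append:
  fixes P Q :: "'a::finite list pmf"
  assumes d: "\<And>t a. t \<in> \<theta> \<Longrightarrow> density_op d (W t (return_pmf a))"
    and ts: "ts \<in> nlists m \<theta>" "ts' \<in> nlists n \<theta>"
    and P: "set_pmf P \<subseteq> nlists m UNIV"
  shows "word_channel d W (ts @ ts') (append_pmf P Q) = kron (word_channel d W ts P) (word_channel d W ts' Q)"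
proof -
  have [simp]: "length ts = m" "length ts' = n" using ts by auto
  have "kron (word_channel d W ts P) (word_channel d W ts' Q) =
     mat_lincomb (d ^ m * d ^ n) (nlists m UNIV \<times> nlists n UNIV) (\<lambda>(x, y). pmf P x * pmf Q y)
       (\<lambda>(x, y). kron (word_state W ts x) (word_state W ts' y))"
    unfolding word_channel_alt using word_state_carrier[of \<theta> d W, OF d ts(1)] word_state_carrier[of \<theta> d W, OF d ts(2)]
    by (simp, intro kron_lincomb) (auto simp: in_nlists_UNIV)
  also have "\<dots> = mat_lincomb (d ^ m * d ^ n) (nlists m UNIV \<times> nlists n UNIV)
      (pmf (append_pmf P Q) \<circ> (\<lambda>(a, b). a @ b)) (word_state W (ts @ ts') \<circ> (\<lambda>(a, b). a @ b))"
    by (rule mat_lincomb_cong) (auto simp: pmf_append_pmf[OF P] word_state_append in_nlists_UNIV)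
  also have "\<dots> = mat_lincomb (d ^ m * d ^ n) (nlists (m + n) UNIV) (pmf (append_pmf P Q)) (word_state W (ts @ ts'))"
    by (simp only: nlists_append_image[symmetric] mat_lincomb_reindex[OF inj_on_nlists_append])
  finally show ?thesis by (simp add: word_channel_alt power_add)
qed

section \<open>Expectations over the correlated source\<close>

text \<open>Kept as the literal double sum of \<open>corr_achievable\<close>, so that unfolding
  connects the estimates with the capacity.\<close>

definition corr_exp :: "('x::finite \<times> 'y::finite) pmf \<Rightarrow> nat \<Rightarrow> ('x list \<Rightarrow> 'y list \<Rightarrow> real) \<Rightarrow> real" where
  "corr_exp p n F = (\<Sum>xs\<in>nlists n UNIV. \<Sum>ys\<in>nlists n UNIV. word_prob p xs ys * F xs ys)"

lemma word_prob_nonneg [simp]: "0 \<le> word_prob p xs ys"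
  by (simp add: word_prob_def prod_nonneg)

lemma word_prob_append:
  assumes "length xs = length ys"
  shows "word_prob p (xs @ xs') (ys @ ys') = word_prob p xs ys * word_prob p xs' ys'"
proof -
  have split: "(\<Prod>i<m + n. f i) = (\<Prod>i<m. f i) * (\<Prod>i<n. f (m + i))" for f :: "nat \<Rightarrow> real" and m n
    by (induction n) (simp_all add: mult.assoc)
  let ?m = "length xs" and ?n = "length xs'"
  let ?f = "\<lambda>i. pmf p ((xs @ xs') ! i, (ys @ ys') ! i)"
  have "word_prob p (xs @ xs') (ys @ ys') = (\<Prod>i<?m + ?n. ?f i)"
    by (simp add: word_prob_def)
  also have "\<dots> = (\<Prod>i<?m. ?f i) * (\<Prod>i<?n. ?f (i + ?m))"
    using split[of ?f ?m ?n] by (simp add: add.commute)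
  also have "\<dots> = word_prob p xs ys * word_prob p xs' ys'"
    using assms by (simp add: word_prob_def nth_append)
  finally show ?thesis .
qed

lemma corr_exp_cong:
  "(\<And>xs ys. length xs = n \<Longrightarrow> length ys = n \<Longrightarrow> F xs ys = G xs ys) \<Longrightarrow> corr_exp p n F = corr_exp p n G"
  unfolding corr_exp_def by (intro sum.cong refl) (auto simp: in_nlists_UNIV)

lemma corr_exp_mono:
  "(\<And>xs ys. length xs = n \<Longrightarrow> length ys = n \<Longrightarrow> F xs ys \<le> G xs ys) \<Longrightarrow> corr_exp p n F \<le> corr_exp p n G"
  unfolding corr_exp_def by (intro sum_mono mult_left_mono) (auto simp: in_nlists_UNIV)

lemma corr_exp_nonneg:
  "(\<And>xs ys. length xs = n \<Longrightarrow> length ys = n \<Longrightarrow> 0 \<le> F xs ys) \<Longrightarrow> 0 \<le> corr_exp p n F"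
  unfolding corr_exp_def by (intro sum_nonneg mult_nonneg_nonneg) (auto simp: in_nlists_UNIV)

lemma corr_exp_add: "corr_exp p n (\<lambda>xs ys. F xs ys + G xs ys) = corr_exp p n F + corr_exp p n G"
  by (simp add: corr_exp_def distrib_left sum.distrib)

lemma corr_exp_diff: "corr_exp p n (\<lambda>xs ys. F xs ys - G xs ys) = corr_exp p n F - corr_exp p n G"
  by (simp add: corr_exp_def right_diff_distrib sum_subtractf)

lemma corr_exp_cmult: "corr_exp p n (\<lambda>xs ys. c * F xs ys) = c * corr_exp p n F"
  by (simp add: corr_exp_def sum_distrib_left mult_ac)

lemma corr_exp_sum: "corr_exp p n (\<lambda>xs ys. \<Sum>i\<in>I. F i xs ys) = (\<Sum>i\<in>I. corr_exp p n (F i))"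
proof -
  have "corr_exp p n (\<lambda>xs ys. \<Sum>i\<in>I. F i xs ys) = (\<Sum>xs\<in>nlists n UNIV. \<Sum>i\<in>I. \<Sum>ys\<in>nlists n UNIV. word_prob p xs ys * F i xs ys)"
    unfolding corr_exp_def sum_distrib_left by (intro sum.cong refl sum.swap)
  also have "\<dots> = (\<Sum>i\<in>I. corr_exp p n (F i))" unfolding corr_exp_def by (rule sum.swap)
  finally show ?thesis .
qed

lemma corr_exp_0 [simp]: "corr_exp p 0 F = F [] []"
  by (simp add: corr_exp_def word_prob_def)

lemma corr_exp_one: "corr_exp p (Suc 0) F = (\<Sum>x\<in>UNIV. \<Sum>y\<in>UNIV. pmf p (x, y) * F [x] [y])"
  by (simp add: corr_exp_def sum_nlists_one word_prob_def)

text \<open>Disjoint blocks of the source are independent, hence the iterated expectation.\<close>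

lemma corr_exp_append:
  "corr_exp p (m + n) F = corr_exp p m (\<lambda>xs ys. corr_exp p n (\<lambda>xs' ys'. F (xs @ xs') (ys @ ys')))"
proof -
  have "corr_exp p (m + n) F = (\<Sum>xs\<in>nlists m UNIV. \<Sum>xs'\<in>nlists n UNIV. \<Sum>ys\<in>nlists m UNIV. \<Sum>ys'\<in>nlists n UNIV.
      word_prob p (xs @ xs') (ys @ ys') * F (xs @ xs') (ys @ ys'))"
    by (simp add: corr_exp_def sum_nlists_add)
  also have "\<dots> = (\<Sum>xs\<in>nlists m UNIV. \<Sum>ys\<in>nlists m UNIV. \<Sum>xs'\<in>nlists n UNIV. \<Sum>ys'\<in>nlists n UNIV.
      word_prob p (xs @ xs') (ys @ ys') * F (xs @ xs') (ys @ ys'))"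
    by (intro sum.cong refl sum.swap)
  also have "\<dots> = corr_exp p m (\<lambda>xs ys. corr_exp p n (\<lambda>xs' ys'. F (xs @ xs') (ys @ ys')))"
    unfolding corr_exp_def sum_distrib_left
    by (intro sum.cong refl) (simp add: word_prob_append in_nlists_UNIV mult.assoc)
  finally show ?thesis .
qed

lemma corr_exp_prod:
  "corr_exp p (m + n) (\<lambda>xs ys. F (take m xs) (take m ys) * G (drop m xs) (drop m ys)) = corr_exp p m F * corr_exp p n G"
proof -
  have "corr_exp p (m + n) (\<lambda>xs ys. F (take m xs) (take m ys) * G (drop m xs) (drop m ys))
     = corr_exp p m (\<lambda>xs ys. corr_exp p n G * F xs ys)"
    unfolding corr_exp_append by (intro corr_exp_cong) (simp add: corr_exp_cmult mult.commute)
  thus ?thesis unfolding corr_exp_cmult by (simp only: mult.commute)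
qed

lemma corr_exp_const [simp]: "corr_exp p n (\<lambda>_ _. c) = c"
proof -
  have 1: "corr_exp p (Suc 0) (\<lambda>_ _. 1) = 1"
  proof -
    have "(\<Sum>x\<in>UNIV. \<Sum>y\<in>UNIV. pmf p (x, y)) = (\<Sum>z\<in>UNIV. pmf p z)"
      by (simp add: sum.cartesian_product)
    also have "\<dots> = 1" by (rule sum_pmf_eq_1) auto
    finally show ?thesis by (simp add: corr_exp_one)
  qed
  have "corr_exp p n (\<lambda>_ _. 1) = 1"
  proof (induction n)
    case (Suc n)
    thus ?case using corr_exp_append[of p "Suc 0" n "\<lambda>_ _. 1"] 1 by simp
  qed simp
  thus ?thesis using corr_exp_cmult[of p n c "\<lambda>_ _. 1"] by simp
qed

section \<open>Key protocols\<close>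

text \<open>\<open>N\<close> may look at \<open>xs\<close>, which the receiver does not see: the
  dependence only names the outcome that counts as correct, as in
  \<open>\<lambda>xs. N (u xs)\<close>.\<close>

definition succ_val ::
    "nat \<Rightarrow> (nat \<Rightarrow> 'a::finite pmf \<Rightarrow> complex mat) \<Rightarrow> ('x::finite \<times> 'y::finite) pmf \<Rightarrow> nat list \<Rightarrow>
     ('x list \<Rightarrow> 'a list pmf) \<Rightarrow> ('x list \<Rightarrow> 'y list \<Rightarrow> complex mat) \<Rightarrow> real" where
  "succ_val d W p ts Q N =
     corr_exp p (length ts) (\<lambda>xs ys. Re (mat_trace (word_channel d W ts (Q xs) * N xs ys)))"

text \<open>Trace and source expectation both factor. The real part of the product of the traces is
  the product of their real parts, because the trace of a product of two positive operators is real;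
  this is the purpose of the positivity assumptions on \<open>N\<close> and
  \<open>N'\<close>.\<close>

lemma succ_val_append:
  assumes d: "\<And>t a. t \<in> \<theta> \<Longrightarrow> density_op d (W t (return_pmf a))"
    and ts: "ts \<in> nlists m \<theta>" "ts' \<in> nlists n \<theta>"
    and Q: "\<And>xs. length xs = m \<Longrightarrow> set_pmf (Q xs) \<subseteq> nlists m UNIV"
    and Q': "\<And>xs. length xs = n \<Longrightarrow> set_pmf (Q' xs) \<subseteq> nlists n UNIV"
    and N: "\<And>xs ys. length xs = m \<Longrightarrow> length ys = m \<Longrightarrow> positive_op (d ^ m) (N xs ys)"
    and N': "\<And>xs ys. length xs = n \<Longrightarrow> length ys = n \<Longrightarrow> positive_op (d ^ n) (N' xs ys)"
  shows "succ_val d W p (ts @ ts') (\<lambda>xs. append_pmf (Q (take m xs)) (Q' (drop m xs)))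
      (\<lambda>xs ys. kron (N (take m xs) (take m ys)) (N' (drop m xs) (drop m ys))) =
    succ_val d W p ts Q N * succ_val d W p ts' Q' N'"
proof -
  have [simp]: "length ts = m" "length ts' = n" using ts by auto
  have *: "Re (mat_trace (word_channel d W (ts @ ts') (append_pmf (Q xs) (Q' xs')) * kron (N xs ys) (N' xs' ys'))) =
      Re (mat_trace (word_channel d W ts (Q xs) * N xs ys)) * Re (mat_trace (word_channel d W ts' (Q' xs') * N' xs' ys'))"
    if l: "length xs = m" "length ys = m" "length xs' = n" "length ys' = n" for xs ys xs' ys'
  proof -
    have p: "positive_op (d ^ m) (word_channel d W ts (Q xs))" "positive_op (d ^ n) (word_channel d W ts' (Q' xs'))"
      using word_channel_density[of \<theta> d W, OF d ts(1) Q[OF l(1)]] word_channel_density[of \<theta> d W, OF d ts(2) Q'[OF l(3)]]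
      by (auto simp: density_op_def)
    note P = p N[OF l(1,2)] N'[OF l(3,4)]
    note c = P[THEN positive_op_carrier]
    have "mat_trace (word_channel d W (ts @ ts') (append_pmf (Q xs) (Q' xs')) * kron (N xs ys) (N' xs' ys')) =
       mat_trace (word_channel d W ts (Q xs) * N xs ys) * mat_trace (word_channel d W ts' (Q' xs') * N' xs' ys')"
      using kron_mult[OF c(1,3) c(2,4)] c
      by (simp add: word_channel_append[of \<theta> d W, OF d ts Q[OF l(1)]]
           mat_trace_kron[OF mult_carrier_mat[OF c(1,3)] mult_carrier_mat[OF c(2,4)]])
    thus ?thesis using mat_trace_mult_positive[OF P(1,3)] mat_trace_mult_positive[OF P(2,4)]
      by (simp add: less_eq_complex_def)
  qed
  have "succ_val d W p (ts @ ts') (\<lambda>xs. append_pmf (Q (take m xs)) (Q' (drop m xs)))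
      (\<lambda>xs ys. kron (N (take m xs) (take m ys)) (N' (drop m xs) (drop m ys))) =
    corr_exp p (m + n) (\<lambda>xs ys. Re (mat_trace (word_channel d W ts (Q (take m xs)) * N (take m xs) (take m ys)))
      * Re (mat_trace (word_channel d W ts' (Q' (drop m xs)) * N' (drop m xs) (drop m ys))))"
    unfolding succ_val_def by (simp, intro corr_exp_cong *) auto
  also have "\<dots> = succ_val d W p ts Q N * succ_val d W p ts' Q' N'"
    using corr_exp_prod[of p m n "\<lambda>xs ys. Re (mat_trace (word_channel d W ts (Q xs) * N xs ys))"
      "\<lambda>xs ys. Re (mat_trace (word_channel d W ts' (Q' xs) * N' xs ys))"]
    by (simp add: succ_val_def)
  finally show ?thesis .
qed

definition povm :: "nat \<Rightarrow> nat \<Rightarrow> nat \<Rightarrow> (bool list \<Rightarrow> 'y list \<Rightarrow> complex mat) \<Rightarrow> bool" where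
  "povm d m k N \<longleftrightarrow> (\<forall>ys. length ys = m \<longrightarrow>
     (\<forall>v. length v = k \<longrightarrow> positive_op (d ^ m) (N v ys)) \<and>
     mat_lincomb (d ^ m) (nlists k UNIV) (\<lambda>_. 1) (\<lambda>v. N v ys) = 1\<^sub>m (d ^ m))"

definition povm_append :: "nat \<Rightarrow> nat \<Rightarrow> (bool list \<Rightarrow> 'y list \<Rightarrow> complex mat) \<Rightarrow>
    (bool list \<Rightarrow> 'y list \<Rightarrow> complex mat) \<Rightarrow> bool list \<Rightarrow> 'y list \<Rightarrow> complex mat" where
  "povm_append m k N N' v ys = kron (N (take k v) (take m ys)) (N' (drop k v) (drop m ys))"

lemma povm_append:
  assumes "povm d m k N" "povm d n l N'"
  shows "povm d (m + n) (k + l) (povm_append m k N N')"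
  unfolding povm_def
proof (intro allI impI conjI)
  fix ys :: "'a list" assume ys: "length ys = m + n"
  have N: "\<And>v. length v = k \<Longrightarrow> positive_op (d ^ m) (N v (take m ys))"
      "mat_lincomb (d ^ m) (nlists k UNIV) (\<lambda>_. 1) (\<lambda>v. N v (take m ys)) = 1\<^sub>m (d ^ m)"
   and N': "\<And>v. length v = l \<Longrightarrow> positive_op (d ^ n) (N' v (drop m ys))"
      "mat_lincomb (d ^ n) (nlists l UNIV) (\<lambda>_. 1) (\<lambda>v. N' v (drop m ys)) = 1\<^sub>m (d ^ n)"
    using assms ys by (auto simp: povm_def)
  show "positive_op (d ^ (m + n)) (povm_append m k N N' v ys)" if "length v = k + l" for v
    unfolding povm_append_def power_add using that by (intro kron_positive N N') auto
  have "mat_lincomb (d ^ (m + n)) (nlists (k + l) UNIV) (\<lambda>_. 1) (\<lambda>v. povm_append m k N N' v ys) =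
    mat_lincomb (d ^ m * d ^ n) (nlists k UNIV \<times> nlists l UNIV) (\<lambda>(x, y). 1 * 1)
      (\<lambda>(x, y). kron (N x (take m ys)) (N' y (drop m ys)))"
    unfolding nlists_append_image[symmetric] mat_lincomb_reindex[OF inj_on_nlists_append] power_add
    by (rule mat_lincomb_cong) (auto simp: povm_append_def in_nlists_UNIV)
  also have "\<dots> = kron (1\<^sub>m (d ^ m)) (1\<^sub>m (d ^ n))"
    unfolding N(2)[symmetric] N'(2)[symmetric]
    by (rule kron_lincomb[symmetric]) (use N(1) N'(1) in \<open>auto simp: in_nlists_UNIV dest: positive_op_carrier\<close>)
  finally show "mat_lincomb (d ^ (m + n)) (nlists (k + l) UNIV) (\<lambda>_. 1) (\<lambda>v. povm_append m k N N' v ys) = 1\<^sub>m (d ^ (m + n))"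
    by (simp add: kron_one_one power_add)
qed

text \<open>\<open>u\<close> is the key drawn from the source word, \<open>Q\<close> the input that
  announces it and \<open>N\<close> the measurement of the receiver. The number \<open>s\<close>
  bounds the success probability from below for every jamming word, \<open>q\<close> bounds the
  collision probability of the key from above. Both bounds multiply under concatenation, and the sum
  of squares is the quantity that \<open>derandomize\<close> takes.\<close>

definition key_protocol ::
    "nat \<Rightarrow> nat set \<Rightarrow> (nat \<Rightarrow> 'a::finite pmf \<Rightarrow> complex mat) \<Rightarrow> ('x::finite \<times> 'y::finite) pmf \<Rightarrow>
     nat \<Rightarrow> nat \<Rightarrow> real \<Rightarrow> real \<Rightarrow> ('x list \<Rightarrow> bool list) \<Rightarrow> ('x list \<Rightarrow> 'a list pmf) \<Rightarrow>
     (bool list \<Rightarrow> 'y list \<Rightarrow> complex mat) \<Rightarrow> bool" where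
  "key_protocol d \<theta> W p m k s q u Q N \<longleftrightarrow>
     (\<forall>xs. length xs = m \<longrightarrow> length (u xs) = k \<and> set_pmf (Q xs) \<subseteq> nlists m UNIV) \<and>
     povm d m k N \<and>
     (\<forall>ts\<in>nlists m \<theta>. s \<le> succ_val d W p ts Q (\<lambda>xs. N (u xs))) \<and>
     (\<Sum>v\<in>nlists k UNIV. (corr_exp p m (\<lambda>xs ys. of_bool (u xs = v)))\<^sup>2) \<le> q"

lemma key_protocol_append:
  fixes p :: "('x::finite \<times> 'y::finite) pmf"
  assumes d: "\<And>t a. t \<in> \<theta> \<Longrightarrow> density_op d (W t (return_pmf a))"
    and 1: "key_protocol d \<theta> W p m k s q u Q N" and 2: "key_protocol d \<theta> W p n l s' q' u' Q' N'"
    and nn: "0 \<le> s" "0 \<le> s'"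
  shows "key_protocol d \<theta> W p (m + n) (k + l) (s * s') (q * q')
    (\<lambda>xs. u (take m xs) @ u' (drop m xs)) (\<lambda>xs. append_pmf (Q (take m xs)) (Q' (drop m xs)))
    (povm_append m k N N')"
  unfolding key_protocol_def
proof (intro conjI allI impI ballI)
  fix xs :: "'x list" assume "length xs = m + n"
  hence l: "length (take m xs) = m" "length (drop m xs) = n" by auto
  show "length (u (take m xs) @ u' (drop m xs)) = k + l"
    using 1 2 l by (simp add: key_protocol_def)
  show "set_pmf (append_pmf (Q (take m xs)) (Q' (drop m xs))) \<subseteq> nlists (m + n) UNIV"
    using 1 2 l by (intro set_append_pmf) (auto simp only: key_protocol_def)
next
  show "povm d (m + n) (k + l) (povm_append m k N N')"
    using 1 2 by (intro povm_append) (auto simp: key_protocol_def)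
next
  fix ts assume "ts \<in> nlists (m + n) \<theta>"
  then obtain ts1 ts2 where ts: "ts = ts1 @ ts2" "ts1 \<in> nlists m \<theta>" "ts2 \<in> nlists n \<theta>"
    using take_drop_nlists[of ts m n \<theta>] by (metis append_take_drop_id)
  have "s * s' \<le> succ_val d W p ts1 Q (\<lambda>xs. N (u xs)) * succ_val d W p ts2 Q' (\<lambda>xs. N' (u' xs))"
  proof (rule mult_mono)
    show "s \<le> succ_val d W p ts1 Q (\<lambda>xs. N (u xs))" "s' \<le> succ_val d W p ts2 Q' (\<lambda>xs. N' (u' xs))"
      using 1 2 ts by (auto simp: key_protocol_def)
    with nn show "0 \<le> s'" "0 \<le> succ_val d W p ts1 Q (\<lambda>xs. N (u xs))" by linarith+
  qed
  also have "\<dots> = succ_val d W p ts (\<lambda>xs. append_pmf (Q (take m xs)) (Q' (drop m xs)))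
      (\<lambda>xs ys. kron (N (u (take m xs)) (take m ys)) (N' (u' (drop m xs)) (drop m ys)))"
    unfolding ts(1) using 1 2
    by (intro succ_val_append[of \<theta> d W, OF d ts(2,3), symmetric]) (auto simp: key_protocol_def povm_def)
  also have "\<dots> = succ_val d W p ts (\<lambda>xs. append_pmf (Q (take m xs)) (Q' (drop m xs)))
     (\<lambda>xs. povm_append m k N N' (u (take m xs) @ u' (drop m xs)))"
    unfolding succ_val_def using ts 1 by (intro corr_exp_cong) (auto simp: povm_append_def key_protocol_def)
  finally show "s * s' \<le> succ_val d W p ts (\<lambda>xs. append_pmf (Q (take m xs)) (Q' (drop m xs)))
     (\<lambda>xs. povm_append m k N N' (u (take m xs) @ u' (drop m xs)))" .
next
  have e: "corr_exp p (m + n) (\<lambda>xs ys. of_bool (u (take m xs) @ u' (drop m xs) = v @ v')) =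
     corr_exp p m (\<lambda>xs ys. of_bool (u xs = v)) * corr_exp p n (\<lambda>xs ys. of_bool (u' xs = v'))"
    if "length v = k" for v v'
    unfolding corr_exp_prod[symmetric] using that 1
    by (intro corr_exp_cong) (auto simp: key_protocol_def of_bool_def)
  have "(\<Sum>v\<in>nlists (k + l) UNIV. (corr_exp p (m + n) (\<lambda>xs ys. of_bool (u (take m xs) @ u' (drop m xs) = v)))\<^sup>2) =
    (\<Sum>v\<in>nlists k UNIV. (corr_exp p m (\<lambda>xs ys. of_bool (u xs = v)))\<^sup>2) *
    (\<Sum>v\<in>nlists l UNIV. (corr_exp p n (\<lambda>xs ys. of_bool (u' xs = v)))\<^sup>2)"
    unfolding sum_nlists_add by (simp add: e in_nlists_UNIV sum_product power_mult_distrib)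
  also have "\<dots> \<le> q * q'"
  proof (rule mult_mono)
    show le: "(\<Sum>v\<in>nlists k UNIV. (corr_exp p m (\<lambda>xs ys. of_bool (u xs = v)))\<^sup>2) \<le> q"
      "(\<Sum>v\<in>nlists l UNIV. (corr_exp p n (\<lambda>xs ys. of_bool (u' xs = v)))\<^sup>2) \<le> q'"
      using 1 2 by (auto simp: key_protocol_def)
    have "0 \<le> (\<Sum>v\<in>nlists k UNIV. (corr_exp p m (\<lambda>xs ys. of_bool (u xs = v)))\<^sup>2)"
      by (intro sum_nonneg) auto
    with le show "0 \<le> q" by linarith
  qed (auto intro: sum_nonneg)
  finally show "(\<Sum>v\<in>nlists (k + l) UNIV. (corr_exp p (m + n) (\<lambda>xs ys. of_bool (u (take m xs) @ u' (drop m xs) = v)))\<^sup>2) \<le> q * q'" .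
qed

lemma succ_val_lincomb:
  assumes d: "\<And>t a. t \<in> \<theta> \<Longrightarrow> density_op d (W t (return_pmf a))"
    and ts: "ts \<in> nlists m \<theta>"
    and Q: "\<And>xs. length xs = m \<Longrightarrow> set_pmf (Q xs) \<subseteq> nlists m UNIV"
    and N: "\<And>v xs ys. v \<in> I \<Longrightarrow> length xs = m \<Longrightarrow> length ys = m \<Longrightarrow> N v xs ys \<in> carrier_mat (d ^ m) (d ^ m)"
  shows "succ_val d W p ts Q (\<lambda>xs ys. mat_lincomb (d ^ m) I c (\<lambda>v. N v xs ys)) =
    (\<Sum>v\<in>I. c v * succ_val d W p ts Q (N v))"
proof -
  have [simp]: "length ts = m" using ts by auto
  have *: "Re (mat_trace (word_channel d W ts (Q xs) * mat_lincomb (d ^ m) I c (\<lambda>v. N v xs ys))) =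
     (\<Sum>v\<in>I. c v * Re (mat_trace (word_channel d W ts (Q xs) * N v xs ys)))"
    if "length xs = m" "length ys = m" for xs ys
  proof -
    have "word_channel d W ts (Q xs) \<in> carrier_mat (d ^ m) (d ^ m)"
      using word_channel_density[of \<theta> d W, OF d ts Q[OF that(1)]] by (auto simp: density_op_def dest: positive_op_carrier)
    thus ?thesis using N that by (subst mat_trace_mult_lincomb) auto
  qed
  show ?thesis unfolding succ_val_def
    by (simp add: * corr_exp_sum corr_exp_cmult cong: corr_exp_cong)
qed

lemma succ_val_one:
  assumes d: "\<And>t a. t \<in> \<theta> \<Longrightarrow> density_op d (W t (return_pmf a))"
    and ts: "ts \<in> nlists m \<theta>"
    and Q: "\<And>xs. length xs = m \<Longrightarrow> set_pmf (Q xs) \<subseteq> nlists m UNIV"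
    and N: "\<And>xs ys. length xs = m \<Longrightarrow> length ys = m \<Longrightarrow> N xs ys = 1\<^sub>m (d ^ m)"
  shows "succ_val d W p ts Q N = 1"
proof -
  have [simp]: "length ts = m" using ts by auto
  have *: "Re (mat_trace (word_channel d W ts (Q xs) * N xs ys)) = 1"
    if "length xs = m" "length ys = m" for xs ys
  proof -
    have "density_op (d ^ m) (word_channel d W ts (Q xs))"
      using word_channel_density[of \<theta> d W, OF d ts Q[OF that(1)]] .
    thus ?thesis unfolding N[OF that]
      by (auto simp: density_op_def right_mult_one_mat[of _ "d ^ m" "d ^ m"] dest: positive_op_carrier)
  qed
  show ?thesis unfolding succ_val_def
    by (simp add: * cong: corr_exp_cong)
qed

lemma succ_val_nonneg:
  assumes d: "\<And>t a. t \<in> \<theta> \<Longrightarrow> density_op d (W t (return_pmf a))"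
    and ts: "ts \<in> nlists m \<theta>"
    and Q: "\<And>xs. length xs = m \<Longrightarrow> set_pmf (Q xs) \<subseteq> nlists m UNIV"
    and N: "\<And>xs ys. length xs = m \<Longrightarrow> length ys = m \<Longrightarrow> positive_op (d ^ m) (N xs ys)"
  shows "0 \<le> succ_val d W p ts Q N"
  unfolding succ_val_def
proof (rule corr_exp_nonneg)
  fix xs :: "'b list" and ys :: "'c list" assume "length xs = length ts" "length ys = length ts"
  hence l: "length xs = m" "length ys = m" using ts by auto
  have "density_op (d ^ m) (word_channel d W ts (Q xs))"
    using word_channel_density[of \<theta> d W, OF d ts Q[OF l(1)]] .
  thus "0 \<le> Re (mat_trace (word_channel d W ts (Q xs) * N xs ys))"
    using mat_trace_mult_positive[OF _ N[OF l]] by (auto simp: density_op_def less_eq_complex_def)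
qed

subsection \<open>Repeated detection of a bit\<close>

text \<open>\<open>r\<close> to the power of wrong minus right outcomes when \<open>b\<close> was
  sent: the exponential tilt of a Chernoff bound. Exchanging the two bits inverts it, so the
  threshold 1 serves both.\<close>

definition bit_weight :: "real \<Rightarrow> bool \<Rightarrow> bool list \<Rightarrow> real" where
  "bit_weight r b v = (\<Prod>z\<leftarrow>v. if z = b then inverse r else r)"

lemma bit_weight_pos: "r > 0 \<Longrightarrow> bit_weight r b v > 0"
  by (induction v) (auto simp: bit_weight_def)

lemma bit_weight_append: "bit_weight r b (v @ v') = bit_weight r b v * bit_weight r b v'"
  by (simp add: bit_weight_def)

lemma bit_weight_not: "r > 0 \<Longrightarrow> bit_weight r (\<not> b) v = inverse (bit_weight r b v)"
  by (induction v) (auto simp: bit_weight_def)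

text \<open>
  The weighted outcome sum is a Chernoff bound: an outcome \<open>v\<close> with at least as many wrong as
  right bits has \<open>bit_weight r b v \<ge> 1\<close>, and the sum is multiplicative under concatenation.
\<close>

definition detector ::
    "nat \<Rightarrow> nat set \<Rightarrow> (nat \<Rightarrow> 'a::finite pmf \<Rightarrow> complex mat) \<Rightarrow> ('x::finite \<times> 'y::finite) pmf \<Rightarrow>
     real \<Rightarrow> nat \<Rightarrow> nat \<Rightarrow> real \<Rightarrow> (bool \<Rightarrow> 'x list \<Rightarrow> 'a list pmf) \<Rightarrow>
     (bool list \<Rightarrow> 'y list \<Rightarrow> complex mat) \<Rightarrow> bool" where
  "detector d \<theta> W p r m k \<rho> Q N \<longleftrightarrow>
     (\<forall>b xs. length xs = m \<longrightarrow> set_pmf (Q b xs) \<subseteq> nlists m UNIV) \<and>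
     povm d m k N \<and>
     (\<forall>b. \<forall>ts\<in>nlists m \<theta>.
        (\<Sum>v\<in>nlists k UNIV. bit_weight r b v * succ_val d W p ts (Q b) (\<lambda>_. N v)) \<le> \<rho>)"

lemma detector_append:
  fixes p :: "('x::finite \<times> 'y::finite) pmf"
  assumes d: "\<And>t a. t \<in> \<theta> \<Longrightarrow> density_op d (W t (return_pmf a))"
    and 1: "detector d \<theta> W p r m k \<rho> Q N" and 2: "detector d \<theta> W p r n l \<rho>' Q' N'"
    and r: "r > 0" "0 \<le> \<rho>"
  shows "detector d \<theta> W p r (m + n) (k + l) (\<rho> * \<rho>')
    (\<lambda>b xs. append_pmf (Q b (take m xs)) (Q' b (drop m xs))) (povm_append m k N N')"
  unfolding detector_def
proof (intro conjI allI impI ballI)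
  fix b and xs :: "'x list" assume "length xs = m + n"
  hence l: "length (take m xs) = m" "length (drop m xs) = n" by auto
  show "set_pmf (append_pmf (Q b (take m xs)) (Q' b (drop m xs))) \<subseteq> nlists (m + n) UNIV"
    using 1 2 l by (intro set_append_pmf) (auto simp only: detector_def)
next
  show "povm d (m + n) (k + l) (povm_append m k N N')"
    using 1 2 by (intro povm_append) (auto simp: detector_def)
next
  fix b ts assume "ts \<in> nlists (m + n) \<theta>"
  then obtain ts1 ts2 where ts: "ts = ts1 @ ts2" "ts1 \<in> nlists m \<theta>" "ts2 \<in> nlists n \<theta>"
    using take_drop_nlists[of ts m n \<theta>] by (metis append_take_drop_id)
  let ?Q = "\<lambda>xs. append_pmf (Q b (take m xs)) (Q' b (drop m xs))"
  let ?s = "\<lambda>v. succ_val d W p ts1 (Q b) (\<lambda>_. N v)" and ?s' = "\<lambda>v. succ_val d W p ts2 (Q' b) (\<lambda>_. N' v)"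
  have sv: "succ_val d W p ts ?Q (\<lambda>_. povm_append m k N N' (v @ v')) = ?s v * ?s' v'"
    if "length v = k" "length v' = l" for v v'
  proof -
    have "?s v * ?s' v' = succ_val d W p ts ?Q (\<lambda>xs ys. kron (N v (take m ys)) (N' v' (drop m ys)))"
      unfolding ts(1) using 1 2 that
      by (intro succ_val_append[of \<theta> d W, OF d ts(2,3), symmetric]) (auto simp: detector_def povm_def)
    thus ?thesis using that by (simp add: povm_append_def[abs_def])
  qed
  have nn: "0 \<le> ?s v" if "v \<in> nlists k UNIV" for v
    using 1 that by (intro succ_val_nonneg[of \<theta> d W, OF d ts(2)]) (auto simp: detector_def povm_def in_nlists_UNIV)
  have nn': "0 \<le> ?s' v" if "v \<in> nlists l UNIV" for v
    using 2 that by (intro succ_val_nonneg[of \<theta> d W, OF d ts(3)]) (auto simp: detector_def povm_def in_nlists_UNIV)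
  have "(\<Sum>v\<in>nlists (k + l) UNIV. bit_weight r b v * succ_val d W p ts ?Q (\<lambda>_. povm_append m k N N' v)) =
    (\<Sum>v\<in>nlists k UNIV. bit_weight r b v * ?s v) * (\<Sum>v\<in>nlists l UNIV. bit_weight r b v * ?s' v)"
    unfolding sum_nlists_add sum_product
    by (intro sum.cong refl) (simp add: sv in_nlists_UNIV bit_weight_append mult_ac)
  also have "\<dots> \<le> \<rho> * \<rho>'"
  proof (rule mult_mono)
    show "(\<Sum>v\<in>nlists k UNIV. bit_weight r b v * ?s v) \<le> \<rho>" "(\<Sum>v\<in>nlists l UNIV. bit_weight r b v * ?s' v) \<le> \<rho>'"
      using 1 2 ts by (auto simp: detector_def)
    show "0 \<le> (\<Sum>v\<in>nlists l UNIV. bit_weight r b v * ?s' v)"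
      using nn' bit_weight_pos[OF r(1)] by (intro sum_nonneg mult_nonneg_nonneg) (auto intro: less_imp_le)
  qed (fact r(2))
  finally show "(\<Sum>v\<in>nlists (k + l) UNIV. bit_weight r b v * succ_val d W p ts ?Q (\<lambda>_. povm_append m k N N' v)) \<le> \<rho> * \<rho>'" .
qed

lemma detector_power:
  fixes p :: "('x::finite \<times> 'y::finite) pmf"
  assumes d: "\<And>t a. t \<in> \<theta> \<Longrightarrow> density_op d (W t (return_pmf a))"
    and 1: "detector d \<theta> W p r m 1 \<rho> Q N" and r: "r > 0" "0 \<le> \<rho>"
  shows "\<exists>Q N. detector d \<theta> W p r (Suc l * m) (Suc l) (\<rho> ^ Suc l) Q N"
proof (induction l)
  case 0 thus ?case using 1 by auto
next
  case (Suc l)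
  then obtain Q' N' where *: "detector d \<theta> W p r (Suc l * m) (Suc l) (\<rho> ^ Suc l) Q' N'" by blast
  from detector_append[of \<theta> d W, OF d 1 * r] show ?case by auto
qed

text \<open>For \<open>r > 1\<close> the test \<open>1 \<le> bit_weight r False v\<close> says that
  \<open>v\<close> has at least as many \<open>True\<close> as \<open>False\<close> entries. The
  outcomes are thus grouped by majority vote, ties going to \<open>True\<close>.\<close>

definition decoded_povm :: "nat \<Rightarrow> real \<Rightarrow> nat \<Rightarrow> nat \<Rightarrow> (bool list \<Rightarrow> 'y list \<Rightarrow> complex mat) \<Rightarrow> bool \<Rightarrow> 'y list \<Rightarrow> complex mat" where
  "decoded_povm d r m k N b ys =
     mat_lincomb (d ^ m) {v \<in> nlists k UNIV. (1 \<le> bit_weight r False v) = b} (\<lambda>_. 1) (\<lambda>v. N v ys)"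

lemma decoded_povm_positive:
  "povm d m k N \<Longrightarrow> length ys = m \<Longrightarrow> positive_op (d ^ m) (decoded_povm d r m k N b ys)"
  unfolding decoded_povm_def by (intro mat_lincomb_positive) (auto simp: povm_def in_nlists_UNIV)

lemma decoded_povm_sum:
  assumes "povm d m k N" "length ys = m"
  shows "mat_lincomb (d ^ m) UNIV (\<lambda>_. 1) (\<lambda>b. decoded_povm d r m k N b ys) = 1\<^sub>m (d ^ m)"
proof -
  let ?S = "\<lambda>b. {v \<in> nlists k UNIV. (1 \<le> bit_weight r False v) = b}"
  have S: "nlists k UNIV = ?S True \<union> ?S False" by auto
  have "mat_lincomb (d ^ m) UNIV (\<lambda>_. 1) (\<lambda>b. decoded_povm d r m k N b ys) =
     mat_lincomb (d ^ m) (nlists k UNIV) (\<lambda>_. 1) (\<lambda>v. N v ys)"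
    by (rule eq_matI, subst S)
       (simp_all add: decoded_povm_def UNIV_bool add.commute, subst sum.union_disjoint, auto)
  thus ?thesis using assms by (simp add: povm_def)
qed

text \<open>Markov's inequality: every wrongly decoded outcome has weight at least 1, so the total
  probability of these outcomes is dominated by the weighted sum, which is at most
  \<open>\<rho>\<close>.\<close>

lemma detector_decode:
  fixes p :: "('x::finite \<times> 'y::finite) pmf"
  assumes d: "\<And>t a. t \<in> \<theta> \<Longrightarrow> density_op d (W t (return_pmf a))"
    and 1: "detector d \<theta> W p r m k \<rho> Q N" and r: "r > 0" and ts: "ts \<in> nlists m \<theta>"
  shows "1 - \<rho> \<le> succ_val d W p ts (Q b) (\<lambda>_. decoded_povm d r m k N b)"
proof -
  let ?s = "\<lambda>v. succ_val d W p ts (Q b) (\<lambda>_. N v)"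
  let ?S = "{v \<in> nlists k UNIV. (1 \<le> bit_weight r False v) = b}"
  have Q: "\<And>xs. length xs = m \<Longrightarrow> set_pmf (Q b xs) \<subseteq> nlists m UNIV" and N: "povm d m k N"
   and le: "(\<Sum>v\<in>nlists k UNIV. bit_weight r b v * ?s v) \<le> \<rho>"
    using 1 ts by (auto simp only: detector_def)
  note c = N[unfolded povm_def, rule_format, THEN conjunct1, rule_format, THEN positive_op_carrier]
  have "1 = succ_val d W p ts (Q b) (\<lambda>xs ys. mat_lincomb (d ^ m) (nlists k UNIV) (\<lambda>_. 1) (\<lambda>v. N v ys))"
    using N Q by (intro succ_val_one[of \<theta> d W, OF d ts, symmetric]) (auto simp only: povm_def)
  also have "\<dots> = (\<Sum>v\<in>nlists k UNIV. ?s v)"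
    using c Q by (subst succ_val_lincomb[of \<theta> d W, OF d ts]) (auto simp: in_nlists_UNIV)
  finally have sum1: "(\<Sum>v\<in>nlists k UNIV. ?s v) = 1" by simp
  have nn: "0 \<le> ?s v" if "v \<in> nlists k UNIV" for v
    using N Q that by (intro succ_val_nonneg[of \<theta> d W, OF d ts]) (auto simp: povm_def in_nlists_UNIV)
  have "succ_val d W p ts (Q b) (\<lambda>_. decoded_povm d r m k N b) = (\<Sum>v\<in>?S. ?s v)"
    unfolding decoded_povm_def[abs_def]
    using c Q by (subst succ_val_lincomb[of \<theta> d W, OF d ts]) (auto simp: in_nlists_UNIV)
  also have "\<dots> = 1 - (\<Sum>v\<in>nlists k UNIV - ?S. ?s v)"
    using sum.subset_diff[of ?S "nlists k UNIV" ?s] sum1 by simp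
  finally have eq: "succ_val d W p ts (Q b) (\<lambda>_. decoded_povm d r m k N b) = 1 - (\<Sum>v\<in>nlists k UNIV - ?S. ?s v)" .
  \<comment> \<open>If \<open>True\<close> was sent, a wrong decision means
    \<open>bit_weight r False v < 1\<close>, and the weight in question is its inverse; if
    \<open>False\<close> was sent, the wrong outcomes are by definition those of weight at least
    1.\<close>
  have w1: "1 \<le> bit_weight r b v" if "v \<in> nlists k UNIV - ?S" for v
  proof (cases b)
    case True
    hence "bit_weight r False v < 1" using that by auto
    moreover have "bit_weight r True v = inverse (bit_weight r False v)"
      using bit_weight_not[OF r, of False v] by simp
    ultimately show ?thesis using True bit_weight_pos[OF r, of False v] by (simp add: one_le_inverse)
  qed (use that in auto)
  have "(\<Sum>v\<in>nlists k UNIV - ?S. ?s v) \<le> (\<Sum>v\<in>nlists k UNIV - ?S. bit_weight r b v * ?s v)"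
  proof (rule sum_mono)
    fix v assume v: "v \<in> nlists k UNIV - ?S"
    show "?s v \<le> bit_weight r b v * ?s v" using mult_right_mono[OF w1[OF v], of "?s v"] nn[of v] v by simp
  qed
  also have "\<dots> \<le> (\<Sum>v\<in>nlists k UNIV. bit_weight r b v * ?s v)"
    using nn bit_weight_pos[OF r] by (intro sum_mono2 mult_nonneg_nonneg) (auto intro: less_imp_le)
  finally show ?thesis using eq le by linarith
qed

subsection \<open>Generating and transmitting a key bit\<close>

lemma length_1_conv: "length v = Suc 0 \<longleftrightarrow> v = [hd v]"
  by (cases v) auto

lemma mat_trace_word_channel_append:
  fixes P P' :: "'a::finite list pmf"
  assumes d: "\<And>t a. t \<in> \<theta> \<Longrightarrow> density_op d (W t (return_pmf a))"
    and ts: "ts \<in> nlists m \<theta>" "ts' \<in> nlists n \<theta>"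
    and P: "set_pmf P \<subseteq> nlists m UNIV" "set_pmf P' \<subseteq> nlists n UNIV"
    and N: "N \<in> carrier_mat (d ^ m) (d ^ m)" "N' \<in> carrier_mat (d ^ n) (d ^ n)"
  shows "mat_trace (word_channel d W (ts @ ts') (append_pmf P P') * kron N N') =
    mat_trace (word_channel d W ts P * N) * mat_trace (word_channel d W ts' P' * N')"
proof -
  have c: "word_channel d W ts P \<in> carrier_mat (d ^ m) (d ^ m)" "word_channel d W ts' P' \<in> carrier_mat (d ^ n) (d ^ n)"
    using word_channel_density[of \<theta> d W, OF d ts(1) P(1)] word_channel_density[of \<theta> d W, OF d ts(2) P(2)]
    by (auto simp: density_op_def dest: positive_op_carrier)
  show ?thesis using kron_mult[OF c(1) N(1) c(2) N(2)]
    by (simp add: word_channel_append[of \<theta> d W, OF d ts P(1)] mat_trace_kron[OF mult_carrier_mat[OF c(1) N(1)] mult_carrier_mat[OF c(2) N(2)]])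
qed

lemma mat_trace_word_channel_one:
  fixes P :: "'a::finite list pmf"
  assumes d: "\<And>t a. t \<in> \<theta> \<Longrightarrow> density_op d (W t (return_pmf a))"
    and ts: "ts \<in> nlists m \<theta>" and P: "set_pmf P \<subseteq> nlists m UNIV"
  shows "mat_trace (word_channel d W ts P * 1\<^sub>m (d ^ m)) = 1"
  using word_channel_density[of \<theta> d W, OF d ts P]
  by (auto simp: density_op_def right_mult_one_mat[of _ "d ^ m" "d ^ m"] dest: positive_op_carrier)

text \<open>One source letter is set aside to produce the bit and the remaining \<open>m\<close>
  letters serve the detector, so the bit is independent of the correlation by which it is
  transmitted. The channel use that comes with the first letter carries the dummy input
  \<open>a0\<close>, and the receiver ignores it. A bit with probabilities \<open>P\<close> and
  \<open>1 - P\<close> has the collision probability stated.\<close>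

lemma key_bit_protocol:
  fixes p :: "('x::finite \<times> 'y::finite) pmf" and W :: "nat \<Rightarrow> 'a::finite pmf \<Rightarrow> complex mat" and x0 :: 'x
  assumes d: "\<And>t a. t \<in> \<theta> \<Longrightarrow> density_op d (W t (return_pmf a))"
    and 1: "detector d \<theta> W p r m k \<rho> Q N" and r: "r > 0"
  defines "P \<equiv> corr_exp p (Suc 0) (\<lambda>xs ys. of_bool (hd xs = x0))"
  shows "\<exists>u Q N. key_protocol d \<theta> W p (Suc m) 1 (1 - \<rho>) (P\<^sup>2 + (1 - P)\<^sup>2) u Q N"
proof -
  obtain a0 :: 'a where True by simp
  define u where "u xs = [hd xs = x0]" for xs
  define Q' where "Q' xs = append_pmf (return_pmf [a0]) (Q (hd xs = x0) (tl xs))" for xs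
  define M where "M = decoded_povm d r m k N"
  define N' where "N' v ys = kron (1\<^sub>m d) (M (hd v) (tl ys))" for v ys
  have Q: "\<And>b xs. length xs = m \<Longrightarrow> set_pmf (Q b xs) \<subseteq> nlists m UNIV" and N: "povm d m k N"
    using 1 by (auto simp only: detector_def)
  note one_pos = positive_op_one[of d]
  have Mpos: "positive_op (d ^ m) (M b ys)" if "length ys = m" for b ys
    unfolding M_def by (rule decoded_povm_positive[OF N that])
  have "key_protocol d \<theta> W p (Suc m) 1 (1 - \<rho>) (P\<^sup>2 + (1 - P)\<^sup>2) u Q' N'"
    unfolding key_protocol_def
  proof (intro conjI allI impI ballI)
    fix xs :: "'x list" assume "length xs = Suc m"
    thus "length (u xs) = 1" "set_pmf (Q' xs) \<subseteq> nlists (Suc m) UNIV"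
      using set_append_pmf[of "return_pmf [a0]" 1 "Q (hd xs = x0) (tl xs)" m] Q[of "tl xs"]
      by (simp_all add: u_def Q'_def in_nlists_UNIV)
  next
    show "povm d (Suc m) 1 N'" unfolding povm_def
    proof (intro allI impI conjI)
      fix ys :: "'y list" assume ys: "length ys = Suc m"
      show "positive_op (d ^ Suc m) (N' v ys)" for v
        unfolding N'_def using kron_positive[OF one_pos Mpos[of "tl ys" "hd v"]] ys by simp
      have "mat_lincomb (d ^ Suc m) (nlists 1 UNIV) (\<lambda>_. 1) (\<lambda>v. N' v ys) =
         mat_lincomb (d * d ^ m) UNIV (\<lambda>_. 1) (\<lambda>b. kron (1\<^sub>m d) (M b (tl ys)))"
        by (rule eq_matI) (auto simp: sum_nlists_one N'_def)
      also have "\<dots> = kron (1\<^sub>m d) (mat_lincomb (d ^ m) UNIV (\<lambda>_. 1) (\<lambda>b. M b (tl ys)))"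
        using Mpos[THEN positive_op_carrier, of "tl ys"] ys by (intro kron_lincomb_right[symmetric]) auto
      also have "\<dots> = 1\<^sub>m (d ^ Suc m)"
        using decoded_povm_sum[OF N, of "tl ys" r] ys unfolding M_def by (simp add: kron_one_one)
      finally show "mat_lincomb (d ^ Suc m) (nlists 1 UNIV) (\<lambda>_. 1) (\<lambda>v. N' v ys) = 1\<^sub>m (d ^ Suc m)" .
    qed
  next
    fix ts assume "ts \<in> nlists (Suc m) \<theta>"
    then obtain t ts' where ts: "ts = [t] @ ts'" "[t] \<in> nlists 1 \<theta>" "ts' \<in> nlists m \<theta>"
      by (auto simp: in_nlists_Suc_iff)
    have l: "length ts = 1 + m" "length ts' = m" using ts by auto
    have tr: "Re (mat_trace (word_channel d W ts (Q' ([x] @ xs)) * N' (u ([x] @ xs)) ([y] @ ys))) =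
      Re (mat_trace (word_channel d W ts' (Q (x = x0) xs) * M (x = x0) ys))"
      if "length xs = m" "length ys = m" for x xs y ys
      using mat_trace_word_channel_append[of \<theta> d W, OF d ts(2,3) _ Q[OF that(1)], of "return_pmf [a0]" "1\<^sub>m d" "M (x = x0) ys"]
        mat_trace_word_channel_one[of \<theta> d W, OF d ts(2), of "return_pmf [a0]"] Mpos[OF that(2), THEN positive_op_carrier] 
      by (simp add: ts(1) Q'_def N'_def u_def in_nlists_UNIV)
    have "succ_val d W p ts Q' (\<lambda>xs. N' (u xs)) =
      corr_exp p 1 (\<lambda>xs ys. succ_val d W p ts' (Q (hd xs = x0)) (\<lambda>_. M (hd xs = x0)))"
      unfolding succ_val_def l corr_exp_append
    proof (intro corr_exp_cong)
      fix xs xs' :: "'x list" and ys ys' :: "'y list"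
      assume "length xs = 1" "length ys = 1" "length xs' = m" "length ys' = m"
      thus "Re (mat_trace (word_channel d W ts (Q' (xs @ xs')) * N' (u (xs @ xs')) (ys @ ys'))) =
        Re (mat_trace (word_channel d W ts' (Q (hd xs = x0) xs') * M (hd xs = x0) ys'))"
        using tr[of xs' ys' "hd xs" "hd ys"] length_1_conv[of xs] length_1_conv[of ys] by simp
    qed
    also have "\<dots> \<ge> corr_exp p 1 (\<lambda>_ _. 1 - \<rho>)"
      unfolding M_def by (intro corr_exp_mono detector_decode[of \<theta> d W, OF d 1 r ts(3)])
    finally show "1 - \<rho> \<le> succ_val d W p ts Q' (\<lambda>xs. N' (u xs))" by simp
  next
    \<comment> \<open>The event concerns the first letter only, so the remaining block integrates
      out.\<close>
    have T: "corr_exp p (Suc m) (\<lambda>xs ys. of_bool (u xs = [True])) = P"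
      using corr_exp_append[of p "Suc 0" m "\<lambda>xs ys. of_bool (u xs = [True])"]
      unfolding P_def by (simp, intro corr_exp_cong) (auto simp: u_def length_Suc_conv)
    have F: "corr_exp p (Suc m) (\<lambda>xs ys. of_bool (u xs = [False])) = 1 - P"
    proof -
      have "corr_exp p (Suc m) (\<lambda>xs ys. of_bool (u xs = [False])) = corr_exp p (Suc m) (\<lambda>xs ys. 1 - of_bool (u xs = [True]))"
        by (intro corr_exp_cong) (auto simp: u_def)
      thus ?thesis by (simp add: corr_exp_diff T)
    qed
    show "(\<Sum>v\<in>nlists 1 UNIV. (corr_exp p (Suc m) (\<lambda>xs ys. of_bool (u xs = v)))\<^sup>2) \<le> P\<^sup>2 + (1 - P)\<^sup>2"
      by (simp add: sum_nlists_one UNIV_bool T F)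
  qed
  thus ?thesis by blast
qed

lemma key_protocol_power:
  fixes p :: "('x::finite \<times> 'y::finite) pmf"
  assumes d: "\<And>t a. t \<in> \<theta> \<Longrightarrow> density_op d (W t (return_pmf a))"
    and 1: "key_protocol d \<theta> W p m 1 s q u Q N" and s: "0 \<le> s"
  shows "\<exists>u Q N. key_protocol d \<theta> W p (Suc k * m) (Suc k) (s ^ Suc k) (q ^ Suc k) u Q N"
proof (induction k)
  case 0 thus ?case using 1 by auto
next
  case (Suc k)
  then obtain u' Q' N' where *: "key_protocol d \<theta> W p (Suc k * m) (Suc k) (s ^ Suc k) (q ^ Suc k) u' Q' N'" by blast
  have "0 \<le> s ^ Suc k" using s by simp
  from key_protocol_append[of \<theta> d W, OF d 1 * s this] show ?case by auto
qed

subsection \<open>Detecting a bit from correlated letters\<close>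

definition pair_exp :: "('x::finite \<times> 'y::finite) pmf \<Rightarrow> ('x \<Rightarrow> 'y \<Rightarrow> real) \<Rightarrow> real" where
  "pair_exp p F = (\<Sum>x\<in>UNIV. \<Sum>y\<in>UNIV. pmf p (x, y) * F x y)"

lemma pair_exp_corr_exp: "pair_exp p F = corr_exp p (Suc 0) (\<lambda>xs ys. F (hd xs) (hd ys))"
  by (simp add: corr_exp_one pair_exp_def)

lemma pair_exp_const [simp]: "pair_exp p (\<lambda>_ _. c) = c"
  by (simp add: pair_exp_corr_exp)

lemma corr_exp_Suc:
  "corr_exp p (Suc n) F = pair_exp p (\<lambda>x y. corr_exp p n (\<lambda>xs ys. F (x # xs) (y # ys)))"
  using corr_exp_append[of p "Suc 0" n F] by (simp add: corr_exp_one pair_exp_def)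

lemma corr_exp_nth:
  "i < n \<Longrightarrow> corr_exp p n (\<lambda>xs ys. F (xs ! i) (ys ! i)) = pair_exp p F"
  by (induction n arbitrary: i) (auto simp: corr_exp_Suc nth_Cons' less_Suc_eq_0_disj)

lemma pair_exp_mult_const: "pair_exp p (\<lambda>x y. F x y * c) = pair_exp p F * c"
  unfolding pair_exp_def sum_distrib_right by (simp add: mult.assoc)

lemma corr_exp_nth_nth:
  assumes "i < n" "j < n" "i \<noteq> j"
  shows "corr_exp p n (\<lambda>xs ys. f (xs ! i) * g (ys ! j)) = pair_exp p (\<lambda>x y. f x) * pair_exp p (\<lambda>x y. g y)"
  using assms
proof (induction n arbitrary: i j)
  case (Suc n)
  show ?case
  proof (cases i)
    case 0
    then obtain j' where j: "j = Suc j'" "j' < n" using Suc.prems by (cases j) auto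
    show ?thesis using 0 j corr_exp_nth[of j' n p "\<lambda>x y. g y"]
      by (simp add: corr_exp_Suc corr_exp_cmult pair_exp_mult_const)
  next
    case (Suc i')
    show ?thesis
    proof (cases j)
      case 0
      thus ?thesis using Suc Suc.prems corr_exp_nth[of i' n p "\<lambda>x y. f x"]
        corr_exp_cmult[of p n _ "\<lambda>xs ys. f (xs ! i')"] pair_exp_mult_const[of p "\<lambda>x y. g y" "pair_exp p (\<lambda>x y. f x)"]
        by (simp add: corr_exp_Suc mult.commute)
    next
      case (Suc j')
      thus ?thesis using \<open>i = Suc i'\<close> Suc.IH[of i' j'] Suc.prems by (simp add: corr_exp_Suc)
    qed
  qed
qed simp

text \<open>By the arithmetic-geometric mean inequality, entries of modulus at most \<open>B\<close>
  give a quadratic form of modulus at most \<open>B * real d\<close> times the squared norm of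
  \<open>v\<close>, hence at most half of that norm; the form of one half of the identity
  compensates this.\<close>

lemma positive_op_half_plus:
  fixes H :: "complex mat"
  assumes herm: "\<And>i j. i < d \<Longrightarrow> j < d \<Longrightarrow> H $$ (i, j) = cnj (H $$ (j, i))"
    and bound: "\<And>i j. i < d \<Longrightarrow> j < d \<Longrightarrow> cmod (H $$ (i, j)) \<le> B" and B: "B * real d \<le> 1 / 2"
    and R: "R \<in> carrier_mat d d" "\<And>i j. i < d \<Longrightarrow> j < d \<Longrightarrow> R $$ (i, j) = of_bool (i = j) / 2 + H $$ (i, j)"
  shows "positive_op d R"
  unfolding positive_op_iff_sum
proof (intro conjI allI)
  fix v :: "nat \<Rightarrow> complex"
  define h where "h = (\<Sum>i<d. \<Sum>j<d. cnj (v i) * H $$ (i, j) * v j)"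
  define V where "V = (\<Sum>i<d. (cmod (v i))\<^sup>2)"
  have "(\<Sum>i<d. \<Sum>j<d. cnj (v i) * R $$ (i, j) * v j) = (\<Sum>i<d. \<Sum>j<d. (cnj (v i) * v j / 2) * of_bool (j = i)) + h"
    unfolding h_def sum.distrib[symmetric] by (intro sum.cong refl) (auto simp: R algebra_simps)
  also have "(\<Sum>i<d. \<Sum>j<d. (cnj (v i) * v j / 2) * of_bool (j = i)) = (\<Sum>i<d. cnj (v i) * v i / 2)"
    by (intro sum.cong refl sum_mult_delta) auto
  also have "\<dots> = complex_of_real (V / 2)"
    by (simp add: V_def mult.commute complex_norm_square sum_divide_distrib del: of_real_power)
  finally have eq: "(\<Sum>i<d. \<Sum>j<d. cnj (v i) * R $$ (i, j) * v j) = complex_of_real (V / 2) + h" .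
  have "cnj h = (\<Sum>i<d. \<Sum>j<d. cnj (v j) * H $$ (j, i) * v i)"
    unfolding h_def cnj_sum
  proof (intro sum.cong refl)
    fix i j assume "i \<in> {..<d}" "j \<in> {..<d}"
    hence "cnj (H $$ (i, j)) = H $$ (j, i)" using herm[of j i] by simp
    thus "cnj (cnj (v i) * H $$ (i, j) * v j) = cnj (v j) * H $$ (j, i) * v i" by simp
  qed
  also have "\<dots> = h" unfolding h_def by (rule sum.swap)
  finally have im: "Im h = 0" by (simp add: complex_eq_iff)
  have "cmod h \<le> (\<Sum>i<d. \<Sum>j<d. B * (((cmod (v i))\<^sup>2 + (cmod (v j))\<^sup>2) / 2))"
    unfolding h_def
  proof (intro order_trans[OF norm_sum] sum_mono order_trans[OF norm_sum])
    fix i j assume ij: "i \<in> {..<d}" "j \<in> {..<d}"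
    have "cmod (cnj (v i) * H $$ (i, j) * v j) = cmod (H $$ (i, j)) * (cmod (v i) * cmod (v j))"
      by (simp add: norm_mult)
    also have "\<dots> \<le> B * (cmod (v i) * cmod (v j))"
      using bound ij by (intro mult_right_mono) auto
    also have "cmod (v i) * cmod (v j) \<le> ((cmod (v i))\<^sup>2 + (cmod (v j))\<^sup>2) / 2"
      using sum_squares_bound[of "cmod (v i)" "cmod (v j)"] by simp
    hence "B * (cmod (v i) * cmod (v j)) \<le> B * (((cmod (v i))\<^sup>2 + (cmod (v j))\<^sup>2) / 2)"
      using order_trans[OF norm_ge_zero bound[of i j]] ij by (intro mult_left_mono) auto
    finally show "cmod (cnj (v i) * H $$ (i, j) * v j) \<le> B * (((cmod (v i))\<^sup>2 + (cmod (v j))\<^sup>2) / 2)" .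
  qed
  also have "\<dots> = (\<Sum>i<d. \<Sum>j<d. B / 2 * (cmod (v i))\<^sup>2) + (\<Sum>i<d. \<Sum>j<d. B / 2 * (cmod (v j))\<^sup>2)"
    unfolding sum.distrib[symmetric] by (simp add: distrib_left add_divide_distrib)
  also have "\<dots> = B * real d * V"
    unfolding sum_distrib_left[symmetric] V_def[symmetric] by (simp add: V_def[symmetric] flip: sum_distrib_left)
  also have "\<dots> \<le> 1 / 2 * V"
    using B by (intro mult_right_mono) (auto simp: V_def sum_nonneg)
  finally have "\<bar>Re h\<bar> \<le> V / 2" using abs_Re_le_cmod[of h] by linarith
  thus "0 \<le> (\<Sum>i<d. \<Sum>j<d. cnj (v i) * R $$ (i, j) * v j)"
    unfolding eq using im by (simp add: less_eq_complex_def)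
qed (fact R(1))

lemma word_channel_letter:
  fixes A :: "'a::finite pmf"
  assumes "\<And>a. W t (return_pmf a) \<in> carrier_mat d d"
  shows "word_channel d W [t] (map_pmf (\<lambda>a. [a]) A) = mat_lincomb d UNIV (pmf A) (\<lambda>a. W t (return_pmf a))"
proof -
  have "pmf (map_pmf (\<lambda>a. [a]) A) [a] = pmf A a" for a
    by (rule pmf_map_inj') (auto simp: inj_on_def)
  moreover have "word_state W [t] [a] = W t (return_pmf a)" for a
    using kron_one_right by (simp add: word_state_def)
  ultimately show ?thesis
    unfolding word_channel_alt by (intro eq_matI) (auto simp: sum_nlists_one)
qed

definition bit_sign :: "bool \<Rightarrow> real" where "bit_sign b = (if b then 1 else -1)"

lemma abs_bit_sign [simp]: "\<bar>bit_sign b\<bar> = 1"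
  by (simp add: bit_sign_def)

text \<open>Position \<open>h a\<close> holds the source letter reserved for the input letter
  \<open>a\<close>. Subtracting the mean keeps the total mass at 1, and the factor 1/2 keeps the
  weights nonnegative as long as \<open>f\<close> is bounded by 1 in modulus.\<close>

definition perturbed_letter :: "('a::finite \<Rightarrow> nat) \<Rightarrow> ('x \<Rightarrow> real) \<Rightarrow> bool \<Rightarrow> 'x list \<Rightarrow> 'a pmf" where
  "perturbed_letter h f b xs = embed_pmf (\<lambda>a. 1 / real CARD('a) + bit_sign b / (2 * real CARD('a)) *
     (f (xs ! h a) - (\<Sum>a'\<in>UNIV. f (xs ! h a')) / real CARD('a)))"

lemma pmf_perturbed_letter:
  fixes h :: "'a::finite \<Rightarrow> nat"
  assumes f: "\<And>x. \<bar>f x\<bar> \<le> 1"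
  shows "pmf (perturbed_letter h f b xs) a = 1 / real CARD('a) + bit_sign b / (2 * real CARD('a)) *
     (f (xs ! h a) - (\<Sum>a'\<in>UNIV. f (xs ! h a')) / real CARD('a))"
  unfolding perturbed_letter_def
proof (rule pmf_embed_pmf)
  let ?K = "real CARD('a)"
  let ?m = "(\<Sum>a'\<in>UNIV. f (xs ! h a')) / ?K"
  let ?P = "\<lambda>a. 1 / ?K + bit_sign b / (2 * ?K) * (f (xs ! h a) - ?m)"
  have K: "?K > 0" by simp
  have m: "\<bar>?m\<bar> \<le> 1"
  proof -
    have "\<bar>\<Sum>a'\<in>UNIV. f (xs ! h a')\<bar> \<le> (\<Sum>a'\<in>(UNIV :: 'a set). 1)"
      using f by (intro order_trans[OF sum_abs] sum_mono)
    thus ?thesis using K by (simp add: abs_divide)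
  qed
  show nn: "0 \<le> ?P a" for a
  proof -
    have "\<bar>f (xs ! h a) - ?m\<bar> \<le> 2" using f[of "xs ! h a"] m by linarith
    hence "\<bar>bit_sign b * (f (xs ! h a) - ?m)\<bar> \<le> 2" by (simp add: abs_mult abs_bit_sign)
    hence "- 2 \<le> bit_sign b * (f (xs ! h a) - ?m)" by linarith
    hence "- 2 / (2 * ?K) \<le> bit_sign b * (f (xs ! h a) - ?m) / (2 * ?K)"
      using K by (intro divide_right_mono) auto
    thus ?thesis using K by simp
  qed
  have "(\<Sum>a\<in>UNIV. ?P a) = (\<Sum>a\<in>(UNIV :: 'a set). 1 / ?K) + bit_sign b / (2 * ?K) * (\<Sum>a\<in>UNIV. f (xs ! h a) - ?m)"
    by (simp only: sum.distrib sum_distrib_left)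
  also have "(\<Sum>a\<in>UNIV. f (xs ! h a) - ?m) = 0" by (simp add: sum_subtractf)
  finally have "(\<Sum>a\<in>UNIV. ?P a) = 1" by simp
  thus "(\<integral>\<^sup>+ a. ennreal (?P a) \<partial>count_space UNIV) = 1"
    using nn by (simp add: nn_integral_count_space_finite sum_ennreal)
qed

text \<open>Only the diagonal survives. Letters at different positions are independent and centred,
  so \<open>f\<close> and \<open>g\<close> correlate only when \<open>a = a'\<close>; the mean
  subtracted in \<open>perturbed_letter\<close> leaves a term proportional to the sum of
  \<open>w a' a\<close> over \<open>a'\<close>, which vanishes. In the application
  \<open>w a' a\<close> is the expectation of \<open>M a'\<close> in the output state for
  \<open>a\<close>.\<close>

lemma perturbed_letter_expectation:
  fixes h :: "'a::finite \<Rightarrow> nat" and p :: "('x::finite \<times> 'y::finite) pmf" and w :: "'a \<Rightarrow> 'a \<Rightarrow> real"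
  assumes f: "\<And>x. \<bar>f x\<bar> \<le> 1" and h: "bij_betw h UNIV {..<CARD('a)}"
    and E: "pair_exp p (\<lambda>x y. f x) = 0" "pair_exp p (\<lambda>x y. g y) = 0" "pair_exp p (\<lambda>x y. f x * g y) = \<kappa>"
    and w: "\<And>a. (\<Sum>a'\<in>UNIV. w a' a) = 0"
  shows "corr_exp p CARD('a) (\<lambda>xs ys. \<Sum>a\<in>UNIV. pmf (perturbed_letter h f b xs) a *
      (1 / 2 + c * (\<Sum>a'\<in>UNIV. g (ys ! h a') * w a' a))) =
    1 / 2 + c * bit_sign b * \<kappa> / (2 * real CARD('a)) * (\<Sum>a\<in>UNIV. w a a)"
proof -
  let ?K = "real CARD('a)" and ?n = "CARD('a)"
  let ?A = "\<lambda>xs. pmf (perturbed_letter h f b xs)"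
  have hl: "h a < ?n" for a using h by (auto simp: bij_betw_def)
  have hi: "h a = h a' \<longleftrightarrow> a = a'" for a a' using h by (auto simp: bij_betw_def inj_on_def)
  have Efg: "corr_exp p ?n (\<lambda>xs ys. f (xs ! h a) * g (ys ! h a')) = of_bool (a = a') * \<kappa>" for a a'
    using corr_exp_nth[OF hl, of p "\<lambda>x y. f x * g y" a] corr_exp_nth_nth[OF hl hl, of a a' p f g] E
    by (cases "a = a'") (auto simp: hi)
  have Eg: "corr_exp p ?n (\<lambda>xs ys. g (ys ! h a)) = 0" for a
    using corr_exp_nth[OF hl, of p "\<lambda>x y. g y" a] E by simp
  have EA: "corr_exp p ?n (\<lambda>xs ys. ?A xs a * g (ys ! h a')) =
     bit_sign b * \<kappa> / (2 * ?K) * (of_bool (a = a') - 1 / ?K)" for a a'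
  proof -
    have "corr_exp p ?n (\<lambda>xs ys. ?A xs a * g (ys ! h a')) = corr_exp p ?n (\<lambda>xs ys. 1 / ?K * g (ys ! h a') +
       bit_sign b / (2 * ?K) * (f (xs ! h a) * g (ys ! h a') - 1 / ?K * (\<Sum>a''\<in>UNIV. f (xs ! h a'') * g (ys ! h a'))))"
      unfolding pmf_perturbed_letter[of f, OF f]
      by (intro corr_exp_cong) (simp add: algebra_simps sum_distrib_left sum_distrib_right sum_divide_distrib)
    also have "\<dots> = bit_sign b / (2 * ?K) * (of_bool (a = a') * \<kappa> - 1 / ?K * (\<Sum>a''\<in>UNIV. of_bool (a'' = a') * \<kappa>))"
      unfolding corr_exp_add corr_exp_diff corr_exp_cmult corr_exp_sum Efg Eg by simp
    also have "(\<Sum>a''\<in>UNIV. of_bool (a'' = a') * \<kappa>) = \<kappa>"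
      by (simp add: sum_of_bool_mult_eq)
    also have "bit_sign b / (2 * ?K) * (of_bool (a = a') * \<kappa> - 1 / ?K * \<kappa>) =
       bit_sign b * \<kappa> / (2 * ?K) * (of_bool (a = a') - 1 / ?K)"
    proof -
      have "s / e * (y * \<kappa> - D * \<kappa>) = s * \<kappa> / e * (y - D)" for s e y D
        by (simp add: right_diff_distrib diff_divide_distrib mult_ac)
      thus ?thesis .
    qed
    finally show ?thesis .
  qed
  have "corr_exp p ?n (\<lambda>xs ys. \<Sum>a\<in>UNIV. ?A xs a * (1 / 2 + c * (\<Sum>a'\<in>UNIV. g (ys ! h a') * w a' a))) =
    corr_exp p ?n (\<lambda>xs ys. 1 / 2 + c * (\<Sum>a\<in>UNIV. \<Sum>a'\<in>UNIV. w a' a * (?A xs a * g (ys ! h a'))))"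
  proof (intro corr_exp_cong)
    fix xs :: "'x list" and ys :: "'y list"
    have 1: "(\<Sum>a\<in>UNIV. ?A xs a) = 1" by (rule sum_pmf_eq_1) auto
    have "(\<Sum>a\<in>UNIV. ?A xs a * (1 / 2 + c * (\<Sum>a'\<in>UNIV. g (ys ! h a') * w a' a))) =
      (\<Sum>a\<in>UNIV. ?A xs a * (1 / 2)) + (\<Sum>a\<in>UNIV. c * (?A xs a * (\<Sum>a'\<in>UNIV. g (ys ! h a') * w a' a)))"
      unfolding sum.distrib[symmetric] by (intro sum.cong refl) (simp only: distrib_left mult_ac)
    also have "(\<Sum>a\<in>UNIV. ?A xs a * (1 / 2)) = 1 / 2"
      unfolding sum_distrib_right[symmetric] 1 by simp
    also have "(\<Sum>a\<in>UNIV. c * (?A xs a * (\<Sum>a'\<in>UNIV. g (ys ! h a') * w a' a))) =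
       c * (\<Sum>a\<in>UNIV. \<Sum>a'\<in>UNIV. w a' a * (?A xs a * g (ys ! h a')))"
      unfolding sum_distrib_left by (intro sum.cong refl) (simp only: mult_ac)
    finally show "(\<Sum>a\<in>UNIV. ?A xs a * (1 / 2 + c * (\<Sum>a'\<in>UNIV. g (ys ! h a') * w a' a))) =
      1 / 2 + c * (\<Sum>a\<in>UNIV. \<Sum>a'\<in>UNIV. w a' a * (?A xs a * g (ys ! h a')))" .
  qed
  also have "\<dots> = 1 / 2 + c * (\<Sum>a\<in>UNIV. \<Sum>a'\<in>UNIV. w a' a * (bit_sign b * \<kappa> / (2 * ?K) * (of_bool (a = a') - 1 / ?K)))"
    unfolding corr_exp_add corr_exp_cmult corr_exp_sum EA by simp
  also have "(\<Sum>a\<in>UNIV. \<Sum>a'\<in>UNIV. w a' a * (bit_sign b * \<kappa> / (2 * ?K) * (of_bool (a = a') - 1 / ?K))) =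
     (\<Sum>a\<in>UNIV. bit_sign b * \<kappa> / (2 * ?K) * (w a a))"
  proof (intro sum.cong refl)
    fix a :: 'a
    have alg: "x * (C * (y - D)) = C * (x * y - D * x)" for x y C D :: real
      by (simp add: algebra_simps)
    have "(\<Sum>a'\<in>UNIV. w a' a * (bit_sign b * \<kappa> / (2 * ?K) * (of_bool (a = a') - 1 / ?K))) =
      bit_sign b * \<kappa> / (2 * ?K) * ((\<Sum>a'\<in>UNIV. w a' a * of_bool (a = a')) - 1 / ?K * (\<Sum>a'\<in>UNIV. w a' a))"
      unfolding sum_distrib_left sum_subtractf[symmetric] by (intro sum.cong refl alg)
    also have "(\<Sum>a'\<in>UNIV. w a' a * of_bool (a = a')) = w a a"
      by (simp add: sum_mult_of_bool_eq)
    finally show "(\<Sum>a'\<in>UNIV. w a' a * (bit_sign b * \<kappa> / (2 * ?K) * (of_bool (a = a') - 1 / ?K))) = bit_sign b * \<kappa> / (2 * ?K) * (w a a)"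
      using w by simp
  qed
  finally show ?thesis by (simp only: sum_distrib_left[symmetric] mult.assoc) (simp add: mult_ac)
qed

text \<open>Each channel use comes with one source letter pair, but the signal needs one pair per
  input letter. A block of \<open>CARD('a)\<close> uses therefore collects the letters; only its
  first use carries the signal, and the others send \<open>a0\<close> and are met with the
  identity.\<close>

lemma detector_base:
  fixes p :: "('x::finite \<times> 'y::finite) pmf" and W :: "nat \<Rightarrow> 'a::finite pmf \<Rightarrow> complex mat" and M :: "'a \<Rightarrow> complex mat"
  assumes dens: "\<And>t a. t \<in> \<theta> \<Longrightarrow> density_op d (W t (return_pmf a))" and d: "d > 0"
    and M: "\<And>a. M a \<in> carrier_mat d d" "\<And>a i j. i < d \<Longrightarrow> j < d \<Longrightarrow> M a $$ (i, j) = cnj (M a $$ (j, i))"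
      "\<And>i j. i < d \<Longrightarrow> j < d \<Longrightarrow> (\<Sum>a\<in>UNIV. M a $$ (i, j)) = 0"
    and sep: "\<And>t. t \<in> \<theta> \<Longrightarrow> c \<le> (\<Sum>a\<in>UNIV. Re (mat_trace (W t (return_pmf a) * M a)))" and c: "c > 0"
    and f: "\<And>x. \<bar>f x\<bar> \<le> 1" and g: "\<And>y. \<bar>g y\<bar> \<le> 1"
    and E: "pair_exp p (\<lambda>x y. f x) = 0" "pair_exp p (\<lambda>x y. g y) = 0" "pair_exp p (\<lambda>x y. f x * g y) = \<kappa>"
    and \<kappa>: "\<kappa> > 0"
  shows "\<exists>r \<rho> Q N. r > 0 \<and> 0 \<le> \<rho> \<and> \<rho> < 1 \<and> detector d \<theta> W p r CARD('a) 1 \<rho> Q N"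
proof -
  let ?K = "real CARD('a)" and ?n = "CARD('a)"
  obtain a0 :: 'a where True by simp
  obtain h :: "'a \<Rightarrow> nat" where h: "bij_betw h UNIV {..<?n}"
    using ex_bij_betw_finite_nat[of "UNIV :: 'a set"] by (auto simp: atLeast0LessThan)
  have n: "?n = 1 + (?n - 1)" by (simp add: Suc_leI)
  define B where "B = (\<Sum>a\<in>UNIV. \<Sum>i<d. \<Sum>j<d. cmod (M a $$ (i, j)))"
  have B0: "B \<ge> 0" by (simp add: B_def sum_nonneg)
  \<comment> \<open>\<open>B\<close> sums the moduli of all entries of all \<open>M a\<close>. With
    this scale the perturbation satisfies the bound of \<open>positive_op_half_plus\<close>;
    \<open>B + 1\<close> avoids division by zero.\<close>
  define \<eta> where "\<eta> = 1 / (2 * real d * (B + 1))"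
  have \<eta>: "\<eta> > 0" using d B0 by (simp add: \<eta>_def)
  define H where "H z ys = mat_lincomb d UNIV (\<lambda>a. bit_sign z * \<eta> * g (ys ! h a)) M" for z ys
  \<comment> \<open>One half of the identity plus \<open>H\<close>, written as a linear combination
    over \<open>bool\<close> so that the trace formula for combinations applies: \<open>True\<close>
    indexes the identity, \<open>False\<close> the perturbation.\<close>
  define R where "R z ys = mat_lincomb d UNIV (\<lambda>b. if b then 1 / 2 else 1) (\<lambda>b. if b then 1\<^sub>m d else H z ys)" for z ys
  define N where "N v ys = kron (R (hd v) ys) (1\<^sub>m (d ^ (?n - 1)))" for v ys
  define Q where "Q b xs = append_pmf (map_pmf (\<lambda>a. [a]) (perturbed_letter h f b xs)) (return_pmf (replicate (?n - 1) a0))" for b xs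
  define w where "w t a' a = Re (mat_trace (W t (return_pmf a) * M a'))" for t a' a
  have Rc: "R z ys \<in> carrier_mat d d" for z ys by (simp add: R_def)
  have Re_entry: "R z ys $$ (i, j) = of_bool (i = j) / 2 + H z ys $$ (i, j)" if "i < d" "j < d" for z ys i j
    using that by (simp add: R_def UNIV_bool add.commute)
  have R_pos: "positive_op d (R z ys)" for z ys
  proof (rule positive_op_half_plus[where H = "H z ys" and B = "\<eta> * B"])
    fix i j assume ij: "i < d" "j < d"
    show "H z ys $$ (i, j) = cnj (H z ys $$ (j, i))"
      using ij M(2)[OF ij] by (simp add: H_def)
    have "cmod (H z ys $$ (i, j)) \<le> (\<Sum>a\<in>UNIV. cmod (complex_of_real (bit_sign z * \<eta> * g (ys ! h a)) * M a $$ (i, j)))"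
      using ij by (simp add: H_def norm_sum del: of_real_mult)
    also have "\<dots> \<le> (\<Sum>a\<in>UNIV. \<eta> * (\<Sum>i<d. \<Sum>j<d. cmod (M a $$ (i, j))))"
    proof (intro sum_mono)
      fix a :: 'a
      have "cmod (M a $$ (i, j)) \<le> (\<Sum>j<d. cmod (M a $$ (i, j)))"
        using ij by (intro member_le_sum) auto
      also have "\<dots> \<le> (\<Sum>i<d. \<Sum>j<d. cmod (M a $$ (i, j)))"
        using ij by (intro member_le_sum[of i "{..<d}" "\<lambda>i. \<Sum>j<d. cmod (M a $$ (i, j))"]) (auto intro: sum_nonneg)
      finally have le: "cmod (M a $$ (i, j)) \<le> (\<Sum>i<d. \<Sum>j<d. cmod (M a $$ (i, j)))" .
      have "\<bar>bit_sign z * \<eta> * g (ys ! h a)\<bar> \<le> \<eta>"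
        using \<eta> g[of "ys ! h a"] by (simp add: abs_mult bit_sign_def mult_left_le)
      thus "cmod (complex_of_real (bit_sign z * \<eta> * g (ys ! h a)) * M a $$ (i, j)) \<le> \<eta> * (\<Sum>i<d. \<Sum>j<d. cmod (M a $$ (i, j)))"
        unfolding norm_mult norm_of_real using \<eta> le by (intro mult_mono) auto
    qed
    also have "\<dots> = \<eta> * B" by (simp add: B_def sum_distrib_left)
    finally show "cmod (H z ys $$ (i, j)) \<le> \<eta> * B" .
  next
    have "\<eta> * real d = 1 / (2 * (B + 1))" using d by (simp add: \<eta>_def)
    hence "\<eta> * B * real d = B / (2 * (B + 1))" by (metis mult.assoc mult.commute mult.right_neutral times_divide_eq_right)
    also have "\<dots> \<le> 1 / 2" using B0 by (simp add: divide_le_eq)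
    finally show "\<eta> * B * real d \<le> 1 / 2" .
  qed (use Rc Re_entry in auto)
  have R_sum: "R True ys $$ (i, j) + R False ys $$ (i, j) = of_bool (i = j)" if "i < d" "j < d" for ys i j
    using that by (simp add: Re_entry H_def bit_sign_def sum_negf)
  have povm: "povm d ?n 1 N" unfolding povm_def
  proof (intro allI impI conjI)
    fix ys :: "'y list" assume ys: "length ys = ?n"
    have dn: "d ^ ?n = d * d ^ (?n - 1)" using n by (metis power_Suc plus_1_eq_Suc)
    show "positive_op (d ^ ?n) (N v ys)" for v
      unfolding N_def dn by (intro kron_positive R_pos positive_op_one)
    have "mat_lincomb (d ^ ?n) (nlists 1 UNIV) (\<lambda>_. 1) (\<lambda>v. N v ys) = kron (1\<^sub>m d) (1\<^sub>m (d ^ (?n - 1)))"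
    proof (rule eq_matI)
      fix i j assume "i < dim_row (kron (1\<^sub>m d) (1\<^sub>m (d ^ (?n - 1))) :: complex mat)" "j < dim_col (kron (1\<^sub>m d) (1\<^sub>m (d ^ (?n - 1))) :: complex mat)"
      hence ij: "i < d * d ^ (?n - 1)" "j < d * d ^ (?n - 1)" by auto
      note ij' = div_mod_less_mult[OF ij(1)] div_mod_less_mult[OF ij(2)]
      have ent: "kron (R z ys) (1\<^sub>m (d ^ (?n - 1))) $$ (i, j) =
         R z ys $$ (i div d ^ (?n - 1), j div d ^ (?n - 1)) * 1\<^sub>m (d ^ (?n - 1)) $$ (i mod d ^ (?n - 1), j mod d ^ (?n - 1))" for z
        using ij Rc[of z ys] by (subst kron_entry) auto
      have "mat_lincomb (d ^ ?n) (nlists 1 UNIV) (\<lambda>_. 1) (\<lambda>v. N v ys) $$ (i, j) = N [False] ys $$ (i, j) + N [True] ys $$ (i, j)"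
        using ij by (simp add: dn sum_nlists_one UNIV_bool)
      also have "\<dots> = (R True ys $$ (i div d ^ (?n - 1), j div d ^ (?n - 1)) + R False ys $$ (i div d ^ (?n - 1), j div d ^ (?n - 1))) *
         1\<^sub>m (d ^ (?n - 1)) $$ (i mod d ^ (?n - 1), j mod d ^ (?n - 1))"
        unfolding N_def list.sel ent by (simp only: distrib_right add.commute)
      also have "\<dots> = kron (1\<^sub>m d) (1\<^sub>m (d ^ (?n - 1))) $$ (i, j)"
        unfolding R_sum[OF ij'(1,3)] using ij ij' by (subst kron_entry) auto
      finally show "mat_lincomb (d ^ ?n) (nlists 1 UNIV) (\<lambda>_. 1) (\<lambda>v. N v ys) $$ (i, j) = kron (1\<^sub>m d) (1\<^sub>m (d ^ (?n - 1))) $$ (i, j)" .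
    qed (auto simp: dn)
    thus "mat_lincomb (d ^ ?n) (nlists 1 UNIV) (\<lambda>_. 1) (\<lambda>v. N v ys) = 1\<^sub>m (d ^ ?n)"
      by (simp add: kron_one_one dn)
  qed
  have Qs: "set_pmf (Q b xs) \<subseteq> nlists ?n UNIV" for b xs
  proof -
    have "set_pmf (Q b xs) \<subseteq> nlists (1 + (?n - 1)) UNIV"
      unfolding Q_def by (intro set_append_pmf) (auto simp: in_nlists_UNIV)
    thus ?thesis using n by simp
  qed
  have wsum: "(\<Sum>a'\<in>UNIV. w t a' a) = 0" if "t \<in> \<theta>" for t a
  proof -
    have Wc: "W t (return_pmf a) \<in> carrier_mat d d" using dens[OF that] by (auto simp: density_op_def dest: positive_op_carrier)
    have "(\<Sum>a'\<in>UNIV. mat_trace (W t (return_pmf a) * M a')) = mat_trace (W t (return_pmf a) * mat_lincomb d UNIV (\<lambda>_. 1) M)"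
      using mat_trace_mult_lincomb[of UNIV M d "W t (return_pmf a)" "\<lambda>_. 1"] M(1) Wc by simp
    also have "\<dots> = 0"
      using Wc M(3) by (subst mat_trace_mult[of _ d d]) auto
    finally show ?thesis unfolding w_def by (metis Re_sum zero_complex.simps(1))
  qed
  have sv: "succ_val d W p ts (Q b) (\<lambda>_. N [z]) =
    1 / 2 + bit_sign z * \<eta> * bit_sign b * \<kappa> / (2 * ?K) * (\<Sum>a\<in>UNIV. w (hd ts) a a)" if ts: "ts \<in> nlists ?n \<theta>" for ts b z
  proof -
    obtain t ts' where t: "ts = [t] @ ts'" "[t] \<in> nlists 1 \<theta>" "ts' \<in> nlists (?n - 1) \<theta>"
      using ts n by (metis take_drop_nlists append_take_drop_id length_1_conv nlistsE_length One_nat_def)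
    have tt: "t \<in> \<theta>" using t(2) by simp
    have Wc: "W t (return_pmf a) \<in> carrier_mat d d" for a using dens[OF tt] by (auto simp: density_op_def dest: positive_op_carrier)
    have tr1: "mat_trace (W t (return_pmf a)) = 1" for a using dens[OF tt] by (simp add: density_op_def)
    have "Re (mat_trace (word_channel d W ts (Q b xs) * N [z] ys)) =
      (\<Sum>a\<in>UNIV. pmf (perturbed_letter h f b xs) a * (1 / 2 + bit_sign z * \<eta> * (\<Sum>a'\<in>UNIV. g (ys ! h a') * w t a' a)))" for xs ys
    proof -
      have Rtr: "mat_trace (W t (return_pmf a) * R z ys) = 1 / 2 + (\<Sum>a'\<in>UNIV. complex_of_real (bit_sign z * \<eta> * g (ys ! h a')) * mat_trace (W t (return_pmf a) * M a'))" for a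
        unfolding R_def using Wc[of a] M(1) tr1
        by (subst mat_trace_mult_lincomb) (auto simp: UNIV_bool H_def mat_trace_mult_lincomb right_mult_one_mat[of _ d d])
      have "mat_trace (word_channel d W ts (Q b xs) * N [z] ys) =
        mat_trace (word_channel d W [t] (map_pmf (\<lambda>a. [a]) (perturbed_letter h f b xs)) * R z ys) *
        mat_trace (word_channel d W ts' (return_pmf (replicate (?n - 1) a0)) * 1\<^sub>m (d ^ (?n - 1)))"
        unfolding t(1) Q_def N_def list.sel using Rc
        by (intro mat_trace_word_channel_append[of \<theta> d W, OF dens t(2,3)]) (auto simp: in_nlists_UNIV)
      also have "mat_trace (word_channel d W ts' (return_pmf (replicate (?n - 1) a0)) * 1\<^sub>m (d ^ (?n - 1))) = 1"
        by (intro mat_trace_word_channel_one[of \<theta> d W, OF dens t(3)]) (auto simp: in_nlists_UNIV)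
      also have "mat_trace (word_channel d W [t] (map_pmf (\<lambda>a. [a]) (perturbed_letter h f b xs)) * R z ys) =
        (\<Sum>a\<in>UNIV. complex_of_real (pmf (perturbed_letter h f b xs) a) * mat_trace (W t (return_pmf a) * R z ys))"
        unfolding word_channel_letter[where W = W, OF Wc] using Wc Rc by (intro mat_trace_lincomb_mult) auto
      finally show ?thesis
        unfolding Rtr by (simp add: w_def sum_distrib_left mult_ac)
    qed
    hence "succ_val d W p ts (Q b) (\<lambda>_. N [z]) =
      corr_exp p ?n (\<lambda>xs ys. \<Sum>a\<in>UNIV. pmf (perturbed_letter h f b xs) a * (1 / 2 + bit_sign z * \<eta> * (\<Sum>a'\<in>UNIV. g (ys ! h a') * w t a' a)))"
      using ts by (simp add: succ_val_def)
    also have "\<dots> = 1 / 2 + bit_sign z * \<eta> * bit_sign b * \<kappa> / (2 * ?K) * (\<Sum>a\<in>UNIV. w t a a)"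
      by (rule perturbed_letter_expectation[OF f h E wsum[OF tt]])
    finally show ?thesis by (simp add: t(1))
  qed
  \<comment> \<open>The bias towards the sent bit that is guaranteed for every state of the jammer,
    through the lower bound \<open>c\<close>.\<close>
  define k where "k = \<eta> * \<kappa> / (2 * ?K) * c"
  have k: "k > 0" using \<eta> \<kappa> c by (simp add: k_def)
  \<comment> \<open>With the tilt \<open>1 + k\<close> the weighted sum at bias \<open>k\<close>
    equals 1 - (3 k^2 / 2 + k^3) / r, strictly below 1.\<close>
  define r where "r = 1 + k"
  define \<rho> where "\<rho> = max 0 (inverse r * (1 / 2 + k) + r * (1 / 2 - k))"
  have r: "r > 1" using k by (simp add: r_def)
  have "inverse r * (1 / 2 + k) + r * (1 / 2 - k) = (1 / 2 + k + r * r * (1 / 2 - k)) / r"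
    using r by (simp add: field_simps)
  also have "\<dots> < 1"
  proof -
    have "r * r * (1 / 2 - k) = 1 / 2 - 3 / 2 * (k * k) - k * k * k"
      by (simp add: r_def algebra_simps)
    hence "1 / 2 + k + r * r * (1 / 2 - k) < r" using k mult_pos_pos[OF k k] mult_pos_pos[OF mult_pos_pos[OF k k] k] unfolding r_def by linarith
    thus ?thesis using r by simp
  qed
  finally have \<rho>: "0 \<le> \<rho>" "\<rho> < 1" by (auto simp: \<rho>_def)
  have "detector d \<theta> W p r ?n 1 \<rho> Q N"
    unfolding detector_def
  proof (intro conjI allI impI ballI)
    fix b ts assume ts: "ts \<in> nlists ?n \<theta>"
    have t: "hd ts \<in> \<theta>" using ts nlistsE_length[OF ts] nlistsE_set[OF ts] by (cases ts) auto
    define k' where "k' = \<eta> * \<kappa> / (2 * ?K) * (\<Sum>a\<in>UNIV. w (hd ts) a a)"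
    have kk: "k \<le> k'" unfolding k_def k'_def w_def using sep[OF t] \<eta> \<kappa> by (intro mult_left_mono) auto
    have S: "succ_val d W p ts (Q b) (\<lambda>_. N [z]) = (if z = b then 1 / 2 + k' else 1 / 2 - k')" for z
      unfolding sv[OF ts] k'_def by (auto simp: bit_sign_def)
    have "(\<Sum>v\<in>nlists 1 UNIV. bit_weight r b v * succ_val d W p ts (Q b) (\<lambda>_. N v)) =
      inverse r * (1 / 2 + k') + r * (1 / 2 - k')"
      by (auto simp: sum_nlists_one UNIV_bool S bit_weight_def)
    \<comment> \<open>The actual bias \<open>k'\<close> may exceed \<open>k\<close>; as
      \<open>r > inverse r\<close>, a larger bias only lowers the weighted sum.\<close>
    also have "\<dots> = inverse r * (1 / 2 + k) + r * (1 / 2 - k) - (r - inverse r) * (k' - k)"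
      by (simp add: algebra_simps)
    also have "\<dots> \<le> inverse r * (1 / 2 + k) + r * (1 / 2 - k)"
      using r kk inverse_less_1_iff[of r] by (simp add: mult_nonneg_nonneg)
    finally show "(\<Sum>v\<in>nlists 1 UNIV. bit_weight r b v * succ_val d W p ts (Q b) (\<lambda>_. N v)) \<le> \<rho>"
      by (simp add: \<rho>_def)
  qed (use Qs povm in auto)
  thus ?thesis using r \<rho> by (intro exI[of _ r] exI[of _ \<rho>]) auto
qed

section \<open>Separating an arbitrarily varying channel from the useless ones\<close>

text \<open>First-order optimality at a minimiser of the quadratic form over the simplex.\<close>

lemma simplex_gram_separation:
  fixes G :: "nat \<Rightarrow> nat \<Rightarrow> real"
  assumes S: "finite S" "S \<noteq> {}" and sym: "\<And>s t. G s t = G t s"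
    and pos: "\<And>q. (\<And>s. s \<in> S \<Longrightarrow> 0 \<le> q s) \<Longrightarrow> (\<Sum>s\<in>S. q s) = 1 \<Longrightarrow> 0 < (\<Sum>s\<in>S. \<Sum>t\<in>S. q s * q t * G s t)"
  shows "\<exists>q c. (\<forall>s\<in>S. 0 \<le> q s) \<and> (\<Sum>s\<in>S. q s) = 1 \<and> c > 0 \<and> (\<forall>t\<in>S. c \<le> (\<Sum>s\<in>S. q s * G s t))"
proof -
  let ?Q = "\<lambda>q. \<Sum>s\<in>S. \<Sum>t\<in>S. q s * q t * G s t"
  \<comment> \<open>Coordinates outside \<open>S\<close> are pinned to 0, which makes the simplex a
    closed part of a compact product of intervals.\<close>
  define D where "D = PiE UNIV (\<lambda>s. if s \<in> S then {0..1} else {0 :: real}) \<inter> {q. (\<Sum>s\<in>S. q s) = 1}"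
  have coord: "continuous_on A (\<lambda>q :: nat \<Rightarrow> real. q s)" for A s
    by (rule continuous_on_product_then_coordinatewise[OF continuous_on_id])
  have "compactin (product_topology (\<lambda>_. euclidean) UNIV) (PiE UNIV (\<lambda>s. if s \<in> S then {0..1} else {0 :: real}))"
    unfolding compactin_PiE by auto
  hence "compact (PiE UNIV (\<lambda>s. if s \<in> S then {0..1} else {0 :: real}))"
    by (simp add: euclidean_product_topology)
  moreover have "closed {q :: nat \<Rightarrow> real. (\<Sum>s\<in>S. q s) = 1}"
    by (intro closed_Collect_eq continuous_on_sum coord continuous_on_const)
  ultimately have comp: "compact D" unfolding D_def by (rule compact_Int_closed)
  have ne: "D \<noteq> {}"
  proof -
    obtain s0 where "s0 \<in> S" using S by blast
    hence "(\<lambda>s. of_bool (s = s0)) \<in> D" using S by (auto simp: D_def PiE_def Pi_def sum_of_bool_eq of_bool_def)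
    thus ?thesis by blast
  qed
  have cont: "continuous_on D ?Q"
    by (intro continuous_on_sum continuous_on_mult coord continuous_on_const)
  obtain q where q: "q \<in> D" and min: "\<And>q'. q' \<in> D \<Longrightarrow> ?Q q \<le> ?Q q'"
    using continuous_attains_inf[OF comp ne cont] by blast
  have q0: "0 \<le> q s" "q s \<le> 1" if "s \<in> S" for s
    using q that by (auto simp: D_def PiE_def Pi_def split: if_splits)
  have q00: "q s = 0" if "s \<notin> S" for s
    using q that by (auto simp: D_def PiE_def Pi_def split: if_splits)
  have q1: "(\<Sum>s\<in>S. q s) = 1" using q by (simp add: D_def)
  have "?Q q \<le> (\<Sum>s\<in>S. q s * G s t)" if t: "t \<in> S" for t
  proof (rule ccontr)
    let ?b = "\<Sum>s\<in>S. q s * G s t"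
    assume "\<not> ?Q q \<le> ?b"
    hence lt: "?b < ?Q q" by simp
    \<comment> \<open>Move from the minimiser by a step \<open>\<epsilon>\<close> towards the vertex
      \<open>t\<close>: the first-order decrease cannot exceed what the second-order term gives
      back.\<close>
    have key: "2 * (?Q q - ?b) \<le> \<epsilon> * (G t t - 2 * ?b + ?Q q)" if e: "0 < \<epsilon>" "\<epsilon> < 1" for \<epsilon>
    proof -
      define q' where "q' s = (1 - \<epsilon>) * q s + \<epsilon> * of_bool (s = t)" for s
      have s1: "(\<Sum>s\<in>S. q' s) = 1"
        using q1 t S by (simp add: q'_def sum.distrib sum_of_bool_eq flip: sum_distrib_left)
      have nn: "0 \<le> q' s" if "s \<in> S" for s using q0[OF that] e by (simp add: q'_def)
      have le1: "q' s \<le> 1" if "s \<in> S" for s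
        using member_le_sum[of s S q'] nn that S s1 by auto
      have "q' \<in> D"
        using s1 nn le1 q00 t by (auto simp: D_def PiE_def Pi_def q'_def)
      hence "?Q q \<le> ?Q q'" by (rule min)
      have inner: "(\<Sum>t'\<in>S. q' t' * H t') = (1 - \<epsilon>) * (\<Sum>t'\<in>S. q t' * H t') + \<epsilon> * H t" for H
      proof -
        have "(\<Sum>t'\<in>S. q' t' * H t') = (1 - \<epsilon>) * (\<Sum>t'\<in>S. q t' * H t') + \<epsilon> * (\<Sum>t'\<in>S. of_bool (t' = t) * H t')"
          unfolding sum_distrib_left sum.distrib[symmetric] q'_def by (intro sum.cong refl) (simp add: algebra_simps)
        also have "(\<Sum>t'\<in>S. of_bool (t' = t) * H t') = H t"
          using t S by (simp add: sum_of_bool_mult_eq)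
        finally show ?thesis .
      qed
      have Q_alt: "?Q v = (\<Sum>s\<in>S. v s * (\<Sum>t\<in>S. v t * G s t))" for v
        by (simp add: sum_distrib_left mult.assoc)
      have "?Q q' = (1 - \<epsilon>) * (\<Sum>s\<in>S. q s * ((1 - \<epsilon>) * (\<Sum>t'\<in>S. q t' * G s t') + \<epsilon> * G s t))
          + \<epsilon> * ((1 - \<epsilon>) * (\<Sum>t'\<in>S. q t' * G t t') + \<epsilon> * G t t)"
        unfolding Q_alt inner by (rule refl)
      also have "(\<Sum>t'\<in>S. q t' * G t t') = ?b" by (simp add: sym[of t])
      also have "(\<Sum>s\<in>S. q s * ((1 - \<epsilon>) * (\<Sum>t'\<in>S. q t' * G s t') + \<epsilon> * G s t)) = (1 - \<epsilon>) * ?Q q + \<epsilon> * ?b"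
        unfolding Q_alt unfolding sum_distrib_left[of _ _ S] sum.distrib[symmetric]
        by (intro sum.cong refl) (simp add: algebra_simps sum_distrib_left)
      finally have "?Q q \<le> (1 - \<epsilon>) * ((1 - \<epsilon>) * ?Q q + \<epsilon> * ?b) + \<epsilon> * ((1 - \<epsilon>) * ?b + \<epsilon> * G t t)"
        using \<open>?Q q \<le> ?Q q'\<close> by simp
      hence "0 \<le> \<epsilon> * (\<epsilon> * (G t t - 2 * ?b + ?Q q) - 2 * (?Q q - ?b))"
        by (simp add: algebra_simps)
      thus ?thesis using e by (simp add: zero_le_mult_iff)
    qed
    define E where "E = \<bar>G t t - 2 * ?b + ?Q q\<bar> + 1"
    \<comment> \<open>Small enough that the second-order term is at most half of the first-order
      gain.\<close>
    define \<epsilon> where "\<epsilon> = min (1 / 2) ((?Q q - ?b) / E)"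
    have E: "E > 0" "G t t - 2 * ?b + ?Q q \<le> E" by (auto simp: E_def)
    have e: "0 < \<epsilon>" "\<epsilon> < 1" using lt E by (auto simp: \<epsilon>_def)
    have "2 * (?Q q - ?b) \<le> \<epsilon> * E" using key[OF e] mult_left_mono[OF E(2), of \<epsilon>] e by linarith
    also have "\<epsilon> * E \<le> (?Q q - ?b) / E * E" using E(1) by (intro mult_right_mono) (auto simp: \<epsilon>_def)
    also have "\<dots> = ?Q q - ?b" using E(1) by simp
    finally show False using lt by simp
  qed
  thus ?thesis using q0 q1 pos[of q] by blast
qed

text \<open>\<open>D s\<close> is the deviation of channel \<open>s\<close> from its mean over the
  inputs, and \<open>G\<close> is the Gram matrix of these deviations. Its form at \<open>q\<close>
  is the squared norm of the mixed deviation, which is zero only for a mixture with constant output.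
  The operators \<open>M\<close> are the deviation of the minimising mixture; as they sum to zero
  over the inputs, pairing them with a channel or with its deviation gives the same number.\<close>

lemma channel_separation:
  fixes W :: "nat \<Rightarrow> 'a::finite \<Rightarrow> complex mat"
  assumes S: "finite S" "S \<noteq> {}" and dens: "\<And>t a. t \<in> S \<Longrightarrow> density_op d (W t a)"
    and nontrivial: "\<And>q. (\<And>s. s \<in> S \<Longrightarrow> 0 \<le> q s) \<Longrightarrow> (\<Sum>s\<in>S. q s) = (1 :: real) \<Longrightarrow>
      \<exists>a a' i j. i < d \<and> j < d \<and> (\<Sum>t\<in>S. complex_of_real (q t) * W t a $$ (i, j)) \<noteq> (\<Sum>t\<in>S. complex_of_real (q t) * W t a' $$ (i, j))"
  shows "\<exists>(M :: 'a \<Rightarrow> complex mat) c. c > 0 \<and> (\<forall>a. M a \<in> carrier_mat d d) \<and>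
    (\<forall>a. \<forall>i<d. \<forall>j<d. M a $$ (i, j) = cnj (M a $$ (j, i))) \<and>
    (\<forall>i<d. \<forall>j<d. (\<Sum>a\<in>UNIV. M a $$ (i, j)) = 0) \<and>
    (\<forall>t\<in>S. c \<le> (\<Sum>a\<in>UNIV. Re (mat_trace (W t a * M a))))"
proof -
  let ?K = "complex_of_real (real CARD('a))"
  define A where "A t i j = (\<Sum>a\<in>UNIV. W t a $$ (i, j)) / ?K" for t i j
  define D where "D t = (\<lambda>(a, i, j). W t a $$ (i, j) - A t i j)" for t
  define Z where "Z = (UNIV :: 'a set) \<times> {..<d} \<times> {..<d}"
  have Z: "finite Z" by (simp add: Z_def)
  define G where "G s t = (\<Sum>z\<in>Z. Re (cnj (D s z) * D t z))" for s t
  have herm: "W t a $$ (i, j) = cnj (W t a $$ (j, i))" if "t \<in> S" "i < d" "j < d" for t a i j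
    using positive_op_hermitian_entry[of d "W t a" i j] dens[OF that(1)] that by (simp add: density_op_def)
  have G_sym: "G s t = G t s" for s t
    unfolding G_def by (intro sum.cong refl) (simp add: mult.commute)
  have "0 < (\<Sum>s\<in>S. \<Sum>t\<in>S. q s * q t * G s t)"
    if q: "\<And>s. s \<in> S \<Longrightarrow> 0 \<le> q s" "(\<Sum>s\<in>S. q s) = 1" for q
  proof -
    define F where "F z = (\<Sum>s\<in>S. complex_of_real (q s) * D s z)" for z
    have "(\<Sum>s\<in>S. \<Sum>t\<in>S. q s * q t * G s t) = (\<Sum>s\<in>S. \<Sum>t\<in>S. \<Sum>z\<in>Z. Re (cnj (complex_of_real (q s) * D s z) * (complex_of_real (q t) * D t z)))"
    proof -
      have "Re (cnj (complex_of_real x * u) * (complex_of_real y * v)) = x * y * Re (cnj u * v)" for x y u v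
        by (simp add: algebra_simps)
      thus ?thesis unfolding G_def sum_distrib_left by simp
    qed
    also have "\<dots> = (\<Sum>s\<in>S. \<Sum>z\<in>Z. \<Sum>t\<in>S. Re (cnj (complex_of_real (q s) * D s z) * (complex_of_real (q t) * D t z)))"
      by (intro sum.cong refl sum.swap)
    also have "\<dots> = (\<Sum>z\<in>Z. \<Sum>s\<in>S. \<Sum>t\<in>S. Re (cnj (complex_of_real (q s) * D s z) * (complex_of_real (q t) * D t z)))"
      by (rule sum.swap)
    also have "\<dots> = (\<Sum>z\<in>Z. Re (cnj (F z) * F z))"
      unfolding F_def cnj_sum sum_product Re_sum by (rule refl)
    also have "\<dots> = (\<Sum>z\<in>Z. (cmod (F z))\<^sup>2)"
      by (intro sum.cong refl) (simp add: cmod_power2 flip: power2_eq_square)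
    finally have eq: "(\<Sum>s\<in>S. \<Sum>t\<in>S. q s * q t * G s t) = (\<Sum>z\<in>Z. (cmod (F z))\<^sup>2)" .
    obtain a a' i j where ij: "i < d" "j < d"
      and ne: "(\<Sum>t\<in>S. complex_of_real (q t) * W t a $$ (i, j)) \<noteq> (\<Sum>t\<in>S. complex_of_real (q t) * W t a' $$ (i, j))"
      using nontrivial[OF q] by blast
    have F: "F (a, i, j) = (\<Sum>t\<in>S. complex_of_real (q t) * W t a $$ (i, j)) - (\<Sum>t\<in>S. complex_of_real (q t) * A t i j)" for a
      unfolding F_def D_def prod.case right_diff_distrib by (rule sum_subtractf)
    have "F (a, i, j) \<noteq> 0 \<or> F (a', i, j) \<noteq> 0" using ne unfolding F by auto
    then obtain a'' where "F (a'', i, j) \<noteq> 0" by blast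
    moreover have "(a'', i, j) \<in> Z" using ij by (simp add: Z_def)
    ultimately have "0 < (\<Sum>z\<in>Z. (cmod (F z))\<^sup>2)"
      using Z by (intro sum_pos2[of Z "(a'', i, j)"]) auto
    thus ?thesis by (simp add: eq)
  qed
  from simplex_gram_separation[OF S G_sym this] obtain q c where q: "\<forall>s\<in>S. 0 \<le> q s" "(\<Sum>s\<in>S. q s) = 1"
    and c: "c > 0" and sep: "\<forall>t\<in>S. c \<le> (\<Sum>s\<in>S. q s * G s t)" by blast
  define M where "M a = Matrix.mat d d (\<lambda>(i, j). \<Sum>s\<in>S. complex_of_real (q s) * D s (a, i, j))" for a
  have Mc: "M a \<in> carrier_mat d d" for a by (simp add: M_def)
  have D_herm: "D s (a, i, j) = cnj (D s (a, j, i))" if "s \<in> S" "i < d" "j < d" for s a i j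
  proof -
    have "(\<Sum>a\<in>UNIV. W s a $$ (i, j)) = cnj (\<Sum>a\<in>UNIV. W s a $$ (j, i))"
      using herm[OF that] unfolding cnj_sum by (intro sum.cong refl)
    thus ?thesis using herm[OF that, of a] by (simp add: D_def A_def)
  qed
  have M_herm: "M a $$ (i, j) = cnj (M a $$ (j, i))" if "i < d" "j < d" for a i j
  proof -
    have "(\<Sum>s\<in>S. complex_of_real (q s) * D s (a, i, j)) = (\<Sum>s\<in>S. complex_of_real (q s) * cnj (D s (a, j, i)))"
      using that by (intro sum.cong refl arg_cong2[of _ _ _ _ "(*)"] D_herm)
    thus ?thesis using that by (simp add: M_def)
  qed
  have D_sum: "(\<Sum>a\<in>UNIV. D s (a, i, j)) = 0" for s i j
    by (simp add: D_def A_def sum_subtractf)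
  have M_sum: "(\<Sum>a\<in>UNIV. M a $$ (i, j)) = 0" if "i < d" "j < d" for i j
  proof -
    have "(\<Sum>a\<in>UNIV. M a $$ (i, j)) = (\<Sum>s\<in>S. complex_of_real (q s) * (\<Sum>a\<in>UNIV. D s (a, i, j)))"
      using that by (simp add: M_def sum_distrib_left sum.swap[of _ UNIV])
    thus ?thesis by (simp add: D_sum)
  qed
  have M_sep: "c \<le> (\<Sum>a\<in>UNIV. Re (mat_trace (W t a * M a)))" if t: "t \<in> S" for t
  proof -
    have Wc: "W t a \<in> carrier_mat d d" for a using dens[OF t] by (auto simp: density_op_def dest: positive_op_carrier)
    \<comment> \<open>Hermiticity writes the entry at \<open>(i, j)\<close> as a conjugate at
      \<open>(j, i)\<close>, so the trace becomes an inner product, split here into deviation and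
      mean. The mean part drops out by \<open>M_sum\<close>.\<close>
    have "(\<Sum>a\<in>UNIV. mat_trace (W t a * M a)) = (\<Sum>a\<in>UNIV. \<Sum>i<d. \<Sum>j<d. cnj (D t (a, j, i)) * M a $$ (j, i) + cnj (A t j i) * M a $$ (j, i))"
    proof (intro sum.cong refl)
      fix a
      show "mat_trace (W t a * M a) = (\<Sum>i<d. \<Sum>j<d. cnj (D t (a, j, i)) * M a $$ (j, i) + cnj (A t j i) * M a $$ (j, i))"
        unfolding mat_trace_mult[OF Wc Mc]
      proof (intro sum.cong refl)
        fix i j assume "i \<in> {..<d}" "j \<in> {..<d}"
        hence "W t a $$ (i, j) = cnj (D t (a, j, i)) + cnj (A t j i)"
          using herm[OF t, of i j a] by (simp add: D_def)
        thus "W t a $$ (i, j) * M a $$ (j, i) = cnj (D t (a, j, i)) * M a $$ (j, i) + cnj (A t j i) * M a $$ (j, i)"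
          by (simp add: distrib_right)
      qed
    qed
    also have "\<dots> = (\<Sum>a\<in>UNIV. \<Sum>i<d. \<Sum>j<d. cnj (D t (a, j, i)) * M a $$ (j, i)) + (\<Sum>a\<in>UNIV. \<Sum>i<d. \<Sum>j<d. cnj (A t j i) * M a $$ (j, i))"
      by (simp only: sum.distrib)
    also have "(\<Sum>a\<in>UNIV. \<Sum>i<d. \<Sum>j<d. cnj (A t j i) * M a $$ (j, i)) = (\<Sum>i<d. \<Sum>j<d. cnj (A t j i) * (\<Sum>a\<in>UNIV. M a $$ (j, i)))"
    proof -
      have "(\<Sum>a\<in>UNIV. \<Sum>i<d. \<Sum>j<d. cnj (A t j i) * M a $$ (j, i)) = (\<Sum>i<d. \<Sum>a\<in>UNIV. \<Sum>j<d. cnj (A t j i) * M a $$ (j, i))"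
        by (rule sum.swap)
      also have "\<dots> = (\<Sum>i<d. \<Sum>j<d. \<Sum>a\<in>UNIV. cnj (A t j i) * M a $$ (j, i))"
        by (intro sum.cong refl sum.swap)
      finally show ?thesis by (simp only: sum_distrib_left)
    qed
    also have "\<dots> = 0" by (intro sum.neutral ballI) (simp add: M_sum)
    also have "(\<Sum>a\<in>UNIV. \<Sum>i<d. \<Sum>j<d. cnj (D t (a, j, i)) * M a $$ (j, i)) = (\<Sum>a\<in>UNIV. \<Sum>j<d. \<Sum>i<d. cnj (D t (a, j, i)) * M a $$ (j, i))"
      by (intro sum.cong refl sum.swap)
    also have "\<dots> = (\<Sum>a\<in>UNIV. \<Sum>j<d. \<Sum>i<d. \<Sum>s\<in>S. complex_of_real (q s) * (cnj (D t (a, j, i)) * D s (a, j, i)))"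
      by (intro sum.cong refl) (simp add: M_def sum_distrib_left mult_ac)
    also have "\<dots> = (\<Sum>z\<in>Z. \<Sum>s\<in>S. complex_of_real (q s) * (cnj (D t z) * D s z))"
      unfolding Z_def sum.cartesian_product' by (rule refl)
    also have "\<dots> = (\<Sum>s\<in>S. complex_of_real (q s) * (\<Sum>z\<in>Z. cnj (D t z) * D s z))"
      unfolding sum_distrib_left by (rule sum.swap)
    finally have "(\<Sum>a\<in>UNIV. mat_trace (W t a * M a)) = (\<Sum>s\<in>S. complex_of_real (q s) * (\<Sum>z\<in>Z. cnj (D t z) * D s z))"
      by simp
    hence "Re (\<Sum>a\<in>UNIV. mat_trace (W t a * M a)) = Re (\<Sum>s\<in>S. complex_of_real (q s) * (\<Sum>z\<in>Z. cnj (D t z) * D s z))"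
      by (rule arg_cong)
    also have "\<dots> = (\<Sum>s\<in>S. q s * G t s)"
      by (simp add: G_def)
    finally have "(\<Sum>a\<in>UNIV. Re (mat_trace (W t a * M a))) = (\<Sum>s\<in>S. q s * G s t)"
      using G_sym[of t] by simp
    thus ?thesis using sep t by simp
  qed
  show ?thesis using c Mc M_herm M_sum M_sep by (intro exI[of _ M] exI[of _ c]) blast
qed

section \<open>From positive mutual information to key protocols\<close>

lemma mutual_info_pos_dependent:
  fixes p :: "('x::finite \<times> 'y::finite) pmf"
  assumes "mutual_info p > 0"
  shows "\<exists>x y. pmf p (x, y) \<noteq> pmf (map_pmf fst p) x * pmf (map_pmf snd p) y"
proof (rule ccontr)
  assume "\<nexists>x y. pmf p (x, y) \<noteq> pmf (map_pmf fst p) x * pmf (map_pmf snd p) y"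
  hence eq: "pmf (map_pmf fst p) x * pmf (map_pmf snd p) y = pmf p (x, y)" for x y by simp
  \<comment> \<open>For a product law each quotient is 1, or 0/0 with weight 0; either way the term
    vanishes.\<close>
  have "mutual_info p = 0"
    unfolding mutual_info_eq_sum eq by (intro sum.neutral ballI) (simp add: divide_self_if)
  thus False using assms by simp
qed

lemma pmf_map_fst_pair_exp:
  fixes p :: "('x::finite \<times> 'y::finite) pmf"
  shows "pmf (map_pmf fst p) x0 = pair_exp p (\<lambda>x y. of_bool (x = x0))"
    and "pmf (map_pmf snd p) y0 = pair_exp p (\<lambda>x y. of_bool (y = y0))"
proof -
  have ex: "measure_pmf.expectation p (\<lambda>z. F (fst z) (snd z)) = pair_exp p F" for F :: "'x \<Rightarrow> 'y \<Rightarrow> real"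
    unfolding pair_exp_def
    by (subst integral_measure_pmf[of UNIV]) (auto simp: sum.cartesian_product case_prod_unfold)
  have "pmf (map_pmf fst p) x0 = measure_pmf.expectation p (indicator (fst -` {x0}))"
    by (simp add: pmf_map)
  also have "(indicator (fst -` {x0}) :: 'x \<times> 'y \<Rightarrow> real) = (\<lambda>z. of_bool (fst z = x0))"
    by (auto simp: indicator_def fun_eq_iff)
  finally show "pmf (map_pmf fst p) x0 = pair_exp p (\<lambda>x y. of_bool (x = x0))"
    using ex[of "\<lambda>x y. of_bool (x = x0)"] by simp
  have "pmf (map_pmf snd p) y0 = measure_pmf.expectation p (indicator (snd -` {y0}))"
    by (simp add: pmf_map)
  also have "(indicator (snd -` {y0}) :: 'x \<times> 'y \<Rightarrow> real) = (\<lambda>z. of_bool (snd z = y0))"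
    by (auto simp: indicator_def fun_eq_iff)
  finally show "pmf (map_pmf snd p) y0 = pair_exp p (\<lambda>x y. of_bool (y = y0))"
    using ex[of "\<lambda>x y. of_bool (y = y0)"] by simp
qed

text \<open>At \<open>(x0, y0)\<close> the joint probability differs from the product of the
  marginals. \<open>f\<close> and \<open>g\<close> are the centred indicators of these letters, and
  the sign in \<open>g\<close> turns their covariance \<open>C\<close> into its modulus. The
  indicator of \<open>x0\<close> cannot be almost surely constant, as otherwise \<open>C\<close>
  would be 0; so \<open>P\<close> lies strictly between 0 and 1, and the same indicator can generate
  key bits.\<close>

lemma correlated_functions:
  fixes p :: "('x::finite \<times> 'y::finite) pmf"
  assumes "mutual_info p > 0"
  obtains x0 :: 'x and P \<kappa> :: real and f :: "'x \<Rightarrow> real" and g :: "'y \<Rightarrow> real"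
  where "P = corr_exp p (Suc 0) (\<lambda>xs ys. of_bool (hd xs = x0))" "0 < P" "P < 1"
    "\<And>x. \<bar>f x\<bar> \<le> 1" "\<And>y. \<bar>g y\<bar> \<le> 1"
    "pair_exp p (\<lambda>x y. f x) = 0" "pair_exp p (\<lambda>x y. g y) = 0"
    "pair_exp p (\<lambda>x y. f x * g y) = \<kappa>" "\<kappa> > 0"
proof -
  obtain x0 y0 where ne: "pmf p (x0, y0) \<noteq> pmf (map_pmf fst p) x0 * pmf (map_pmf snd p) y0"
    using mutual_info_pos_dependent[OF assms] by blast
  define P where "P = pair_exp p (\<lambda>x y. of_bool (x = x0))"
  define R where "R = pair_exp p (\<lambda>x y. of_bool (y = y0))"
  have lin: "pair_exp p (\<lambda>x y. F x y + G x y) = pair_exp p F + pair_exp p G"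
    "pair_exp p (\<lambda>x y. F x y - G x y) = pair_exp p F - pair_exp p G"
    "pair_exp p (\<lambda>x y. c * F x y) = c * pair_exp p F" for F G c
    by (simp_all add: pair_exp_corr_exp corr_exp_add corr_exp_diff corr_exp_cmult)
  have mono: "pair_exp p F \<le> pair_exp p G" if "\<And>x y. F x y \<le> G x y" for F G
    unfolding pair_exp_corr_exp using that by (intro corr_exp_mono)
  have joint: "pair_exp p (\<lambda>x y. of_bool (x = x0) * of_bool (y = y0)) = pmf p (x0, y0)"
    unfolding pair_exp_def by (simp add: sum_of_bool_mult_eq mult.left_commute[of "pmf p _"] flip: sum_distrib_left)
  have P01: "0 \<le> P" "P \<le> 1" and R01: "0 \<le> R" "R \<le> 1"
    using mono[of "\<lambda>_ _. 0" "\<lambda>x y. of_bool (x = x0)"] mono[of "\<lambda>x y. of_bool (x = x0)" "\<lambda>_ _. 1"]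
      mono[of "\<lambda>_ _. 0" "\<lambda>x y. of_bool (y = y0)"] mono[of "\<lambda>x y. of_bool (y = y0)" "\<lambda>_ _. 1"]
    by (auto simp: P_def R_def)
  have ne': "pmf p (x0, y0) \<noteq> P * R" using ne by (simp add: pmf_map_fst_pair_exp P_def R_def)
  have "pmf p (x0, y0) \<le> P"
    unfolding joint[symmetric] P_def by (intro mono) auto
  hence P0: "P \<noteq> 0" using ne' by auto
  \<comment> \<open>The difference is the probability of \<open>y0\<close> without
    \<open>x0\<close>; if \<open>P = 1\<close> it vanishes, and the joint probability equals
    \<open>P * R\<close>.\<close>
  have "R - pmf p (x0, y0) \<le> 1 - P" "0 \<le> R - pmf p (x0, y0)"
  proof -
    have "R - pmf p (x0, y0) = pair_exp p (\<lambda>x y. of_bool (y = y0) - of_bool (x = x0) * of_bool (y = y0))"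
      by (simp add: lin joint R_def)
    moreover have "\<dots> \<le> pair_exp p (\<lambda>x y. 1 - of_bool (x = x0))" by (intro mono) auto
    moreover have "pair_exp p (\<lambda>x y. 1 - of_bool (x = x0)) = 1 - P" by (simp add: lin P_def)
    moreover have "pair_exp p (\<lambda>_ _. 0) \<le> pair_exp p (\<lambda>x y. of_bool (y = y0) - of_bool (x = x0) * of_bool (y = y0))"
      by (intro mono) auto
    ultimately show "R - pmf p (x0, y0) \<le> 1 - P" "0 \<le> R - pmf p (x0, y0)" by simp_all
  qed
  hence P1: "P \<noteq> 1" using ne' by auto
  define f :: "'x \<Rightarrow> real" where "f x = of_bool (x = x0) - P" for x
  define C where "C = pmf p (x0, y0) - P * R"
  define g :: "'y \<Rightarrow> real" where "g y = sgn C * (of_bool (y = y0) - R)" for y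
  have f: "\<bar>f x\<bar> \<le> 1" for x using P01 by (simp add: f_def)
  have g: "\<bar>g y\<bar> \<le> 1" for y using R01 by (simp add: g_def abs_mult abs_sgn_eq)
  have Ef: "pair_exp p (\<lambda>x y. f x) = 0" by (simp add: f_def lin P_def)
  have Eg: "pair_exp p (\<lambda>x y. g y) = 0" by (simp add: g_def lin R_def)
  have "pair_exp p (\<lambda>x y. f x * g y) = pair_exp p (\<lambda>x y. sgn C * (of_bool (x = x0) * of_bool (y = y0) - R * of_bool (x = x0) - P * of_bool (y = y0) + P * R))"
    unfolding f_def g_def by (intro arg_cong[where f = "pair_exp p"] ext) (simp add: algebra_simps)
  also have "\<dots> = sgn C * C"
    unfolding lin joint P_def[symmetric] R_def[symmetric] by (simp add: C_def)
  also have "\<dots> = \<bar>C\<bar>" by (simp add: sgn_mult_self_eq abs_sgn mult.commute)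
  finally have "pair_exp p (\<lambda>x y. f x * g y) = \<bar>C\<bar>" .
  moreover have "\<bar>C\<bar> > 0" using ne' by (simp add: C_def)
  moreover have "P = corr_exp p (Suc 0) (\<lambda>xs ys. of_bool (hd xs = x0))" by (simp add: P_def pair_exp_corr_exp)
  ultimately show ?thesis using that[of P x0 f g "\<bar>C\<bar>"] f g Ef Eg P0 P1 P01 by auto
qed

text \<open>The constants \<open>\<rho>\<close> and \<open>q\<close> are fixed before
  \<open>k\<close> and \<open>l\<close>: the bases of error and collision depend on channels and
  source only, while key length and repetition number stay free. The length counts
  \<open>Suc k\<close> bits, each with one generating letter and \<open>Suc l\<close> detector
  blocks.\<close>

lemma key_protocols_exist:
  fixes p :: "('x::finite \<times> 'y::finite) pmf" and W :: "nat \<Rightarrow> 'a::finite pmf \<Rightarrow> complex mat"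
  assumes S: "finite \<theta>" "\<theta> \<noteq> {}" and dens: "\<And>t a. t \<in> \<theta> \<Longrightarrow> density_op d (W t (return_pmf a))"
    and nontrivial: "\<And>q. (\<And>s. s \<in> \<theta> \<Longrightarrow> 0 \<le> q s) \<Longrightarrow> (\<Sum>s\<in>\<theta>. q s) = (1 :: real) \<Longrightarrow>
      \<exists>a a' i j. i < d \<and> j < d \<and> (\<Sum>t\<in>\<theta>. complex_of_real (q t) * W t (return_pmf a) $$ (i, j)) \<noteq> (\<Sum>t\<in>\<theta>. complex_of_real (q t) * W t (return_pmf a') $$ (i, j))"
    and I: "mutual_info p > 0"
  shows "\<exists>\<rho> q. 0 \<le> \<rho> \<and> \<rho> < 1 \<and> 0 < q \<and> q < 1 \<and> (\<forall>k l. \<exists>u Q N. key_protocol d \<theta> W p (Suc k * Suc (Suc l * CARD('a))) (Suc k)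
     ((1 - \<rho> ^ Suc l) ^ Suc k) (q ^ Suc k) u Q N)"
proof -
  obtain M :: "'a \<Rightarrow> complex mat" and c where c: "c > 0" and M: "\<forall>a. M a \<in> carrier_mat d d"
    "\<forall>a. \<forall>i<d. \<forall>j<d. M a $$ (i, j) = cnj (M a $$ (j, i))" "\<forall>i<d. \<forall>j<d. (\<Sum>a\<in>UNIV. M a $$ (i, j)) = 0"
    "\<forall>t\<in>\<theta>. c \<le> (\<Sum>a\<in>UNIV. Re (mat_trace (W t (return_pmf a) * M a)))"
    using channel_separation[OF S, of d "\<lambda>t a. W t (return_pmf a)"] dens nontrivial by blast
  have d: "d > 0" using density_op_dim_pos dens S by blast
  obtain x0 P \<kappa> f g where P: "P = corr_exp p (Suc 0) (\<lambda>xs ys. of_bool (hd xs = x0))" "0 < P" "P < 1"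
    and fg: "\<And>x. \<bar>f x\<bar> \<le> 1" "\<And>y. \<bar>g y\<bar> \<le> 1"
    and E: "pair_exp p (\<lambda>x y. f x) = 0" "pair_exp p (\<lambda>x y. g y) = 0"
    "pair_exp p (\<lambda>x y. f x * g y) = \<kappa>" and \<kappa>: "\<kappa> > 0"
    using correlated_functions[OF I] by metis
  obtain r \<rho> Q N where r: "r > 0" and \<rho>: "0 \<le> \<rho>" "\<rho> < 1" and det: "detector d \<theta> W p r CARD('a) 1 \<rho> Q N"
    using detector_base[of \<theta> d W M c f g p \<kappa>, OF dens d _ _ _ _ c fg E \<kappa>] M by blast
  define q where "q = P\<^sup>2 + (1 - P)\<^sup>2"
  have q: "0 < q" "q < 1"
  proof -
    show "0 < q" using P by (simp add: q_def add_pos_pos)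
    have "q = 1 - 2 * (P * (1 - P))" by (simp add: q_def power2_eq_square algebra_simps)
    moreover have "P * (1 - P) > 0" using P by simp
    ultimately show "q < 1" by linarith
  qed
  have "\<exists>u Q N. key_protocol d \<theta> W p (Suc k * Suc (Suc l * CARD('a))) (Suc k) ((1 - \<rho> ^ Suc l) ^ Suc k) (q ^ Suc k) u Q N" for k l
  proof -
    obtain Q' N' where "detector d \<theta> W p r (Suc l * CARD('a)) (Suc l) (\<rho> ^ Suc l) Q' N'"
      using detector_power[of \<theta> d W, OF dens det r \<rho>(1)] by blast
    from key_bit_protocol[of \<theta> d W, OF dens this r, of x0]
    obtain u Q N where "key_protocol d \<theta> W p (Suc (Suc l * CARD('a))) 1 (1 - \<rho> ^ Suc l) q u Q N"
      unfolding q_def P(1) by blast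
    moreover have "0 \<le> 1 - \<rho> ^ Suc l" using \<rho> power_le_one[of \<rho> "Suc l"] by simp
    ultimately show ?thesis using key_protocol_power[of \<theta> d W, OF dens] by blast
  qed
  thus ?thesis using \<rho> q by blast
qed

section \<open>Derandomization\<close>

lemma (in prob_space) exists_le_expectation:
  assumes "integrable M h" "expectation h \<le> c"
  shows "\<exists>x\<in>space M. h x \<le> (c :: real)"
proof (rule ccontr)
  assume "\<not> ?thesis"
  hence gt: "\<And>x. x \<in> space M \<Longrightarrow> c < h x" by force
  have "AE x in M. c \<noteq> h x" using gt by (intro AE_I2) force
  hence "expectation (\<lambda>_. c) < expectation h"
    using assms gt emeasure_space_1 by (intro integral_less_AE_space) (auto intro!: AE_I2 less_imp_le)
  thus False using assms(2) by (simp add: prob_space)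
qed

text \<open>
  The method of conditional expectations: the codes are fixed one after the other, never
  increasing the conditional expectation of the sum of the exponential moments.
\<close>

lemma (in prob_space) sequential_choice:
  fixes F :: "'i \<Rightarrow> 'v \<Rightarrow> 'a \<Rightarrow> real"
  assumes "finite V" "finite I"
    and "\<And>i v. i \<in> I \<Longrightarrow> v \<in> V \<Longrightarrow> integrable M (\<lambda>c. exp (F i v c))"
    and "\<And>i v. i \<in> I \<Longrightarrow> v \<in> V \<Longrightarrow> expectation (\<lambda>c. exp (F i v c)) \<le> m v"
    and "\<And>i. i \<in> I \<Longrightarrow> 0 \<le> w i"
  shows "\<exists>c. (\<forall>v\<in>V. c v \<in> space M) \<and>
    (\<Sum>i\<in>I. w i * exp (\<Sum>v\<in>V. F i v (c v))) \<le> (\<Sum>i\<in>I. w i) * (\<Prod>v\<in>V. m v)"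
  using assms
proof (induction V arbitrary: w rule: finite_induct)
  case (insert v V)
  let ?h = "\<lambda>c. \<Sum>i\<in>I. w i * exp (F i v c)"
  have "integrable M ?h" using insert.prems by (intro Bochner_Integration.integrable_sum integrable_mult_right) auto
  moreover have "expectation ?h \<le> (\<Sum>i\<in>I. w i) * m v"
  proof -
    have "expectation ?h = (\<Sum>i\<in>I. w i * expectation (\<lambda>c. exp (F i v c)))"
      using insert.prems by (subst Bochner_Integration.integral_sum) auto
    also have "\<dots> \<le> (\<Sum>i\<in>I. w i * m v)"
      using insert.prems by (intro sum_mono mult_left_mono) auto
    finally show ?thesis by (simp add: sum_distrib_right)
  qed
  ultimately obtain c0 where c0: "c0 \<in> space M" "?h c0 \<le> (\<Sum>i\<in>I. w i) * m v"
    using exists_le_expectation by blast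
  have "\<exists>c. (\<forall>v\<in>V. c v \<in> space M) \<and>
    (\<Sum>i\<in>I. (w i * exp (F i v c0)) * exp (\<Sum>v\<in>V. F i v (c v))) \<le> (\<Sum>i\<in>I. w i * exp (F i v c0)) * (\<Prod>v\<in>V. m v)"
    by (rule insert.IH) (use insert.prems in auto)
  then obtain c where c: "\<And>v. v \<in> V \<Longrightarrow> c v \<in> space M"
    "(\<Sum>i\<in>I. (w i * exp (F i v c0)) * exp (\<Sum>v\<in>V. F i v (c v))) \<le> ?h c0 * (\<Prod>v\<in>V. m v)" by blast
  define c' where "c' = c(v := c0)"
  have upd: "(\<Sum>v'\<in>V. F i v' (c' v')) = (\<Sum>v\<in>V. F i v (c v))" "c' v = c0" for i
    unfolding c'_def using insert.hyps by (auto intro!: sum.cong)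
  \<comment> \<open>Nonnegativity of \<open>m\<close> follows because it bounds an expectation of
    exponentials, provided that some \<open>i\<close> is available; for empty \<open>I\<close> both
    sides of the claim are 0.\<close>
  have "0 \<le> m v'" if "v' \<in> V" "i \<in> I" for v' i
    using insert.prems(3)[of i v'] that
      Bochner_Integration.integral_nonneg[of M "\<lambda>c. exp (F i v' c)"] by (simp add: order_trans[rotated])
  hence nn: "0 \<le> (\<Prod>v\<in>V. m v) \<or> I = {}" by (auto intro: prod_nonneg)
  have "(\<Sum>i\<in>I. w i * exp (\<Sum>v'\<in>insert v V. F i v' (c' v'))) = (\<Sum>i\<in>I. (w i * exp (F i v c0)) * exp (\<Sum>v\<in>V. F i v (c v)))"
    using insert.hyps by (intro sum.cong refl) (simp add: upd exp_add mult.assoc)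
  also have "\<dots> \<le> ?h c0 * (\<Prod>v\<in>V. m v)" by (rule c(2))
  also have "\<dots> \<le> (\<Sum>i\<in>I. w i) * m v * (\<Prod>v\<in>V. m v)"
    using nn c0(2) by (auto intro: mult_right_mono)
  also have "\<dots> = (\<Sum>i\<in>I. w i) * (\<Prod>v\<in>insert v V. m v)"
    using insert.hyps by simp
  finally show ?case using c0(1) c(1) by (intro exI[of _ c']) (auto simp: c'_def)
qed simp

text \<open>Hoeffding's lemma on the interval from \<open>-B\<close> to \<open>B\<close>, where
  (2B)^2 / 8 = B^2 / 2. The lemma concerns \<open>l > 0\<close>, so \<open>l = 0\<close> is a
  separate case.\<close>

lemma (in prob_space) exp_moment_bounded:
  fixes X :: "'a \<Rightarrow> real"
  assumes X: "X \<in> borel_measurable M" "\<And>c. c \<in> space M \<Longrightarrow> \<bar>X c\<bar> \<le> B" and l: "0 \<le> l"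
  shows "integrable M (\<lambda>c. exp (l * (X c - expectation X)))"
    and "expectation (\<lambda>c. exp (l * (X c - expectation X))) \<le> exp (l\<^sup>2 * B\<^sup>2 / 2)"
proof -
  interpret interval_bounded_random_variable M X "- B" B
    by standard (use X in \<open>force intro!: AE_I2\<close>)+
  note [measurable] = X(1)
  show int: "integrable M (\<lambda>c. exp (l * (X c - expectation X)))"
  proof (rule integrable_const_bound)
    show "AE c in M. norm (exp (l * (X c - expectation X))) \<le> exp (l * (B - expectation X))"
      using X(2) l by (intro AE_I2) (auto intro!: mult_left_mono simp: abs_le_iff)
  qed measurable
  show "expectation (\<lambda>c. exp (l * (X c - expectation X))) \<le> exp (l\<^sup>2 * B\<^sup>2 / 2)"
  proof (cases "l = 0")
    case False
    have "ennreal (expectation (\<lambda>c. exp (l * (X c - expectation X)))) = (\<integral>\<^sup>+ c. ennreal (exp (l * (X c - expectation X))) \<partial>M)"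
      using int by (intro nn_integral_eq_integral[symmetric]) auto
    also have "\<dots> \<le> ennreal (exp (l\<^sup>2 * (B - - B)\<^sup>2 / 8))"
      using Hoeffdings_lemma_nn_integral[of l] False l by (simp add: algebra_simps)
    finally have "expectation (\<lambda>c. exp (l * (X c - expectation X))) \<le> exp (l\<^sup>2 * (B - - B)\<^sup>2 / 8)"
      by (simp add: ennreal_le_iff)
    thus ?thesis by (simp add: power2_eq_square algebra_simps)
  qed (simp add: prob_space)
qed

text \<open>A Chernoff bound for a weighted average, with a union bound over \<open>I\<close>. The
  exponent contains the sum of the squared weights: this is where a small collision probability
  takes the place of a large number of equally likely keys.\<close>

lemma (in prob_space) derandomize:
  fixes X :: "'i \<Rightarrow> 'a \<Rightarrow> real" and \<omega> :: "'v \<Rightarrow> real"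
  assumes fin: "finite V" "finite I" "I \<noteq> {}"
    and X: "\<And>i. i \<in> I \<Longrightarrow> X i \<in> borel_measurable M" "\<And>i c. i \<in> I \<Longrightarrow> c \<in> space M \<Longrightarrow> \<bar>X i c\<bar> \<le> B"
    and \<omega>: "\<And>v. v \<in> V \<Longrightarrow> 0 \<le> \<omega> v" "(\<Sum>v\<in>V. \<omega> v) = 1" "(\<Sum>v\<in>V. (\<omega> v)\<^sup>2) \<le> q"
    and \<eta>: "\<eta> > 0" "2 * (ln (real (card I)) + 1) * B\<^sup>2 * q \<le> \<eta>\<^sup>2"
  shows "\<exists>c. (\<forall>v\<in>V. c v \<in> space M) \<and> (\<forall>i\<in>I. (\<Sum>v\<in>V. \<omega> v * X i (c v)) \<le> expectation (X i) + \<eta>)"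
proof -
  \<comment> \<open>The added 1 keeps \<open>L\<close> positive when \<open>I\<close> is a
    singleton.\<close>
  define L where "L = ln (real (card I)) + 1"
  have cI: "real (card I) \<ge> 1" using fin by (simp add: Suc_leI card_gt_0_iff)
  have L: "L \<ge> 1" using cI by (simp add: L_def)
  \<comment> \<open>Balances the exponent: the union bound costs at most \<open>L\<close>, by the
    hypothesis on \<open>\<eta>\<close> so does the variance term, and
    \<open>2 * L = l * \<eta>\<close>.\<close>
  define l where "l = 2 * L / \<eta>"
  have l: "l > 0" using L \<eta> by (simp add: l_def)
  let ?F = "\<lambda>i v c. (l * \<omega> v) * (X i c - expectation (X i))"
  have "\<exists>c. (\<forall>v\<in>V. c v \<in> space M) \<and>
    (\<Sum>i\<in>I. 1 * exp (\<Sum>v\<in>V. ?F i v (c v))) \<le> (\<Sum>i\<in>I. 1) * (\<Prod>v\<in>V. exp ((l * \<omega> v)\<^sup>2 * B\<^sup>2 / 2))"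
    using exp_moment_bounded[OF X] l \<omega>(1) fin by (intro sequential_choice) auto
  then obtain c where c: "\<And>v. v \<in> V \<Longrightarrow> c v \<in> space M"
    "(\<Sum>i\<in>I. exp (\<Sum>v\<in>V. ?F i v (c v))) \<le> real (card I) * (\<Prod>v\<in>V. exp ((l * \<omega> v)\<^sup>2 * B\<^sup>2 / 2))" by auto
  have "(\<Sum>v\<in>V. \<omega> v * X i (c v)) \<le> expectation (X i) + \<eta>" if i: "i \<in> I" for i
  proof -
    let ?D = "(\<Sum>v\<in>V. \<omega> v * X i (c v)) - expectation (X i)"
    have "(\<Sum>v\<in>V. ?F i v (c v)) = l * ((\<Sum>v\<in>V. \<omega> v * X i (c v)) - (\<Sum>v\<in>V. \<omega> v) * expectation (X i))"
      unfolding sum_distrib_right sum_subtractf[symmetric] sum_distrib_left by (intro sum.cong refl) (simp add: algebra_simps)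
    hence "exp (l * ?D) = exp (\<Sum>v\<in>V. ?F i v (c v))" by (simp add: \<omega>)
    also have "\<dots> \<le> (\<Sum>i\<in>I. exp (\<Sum>v\<in>V. ?F i v (c v)))"
      using i fin by (intro member_le_sum) auto
    also have "\<dots> \<le> real (card I) * (\<Prod>v\<in>V. exp ((l * \<omega> v)\<^sup>2 * B\<^sup>2 / 2))" by (rule c(2))
    also have "\<dots> = exp (ln (real (card I)) + (\<Sum>v\<in>V. (l * \<omega> v)\<^sup>2 * B\<^sup>2 / 2))"
      using cI fin by (simp add: exp_add exp_sum)
    finally have "l * ?D \<le> ln (real (card I)) + (\<Sum>v\<in>V. (l * \<omega> v)\<^sup>2 * B\<^sup>2 / 2)" by simp
    also have "(\<Sum>v\<in>V. (l * \<omega> v)\<^sup>2 * B\<^sup>2 / 2) = l\<^sup>2 * B\<^sup>2 / 2 * (\<Sum>v\<in>V. (\<omega> v)\<^sup>2)"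
      unfolding sum_distrib_left by (intro sum.cong refl) (simp add: power_mult_distrib)
    also have "\<dots> \<le> l\<^sup>2 * B\<^sup>2 / 2 * q" using \<omega>(3) by (intro mult_left_mono) auto
    also have "ln (real (card I)) \<le> L" by (simp add: L_def)
    also have "l\<^sup>2 * B\<^sup>2 / 2 * q = l\<^sup>2 / (4 * L) * (2 * L * B\<^sup>2 * q)" using L by simp
    also have "\<dots> \<le> l\<^sup>2 / (4 * L) * \<eta>\<^sup>2" using \<eta>(2) L by (intro mult_left_mono) (auto simp: L_def)
    also have "\<dots> = L" using L \<eta>(1) by (simp add: l_def power2_eq_square)
    finally have "l * ?D \<le> 2 * L" by simp
    also have "2 * L = l * \<eta>" using \<eta>(1) by (simp add: l_def)
    finally show ?thesis using l by simp
  qed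
  thus ?thesis using c(1) by blast
qed

section \<open>Codes\<close>

lemma encodersD:
  assumes "E \<in> encoders n J" "j \<in> {1..J}"
  shows "set_pmf (E j) \<subseteq> nlists n UNIV"
  using assms by (auto simp: encoders_def PiE_def Pi_def)

lemma decodersD:
  assumes "D \<in> decoders d n J"
  shows "j \<in> {1..J} \<Longrightarrow> positive_op (d ^ n) (D j)" "mat_lincomb (d ^ n) {1..J} (\<lambda>_. 1) D = 1\<^sub>m (d ^ n)"
  using assms by (auto simp: decoders_def PiE_def Pi_def)

lemma trace_povm_bounds:
  assumes \<rho>: "density_op d \<rho>" and fin: "finite I" and D: "\<And>j. j \<in> I \<Longrightarrow> positive_op d (D j)"
    "mat_lincomb d I (\<lambda>_. 1) D = 1\<^sub>m d" and j: "j \<in> I"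
  shows "0 \<le> Re (mat_trace (\<rho> * D j))" "Re (mat_trace (\<rho> * D j)) \<le> 1"
proof -
  have \<rho>p: "positive_op d \<rho>" "\<rho> \<in> carrier_mat d d" using \<rho> by (auto simp: density_op_def dest: positive_op_carrier)
  have nn: "0 \<le> Re (mat_trace (\<rho> * D i))" if "i \<in> I" for i
    using mat_trace_mult_positive[OF \<rho>p(1) D(1)[OF that]] by (simp add: less_eq_complex_def)
  have "(\<Sum>i\<in>I. mat_trace (\<rho> * D i)) = mat_trace (\<rho> * 1\<^sub>m d)"
    using mat_trace_mult_lincomb[of I D d \<rho> "\<lambda>_. 1"] D(1)[THEN positive_op_carrier] D(2) \<rho>p by simp
  also have "\<dots> = 1" using \<rho> \<rho>p by (simp add: density_op_def right_mult_one_mat[of _ d d])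
  finally have "(\<Sum>i\<in>I. Re (mat_trace (\<rho> * D i))) = 1" by (metis Re_sum one_complex.simps(1))
  moreover have "Re (mat_trace (\<rho> * D j)) \<le> (\<Sum>i\<in>I. Re (mat_trace (\<rho> * D i)))"
    using nn j fin by (intro member_le_sum) auto
  ultimately show "Re (mat_trace (\<rho> * D j)) \<le> 1" by simp
  show "0 \<le> Re (mat_trace (\<rho> * D j))" using nn j .
qed

lemma code_error_bounds:
  assumes d: "\<And>t a. t \<in> \<theta> \<Longrightarrow> density_op d (W t (return_pmf a))"
    and ts: "ts \<in> nlists n \<theta>" and E: "E \<in> encoders n J" and D: "D \<in> decoders d n J" and J: "J \<ge> 1"
  shows "0 \<le> code_error d W J ts E D" "code_error d W J ts E D \<le> 1"
proof -
  let ?S = "\<Sum>j\<in>{1..J}. Re (mat_trace (word_channel d W ts (E j) * D j))"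
  have b: "0 \<le> Re (mat_trace (word_channel d W ts (E j) * D j))" "Re (mat_trace (word_channel d W ts (E j) * D j)) \<le> 1"
    if "j \<in> {1..J}" for j
    using trace_povm_bounds[OF word_channel_density[of \<theta> d W, OF d ts encodersD[OF E that]] _ decodersD[OF D] that] by auto
  have "0 \<le> ?S" using b by (intro sum_nonneg) auto
  moreover have "?S \<le> (\<Sum>j\<in>{1..J}. 1)" using b by (intro sum_mono) auto
  hence "?S \<le> real J" by simp
  ultimately show "0 \<le> code_error d W J ts E D" "code_error d W J ts E D \<le> 1"
    using J by (auto simp: code_error_def)
qed

lemma code_leakage_bound:
  assumes d: "\<And>t a. t \<in> \<theta> \<Longrightarrow> density_op d (V t (return_pmf a))"
    and ts: "ts \<in> nlists n \<theta>" and E: "E \<in> encoders n J" and J: "J \<ge> 1"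
  shows "\<bar>code_leakage d V J ts E\<bar> \<le> real n * log 2 (real d)"
proof -
  have "\<bar>code_leakage d V J ts E\<bar> \<le> log 2 (real (d ^ n))"
    unfolding code_leakage_def nlistsE_length[OF ts]
    using word_channel_density[of \<theta> d V, OF d ts] encodersD[OF E] J
    by (intro holevo_abs_le) auto
  thus ?thesis by (simp add: log_nat_power)
qed

section \<open>Codes selected by a transmitted key\<close>

lemma key_protocol_expectation:
  fixes u :: "'x::finite list \<Rightarrow> bool list"
  assumes key: "key_protocol d \<theta> W p m k s q u Q N"
  shows "corr_exp p m (\<lambda>xs ys. F (u xs)) = (\<Sum>v\<in>nlists k UNIV. corr_exp p m (\<lambda>xs ys. of_bool (u xs = v)) * F v)"
proof -
  have "corr_exp p m (\<lambda>xs ys. F (u xs)) = corr_exp p m (\<lambda>xs ys. \<Sum>v\<in>nlists k UNIV. F v * of_bool (u xs = v))"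
  proof (rule corr_exp_cong)
    fix xs :: "'x list" assume "length xs = m"
    hence u: "u xs \<in> nlists k UNIV" using key by (auto simp only: key_protocol_def in_nlists_UNIV)
    have "(\<Sum>v\<in>nlists k UNIV. F v * of_bool (u xs = v)) = sum F (nlists k UNIV \<inter> {v. u xs = v})"
      by (rule sum_mult_of_bool_eq) simp
    also have "nlists k UNIV \<inter> {v. u xs = v} = {u xs}" using u by blast
    finally show "F (u xs) = (\<Sum>v\<in>nlists k UNIV. F v * of_bool (u xs = v))" by simp
  qed
  thus ?thesis by (simp only: corr_exp_sum corr_exp_cmult mult.commute)
qed

text \<open>
  The first \<open>m\<close> letters carry the key; the key \<open>v\<close> selects the code \<open>c v\<close> used on the rest.
  The receiver applies the decoder belonging to the key that he decoded.
\<close>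

definition keyed_encoder ::
    "nat \<Rightarrow> nat \<Rightarrow> ('x list \<Rightarrow> bool list) \<Rightarrow> ('x list \<Rightarrow> 'a list pmf) \<Rightarrow> (bool list \<Rightarrow> 'a det_code) \<Rightarrow>
     'x list \<Rightarrow> nat \<Rightarrow> 'a list pmf" where
  "keyed_encoder m J u Q c xs =
     restrict (\<lambda>j. append_pmf (Q (take m xs)) (fst (c (u (take m xs))) j)) {1..J}"

definition keyed_decoder ::
    "nat \<Rightarrow> nat \<Rightarrow> nat \<Rightarrow> nat \<Rightarrow> nat \<Rightarrow> (bool list \<Rightarrow> 'y list \<Rightarrow> complex mat) \<Rightarrow> (bool list \<Rightarrow> 'a det_code) \<Rightarrow>
     'y list \<Rightarrow> nat \<Rightarrow> complex mat" where
  "keyed_decoder d m n k J N c ys =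
     restrict (\<lambda>j. mat_lincomb (d ^ m * d ^ n) (nlists k UNIV) (\<lambda>_. 1) (\<lambda>v. kron (N v (take m ys)) (snd (c v) j))) {1..J}"

context
  fixes d d' m n k J :: nat and \<theta> :: "nat set" and W V :: "nat \<Rightarrow> 'a::finite pmf \<Rightarrow> complex mat"
    and p :: "('x::finite \<times> 'y::finite) pmf" and s q :: real
    and u :: "'x list \<Rightarrow> bool list" and Q :: "'x list \<Rightarrow> 'a list pmf" and N :: "bool list \<Rightarrow> 'y list \<Rightarrow> complex mat"
    and c :: "bool list \<Rightarrow> 'a det_code" and \<omega> :: "bool list \<Rightarrow> real"
  assumes dW: "\<And>t a. t \<in> \<theta> \<Longrightarrow> density_op d (W t (return_pmf a))"
    and dV: "\<And>t a. t \<in> \<theta> \<Longrightarrow> density_op d' (V t (return_pmf a))"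
    and key: "key_protocol d \<theta> W p m k s q u Q N"
    and c: "\<And>v. v \<in> nlists k UNIV \<Longrightarrow> c v \<in> encoders n J \<times> decoders d n J" and J: "J \<ge> 1"
  defines "\<omega> \<equiv> \<lambda>v. corr_exp p m (\<lambda>xs ys. of_bool (u xs = v))"
begin

text \<open>The sum over messages is moved inside the sum over keys: each inner decoder resolves the
  identity, and then the key measurement does.\<close>

lemma keyed_code: "corr_code d (m + n) J (keyed_encoder m J u Q c) (keyed_decoder d m n k J N c)"
  unfolding corr_code_def
proof (intro conjI ballI)
  fix xs :: "'x list" assume xs: "xs \<in> nlists (m + n) UNIV"
  hence l: "length (take m xs) = m" by (simp add: in_nlists_UNIV)
  have Q: "set_pmf (Q (take m xs)) \<subseteq> nlists m UNIV" and u: "u (take m xs) \<in> nlists k UNIV"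
    using key l by (auto simp only: key_protocol_def in_nlists_UNIV)
  have "fst (c (u (take m xs))) \<in> encoders n J" using c[OF u] by auto
  hence "set_pmf (append_pmf (Q (take m xs)) (fst (c (u (take m xs))) j)) \<subseteq> nlists (m + n) UNIV" if "j \<in> {1..J}" for j
    using set_append_pmf[OF Q encodersD] that by blast
  thus "keyed_encoder m J u Q c xs \<in> encoders (m + n) J"
    unfolding encoders_def keyed_encoder_def by auto
next
  fix ys :: "'y list" assume ys: "ys \<in> nlists (m + n) UNIV"
  hence l: "length (take m ys) = m" by (simp add: in_nlists_UNIV)
  have N: "\<And>v. v \<in> nlists k UNIV \<Longrightarrow> positive_op (d ^ m) (N v (take m ys))"
     "mat_lincomb (d ^ m) (nlists k UNIV) (\<lambda>_. 1) (\<lambda>v. N v (take m ys)) = 1\<^sub>m (d ^ m)"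
    using key l by (auto simp: key_protocol_def povm_def in_nlists_UNIV)
  have D: "snd (c v) \<in> decoders d n J" if "v \<in> nlists k UNIV" for v using c[OF that] by auto
  let ?K = "\<lambda>j. mat_lincomb (d ^ m * d ^ n) (nlists k UNIV) (\<lambda>_. 1) (\<lambda>v. kron (N v (take m ys)) (snd (c v) j))"
  have "positive_op (d ^ m * d ^ n) (?K j)" if "j \<in> {1..J}" for j
    using that by (intro mat_lincomb_positive kron_positive N decodersD(1)[OF D]) auto
  moreover have "mat_lincomb (d ^ m * d ^ n) {1..J} (\<lambda>_. 1) (restrict ?K {1..J}) = 1\<^sub>m (d ^ m * d ^ n)"
  proof -
    have "mat_lincomb (d ^ m * d ^ n) {1..J} (\<lambda>_. 1) (restrict ?K {1..J}) =
      mat_lincomb (d ^ m * d ^ n) (nlists k UNIV) (\<lambda>_. 1) (\<lambda>v. mat_lincomb (d ^ m * d ^ n) {1..J} (\<lambda>_. 1) (\<lambda>j. kron (N v (take m ys)) (snd (c v) j)))"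
      by (rule eq_matI) (simp_all add: sum.swap[of _ "{Suc 0..J}"])
    also have "\<dots> = mat_lincomb (d ^ m * d ^ n) (nlists k UNIV) (\<lambda>_. 1) (\<lambda>v. kron (N v (take m ys)) (1\<^sub>m (d ^ n)))"
    proof (rule mat_lincomb_cong)
      fix v :: "bool list" assume v: "v \<in> nlists k UNIV"
      have "mat_lincomb (d ^ m * d ^ n) {1..J} (\<lambda>_. 1) (\<lambda>j. kron (N v (take m ys)) (snd (c v) j)) =
        kron (N v (take m ys)) (mat_lincomb (d ^ n) {1..J} (\<lambda>_. 1) (snd (c v)))"
        using decodersD(1)[OF D[OF v]] N(1)[OF v] by (intro kron_lincomb_right[symmetric]) (auto dest: positive_op_carrier)
      thus "mat_lincomb (d ^ m * d ^ n) {1..J} (\<lambda>_. 1) (\<lambda>j. kron (N v (take m ys)) (snd (c v) j)) = kron (N v (take m ys)) (1\<^sub>m (d ^ n))"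
        using decodersD(2)[OF D[OF v]] by simp
    qed simp
    also have "\<dots> = kron (mat_lincomb (d ^ m) (nlists k UNIV) (\<lambda>_. 1) (\<lambda>v. N v (take m ys))) (1\<^sub>m (d ^ n))"
    proof (rule eq_matI)
      fix i j assume "i < dim_row (kron (mat_lincomb (d ^ m) (nlists k UNIV) (\<lambda>_. 1) (\<lambda>v. N v (take m ys))) (1\<^sub>m (d ^ n)))"
        "j < dim_col (kron (mat_lincomb (d ^ m) (nlists k UNIV) (\<lambda>_. 1) (\<lambda>v. N v (take m ys))) (1\<^sub>m (d ^ n)))"
      hence ij: "i < d ^ m * d ^ n" "j < d ^ m * d ^ n" by auto
      note ij' = div_mod_less_mult[OF ij(1)] div_mod_less_mult[OF ij(2)]
      have "kron (N v (take m ys)) (1\<^sub>m (d ^ n)) $$ (i, j) = N v (take m ys) $$ (i div d ^ n, j div d ^ n) * 1\<^sub>m (d ^ n) $$ (i mod d ^ n, j mod d ^ n)"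
        if "v \<in> nlists k UNIV" for v
        using N(1)[OF that, THEN positive_op_carrier] ij by (subst kron_entry) auto
      thus "mat_lincomb (d ^ m * d ^ n) (nlists k UNIV) (\<lambda>_. 1) (\<lambda>v. kron (N v (take m ys)) (1\<^sub>m (d ^ n))) $$ (i, j) =
        kron (mat_lincomb (d ^ m) (nlists k UNIV) (\<lambda>_. 1) (\<lambda>v. N v (take m ys))) (1\<^sub>m (d ^ n)) $$ (i, j)"
        using ij ij' by (subst kron_entry) (auto simp: sum_distrib_right simp del: index_one_mat(1) intro!: sum.cong)
    qed auto
    finally show ?thesis unfolding N(2) by (simp add: kron_one_one)
  qed
  ultimately show "keyed_decoder d m n k J N c ys \<in> decoders d (m + n) J"
    by (auto simp: decoders_def keyed_decoder_def power_add)
qed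

lemma corr_exp_key: "corr_exp p m (\<lambda>xs ys. F (u xs)) = (\<Sum>v\<in>nlists k UNIV. \<omega> v * F v)"
  unfolding \<omega>_def by (rule key_protocol_expectation[OF key])

text \<open>Among all key outcomes only the correct one is kept, since the others contribute
  nonnegative terms. The resulting bound \<open>1 - A * (1 - e)\<close> is relaxed to
  \<open>(1 - A) + e\<close>, so that key error and code error, which depend on the same source
  word, can be averaged separately.\<close>

lemma keyed_code_error:
  assumes ts: "ts \<in> nlists m \<theta>" "ts' \<in> nlists n \<theta>"
  shows "corr_exp p (m + n) (\<lambda>xs ys. code_error d W J (ts @ ts') (keyed_encoder m J u Q c xs) (keyed_decoder d m n k J N c ys))
    \<le> (1 - s) + (\<Sum>v\<in>nlists k UNIV. \<omega> v * code_error d W J ts' (fst (c v)) (snd (c v)))"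
proof -
  let ?A = "\<lambda>xs ys. Re (mat_trace (word_channel d W ts (Q xs) * N (u xs) ys))"
  let ?e = "\<lambda>v. code_error d W J ts' (fst (c v)) (snd (c v))"
  have le: "code_error d W J (ts @ ts') (keyed_encoder m J u Q c (xs @ xs')) (keyed_decoder d m n k J N c (ys @ ys')) \<le> (1 - ?A xs ys) + ?e (u xs)"
    if l: "length xs = m" "length ys = m" "length xs' = n" "length ys' = n" for xs ys xs' ys'
  proof -
    have Q: "set_pmf (Q xs) \<subseteq> nlists m UNIV" and u: "u xs \<in> nlists k UNIV"
      using key l by (auto simp only: key_protocol_def in_nlists_UNIV)
    have N: "\<And>v. v \<in> nlists k UNIV \<Longrightarrow> positive_op (d ^ m) (N v ys)"
       "mat_lincomb (d ^ m) (nlists k UNIV) (\<lambda>_. 1) (\<lambda>v. N v ys) = 1\<^sub>m (d ^ m)"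
      using key l by (auto simp: key_protocol_def povm_def in_nlists_UNIV)
    have E: "fst (c (u xs)) \<in> encoders n J" using c[OF u] by auto
    have D: "snd (c v) \<in> decoders d n J" if "v \<in> nlists k UNIV" for v using c[OF that] by auto
    have dens1: "density_op (d ^ m) (word_channel d W ts (Q xs))"
      using word_channel_density[of \<theta> d W, OF dW ts(1) Q] .
    have A: "0 \<le> ?A xs ys" "?A xs ys \<le> 1"
      using trace_povm_bounds[OF dens1 _ N u] by auto
    have tr: "?A xs ys * Re (mat_trace (word_channel d W ts' (fst (c (u xs)) j) * snd (c (u xs)) j))
      \<le> Re (mat_trace (word_channel d W (ts @ ts') (keyed_encoder m J u Q c (xs @ xs') j) * keyed_decoder d m n k J N c (ys @ ys') j))"
      if j: "j \<in> {1..J}" for j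
    proof -
      let ?\<rho> = "word_channel d W ts (Q xs)" and ?\<sigma> = "word_channel d W ts' (fst (c (u xs)) j)"
      let ?T = "\<lambda>v. Re (mat_trace (?\<rho> * N v ys)) * Re (mat_trace (?\<sigma> * snd (c v) j))"
      have dens2: "density_op (d ^ n) ?\<sigma>"
        using word_channel_density[of \<theta> d W, OF dW ts(2) encodersD[OF E j]] .
      have dens: "density_op (d ^ m * d ^ n) (word_channel d W (ts @ ts') (append_pmf (Q xs) (fst (c (u xs)) j)))"
        using word_channel_append[of \<theta> d W, OF dW ts Q] kron_density[OF dens1 dens2] by simp
      have t: "mat_trace (?\<rho> * N v ys) = complex_of_real (Re (mat_trace (?\<rho> * N v ys)))"
          "mat_trace (?\<sigma> * snd (c v) j) = complex_of_real (Re (mat_trace (?\<sigma> * snd (c v) j)))"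
          "0 \<le> Re (mat_trace (?\<rho> * N v ys))" "0 \<le> Re (mat_trace (?\<sigma> * snd (c v) j))"
        if v: "v \<in> nlists k UNIV" for v
        using mat_trace_mult_positive[OF _ N(1)[OF v], of ?\<rho>] mat_trace_mult_positive[OF _ decodersD(1)[OF D[OF v] j], of ?\<sigma>] dens1 dens2
        by (auto simp: density_op_def less_eq_complex_def complex_eq_iff)
      have "mat_trace (word_channel d W (ts @ ts') (keyed_encoder m J u Q c (xs @ xs') j) * keyed_decoder d m n k J N c (ys @ ys') j) =
        (\<Sum>v\<in>nlists k UNIV. mat_trace (word_channel d W (ts @ ts') (append_pmf (Q xs) (fst (c (u xs)) j)) * kron (N v ys) (snd (c v) j)))"
        unfolding keyed_encoder_def keyed_decoder_def using j l
        using mat_trace_mult_lincomb[of "nlists k UNIV" "\<lambda>v. kron (N v ys) (snd (c v) j)" "d ^ m * d ^ n"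
           "word_channel d W (ts @ ts') (append_pmf (Q xs) (fst (c (u xs)) j))" "\<lambda>_. 1"]
          dens N(1) decodersD(1)[OF D] by (simp add: density_op_def positive_op_carrier)
      also have "\<dots> = (\<Sum>v\<in>nlists k UNIV. mat_trace (?\<rho> * N v ys) * mat_trace (?\<sigma> * snd (c v) j))"
        using N(1) decodersD(1)[OF D] j
        by (intro sum.cong refl mat_trace_word_channel_append[of \<theta> d W, OF dW ts Q encodersD[OF E j]]) (auto dest: positive_op_carrier)
      also have "\<dots> = (\<Sum>v\<in>nlists k UNIV. complex_of_real (?T v))"
        using t(1,2) by (intro sum.cong refl) (metis of_real_mult)
      finally have "Re (mat_trace (word_channel d W (ts @ ts') (keyed_encoder m J u Q c (xs @ xs') j) * keyed_decoder d m n k J N c (ys @ ys') j))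
        = (\<Sum>v\<in>nlists k UNIV. ?T v)" by simp
      moreover have "?T (u xs) \<le> (\<Sum>v\<in>nlists k UNIV. ?T v)"
        using u t(3,4) by (intro member_le_sum) auto
      ultimately show ?thesis by simp
    qed
    have "?A xs ys * (1 - ?e (u xs)) = 1 / real J * (\<Sum>j\<in>{1..J}. ?A xs ys * Re (mat_trace (word_channel d W ts' (fst (c (u xs)) j) * snd (c (u xs)) j)))"
      unfolding code_error_def sum_distrib_left[symmetric] by simp
    also have "\<dots> \<le> 1 / real J * (\<Sum>j\<in>{1..J}. Re (mat_trace (word_channel d W (ts @ ts') (keyed_encoder m J u Q c (xs @ xs') j) * keyed_decoder d m n k J N c (ys @ ys') j)))"
      using tr by (intro mult_left_mono sum_mono) auto
    finally have 1: "code_error d W J (ts @ ts') (keyed_encoder m J u Q c (xs @ xs')) (keyed_decoder d m n k J N c (ys @ ys'))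
       \<le> 1 - ?A xs ys * (1 - ?e (u xs))" by (simp add: code_error_def)
    have "0 \<le> ?e (u xs)" using code_error_bounds[of \<theta> d W, OF dW ts(2) E D[OF u] J] by simp
    hence "?A xs ys * ?e (u xs) \<le> ?e (u xs)" using A by (intro mult_left_le_one_le) auto
    thus ?thesis using 1 by (simp add: algebra_simps)
  qed
  have "corr_exp p (m + n) (\<lambda>xs ys. code_error d W J (ts @ ts') (keyed_encoder m J u Q c xs) (keyed_decoder d m n k J N c ys))
    \<le> corr_exp p m (\<lambda>xs ys. corr_exp p n (\<lambda>xs' ys'. (1 - ?A xs ys) + ?e (u xs)))"
    unfolding corr_exp_append by (intro corr_exp_mono le)
  also have "\<dots> = 1 - succ_val d W p ts Q (\<lambda>xs. N (u xs)) + (\<Sum>v\<in>nlists k UNIV. \<omega> v * ?e v)"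
    using ts by (simp add: corr_exp_add corr_exp_diff succ_val_def corr_exp_key[of ?e])
  also have "s \<le> succ_val d W p ts Q (\<lambda>xs. N (u xs))" using key ts by (simp add: key_protocol_def)
  hence "1 - succ_val d W p ts Q (\<lambda>xs. N (u xs)) + (\<Sum>v\<in>nlists k UNIV. \<omega> v * ?e v) \<le> (1 - s) + (\<Sum>v\<in>nlists k UNIV. \<omega> v * ?e v)" by simp
  finally show ?thesis .
qed

text \<open>For a fixed source word the prefix state is the same for all messages, so it is a common
  tensor factor and \<open>holevo_kron\<close> removes it. What remains depends on the source word
  only through the key.\<close>

lemma keyed_code_leakage:
  assumes ts: "ts \<in> nlists m \<theta>" "ts' \<in> nlists n \<theta>"
  shows "corr_exp p (m + n) (\<lambda>xs ys. code_leakage d' V J (ts @ ts') (keyed_encoder m J u Q c xs)) =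
    (\<Sum>v\<in>nlists k UNIV. \<omega> v * code_leakage d' V J ts' (fst (c v)))"
proof -
  have eq: "code_leakage d' V J (ts @ ts') (keyed_encoder m J u Q c (xs @ xs')) = code_leakage d' V J ts' (fst (c (u xs)))"
    if l: "length xs = m" for xs xs'
  proof -
    have Q: "set_pmf (Q xs) \<subseteq> nlists m UNIV" and u: "u xs \<in> nlists k UNIV"
      using key l by (auto simp only: key_protocol_def in_nlists_UNIV)
    have E: "fst (c (u xs)) \<in> encoders n J" using c[OF u] by auto
    have wc: "word_channel d' V (ts @ ts') (keyed_encoder m J u Q c (xs @ xs') j) =
       kron (word_channel d' V ts (Q xs)) (word_channel d' V ts' (fst (c (u xs)) j))" if "j \<in> {1..J}" for j
      using that l word_channel_append[of \<theta> d' V, OF dV ts Q] by (simp add: keyed_encoder_def)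
    have "holevo (d' ^ m * d' ^ n) {1..J} (pmf_of_set {1..J}) (\<lambda>j. word_channel d' V (ts @ ts') (keyed_encoder m J u Q c (xs @ xs') j)) =
      holevo (d' ^ m * d' ^ n) {1..J} (pmf_of_set {1..J}) (\<lambda>j. kron (word_channel d' V ts (Q xs)) (word_channel d' V ts' (fst (c (u xs)) j)))"
      unfolding holevo_def using wc by (auto intro!: arg_cong2[of _ _ _ _ "(-)"] arg_cong[of _ _ vn_entropy] mat_lincomb_cong)
    also have "\<dots> = holevo (d' ^ n) {1..J} (pmf_of_set {1..J}) (\<lambda>j. word_channel d' V ts' (fst (c (u xs)) j))"
      using word_channel_density[of \<theta> d' V, OF dV ts(1) Q] word_channel_density[of \<theta> d' V, OF dV ts(2)] encodersD[OF E] J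
      by (intro holevo_kron) auto
    finally show ?thesis using ts by (simp add: code_leakage_def power_add)
  qed
  have "corr_exp p (m + n) (\<lambda>xs ys. code_leakage d' V J (ts @ ts') (keyed_encoder m J u Q c xs)) =
    corr_exp p m (\<lambda>xs ys. corr_exp p n (\<lambda>xs' ys'. code_leakage d' V J ts' (fst (c (u xs)))))"
    unfolding corr_exp_append by (intro corr_exp_cong eq)
  also have "\<dots> = (\<Sum>v\<in>nlists k UNIV. \<omega> v * code_leakage d' V J ts' (fst (c v)))"
    using corr_exp_key[of "\<lambda>v. code_leakage d' V J ts' (fst (c v))"] by simp
  finally show ?thesis .
qed

end

section \<open>Correlation-assisted codes are randomness-assisted codes\<close>

lemma avcq_wiretapD:
  assumes "avcq_wiretap d d' \<theta> W V"
  shows "t \<in> \<theta> \<Longrightarrow> density_op d (W t P)" "t \<in> \<theta> \<Longrightarrow> density_op d' (V t P)"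
  using assms by (auto simp: avcq_wiretap_def cq_channel_def)

lemma Max_image_less:
  fixes f :: "'b \<Rightarrow> real"
  assumes "finite A" "A \<noteq> {}" "\<And>x. x \<in> A \<Longrightarrow> f x < e"
  shows "(MAX x\<in>A. f x) < e"
  using assms by (subst Max_less_iff) auto

lemma le_Max_image:
  fixes f :: "'b \<Rightarrow> real"
  assumes "finite A" "x \<in> A"
  shows "f x \<le> (MAX x\<in>A. f x)"
  using assms by (intro Max_ge) auto

lemma nlists_nonempty: "A \<noteq> {} \<Longrightarrow> nlists n A \<noteq> {}"
  using nlists_not_empty[of A n] by blast

text \<open>\<open>G\<close> is the law of the random pair \<open>(E xs, D ys)\<close>, placed on
  the discrete sigma-algebra of all codes, where measurability is automatic.\<close>

lemma corr_code_to_rand_code: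
  fixes p :: "('x::finite \<times> 'y::finite) pmf" and E :: "'x list \<Rightarrow> nat \<Rightarrow> 'a::finite list pmf"
  assumes "corr_code d n J E D"
  shows "\<exists>G. rand_code d d' \<theta> W V n J G \<and>
    (\<forall>F :: 'a det_code \<Rightarrow> real. (\<integral>c. F c \<partial>G) = corr_exp p n (\<lambda>xs ys. F (E xs, D ys)))"
proof -
  let ?A = "encoders n J \<times> decoders d n J"
  let ?S = "nlists n (UNIV :: 'x set) \<times> nlists n (UNIV :: 'y set)"
  define w where "w = (\<lambda>(xs, ys). if (xs, ys) \<in> ?S then word_prob p xs ys else 0)"
  have w0: "w z = 0" if "z \<notin> ?S" for z using that by (cases z) (auto simp: w_def)
  have sum_w: "(\<Sum>z\<in>?S. w z * F z) = corr_exp p n (\<lambda>xs ys. F (xs, ys))" for F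
    unfolding corr_exp_def sum.cartesian_product' by (intro sum.cong refl) (auto simp: w_def)
  have "(\<integral>\<^sup>+ z. ennreal (w z) \<partial>count_space UNIV) = (\<Sum>z\<in>?S. ennreal (w z))"
    by (rule nn_integral_count_space'[OF _ _ subset_UNIV]) (use w0 in auto)
  also have "\<dots> = ennreal (\<Sum>z\<in>?S. w z)" by (rule sum_ennreal) (auto simp: w_def)
  also have "(\<Sum>z\<in>?S. w z) = 1" using sum_w[of "\<lambda>_. 1"] by simp
  finally have w1: "(\<integral>\<^sup>+ z. ennreal (w z) \<partial>count_space UNIV) = 1" by simp
  define P where "P = embed_pmf w"
  have P: "pmf P z = w z" for z
    unfolding P_def by (rule pmf_embed_pmf[OF _ w1]) (auto simp: w_def)
  \<comment> \<open>The mass function lives on lists of all lengths, and \<open>h\<close> must yield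
    a code everywhere; lists of a wrong length, which have mass 0, are replaced by a fixed word of
    length \<open>n\<close>.\<close>
  define fx where "fx xs = (if length xs = n then xs else replicate n undefined)" for xs :: "'x list"
  define fy where "fy ys = (if length ys = n then ys else replicate n undefined)" for ys :: "'y list"
  define h where "h = (\<lambda>(xs, ys). (E (fx xs), D (fy ys)))"
  have h: "h z \<in> ?A" for z
    using assms by (auto simp: h_def fx_def fy_def corr_code_def in_nlists_UNIV split: prod.splits)
  define G where "G = distr (measure_pmf P) (count_space ?A) h"
  have hm: "h \<in> measurable (measure_pmf P) (count_space ?A)" using h by auto
  have "prob_space G" unfolding G_def by (rule prob_space.prob_space_distr[OF measure_pmf.prob_space_axioms hm])
  moreover have "F \<in> borel_measurable G" for F :: "'a det_code \<Rightarrow> real"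
    unfolding G_def by simp
  moreover have "(\<integral>c. F c \<partial>G) = corr_exp p n (\<lambda>xs ys. F (E xs, D ys))" for F :: "'a det_code \<Rightarrow> real"
  proof -
    have "(\<integral>c. F c \<partial>G) = measure_pmf.expectation P (\<lambda>z. F (h z))"
      unfolding G_def by (rule integral_distr[OF hm]) simp
    also have "\<dots> = (\<Sum>z\<in>?S. pmf P z * F (h z))"
    proof (subst integral_measure_pmf[of ?S])
      fix z assume "z \<in> set_pmf P"
      hence "w z \<noteq> 0" by (simp add: set_pmf_iff P)
      thus "z \<in> ?S" using w0 by blast
    qed simp_all
    also have "\<dots> = corr_exp p n (\<lambda>xs ys. F (h (xs, ys)))" unfolding P by (rule sum_w)
    also have "\<dots> = corr_exp p n (\<lambda>xs ys. F (E xs, D ys))"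
      by (intro corr_exp_cong) (simp add: h_def fx_def fy_def)
    finally show ?thesis .
  qed
  moreover have "space G = ?A" by (simp add: G_def)
  ultimately show ?thesis by (intro exI[of _ G]) (auto simp: rand_code_def)
qed

lemma corr_achievable_imp_rand_achievable:
  fixes p :: "('x::finite \<times> 'y::finite) pmf" and W :: "nat \<Rightarrow> 'a::finite pmf \<Rightarrow> complex mat"
  assumes "corr_achievable d d' \<theta> W V p R"
  shows "rand_achievable d d' \<theta> W V R"
  unfolding rand_achievable_def
proof (intro conjI allI impI)
  show "0 \<le> R" using assms by (simp add: corr_achievable_def)
  fix \<epsilon> \<delta> \<zeta> :: real assume "\<epsilon> > 0" "\<delta> > 0" "\<zeta> > 0"
  with assms have "\<forall>\<^sub>F n in sequentially. \<exists>J\<ge>1. \<exists>E D.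
        corr_code d n J E D \<and> log 2 (real J) / real n > R - \<delta> \<and>
        (MAX ts\<in>nlists n \<theta>. corr_exp p n (\<lambda>xs ys. code_error d W J ts (E xs) (D ys))) < \<epsilon> \<and>
        (MAX ts\<in>nlists n \<theta>. corr_exp p n (\<lambda>xs ys. code_leakage d' V J ts (E xs))) < \<zeta>"
    unfolding corr_achievable_def corr_exp_def by blast
  thus "\<forall>\<^sub>F n in sequentially. \<exists>J\<ge>1. \<exists>G.
        rand_code d d' \<theta> W V n J G \<and> log 2 (real J) / real n > R - \<delta> \<and>
        (MAX ts\<in>nlists n \<theta>. \<integral>(E, D). code_error d W J ts E D \<partial>G) < \<epsilon> \<and>
        (MAX ts\<in>nlists n \<theta>. \<integral>(E, D). code_leakage d' V J ts E \<partial>G) < \<zeta>"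
  proof eventually_elim
    case (elim n)
    then obtain J E D where J: "J \<ge> 1" and code: "corr_code d n J E D" and rate: "log 2 (real J) / real n > R - \<delta>"
      and err: "(MAX ts\<in>nlists n \<theta>. corr_exp p n (\<lambda>xs ys. code_error d W J ts (E xs) (D ys))) < \<epsilon>"
      and leak: "(MAX ts\<in>nlists n \<theta>. corr_exp p n (\<lambda>xs ys. code_leakage d' V J ts (E xs))) < \<zeta>" by blast
    obtain G where G: "rand_code d d' \<theta> W V n J G"
      "\<And>F :: 'a det_code \<Rightarrow> real. (\<integral>c. F c \<partial>G) = corr_exp p n (\<lambda>xs ys. F (E xs, D ys))"
      using corr_code_to_rand_code[OF code, where p = p and d' = d' and \<theta> = \<theta> and W = W and V = V] by blast
    show ?case using J G(1) rate err leak by (intro exI[of _ J] exI[of _ G] conjI) (simp_all add: G(2))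
  qed
qed

text \<open>A single message is decoded without looking and reveals nothing. This settles rate 0,
  where the channels may be useless and the transmission of a key impossible.\<close>

lemma corr_achievable_zero:
  fixes p :: "('x::finite \<times> 'y::finite) pmf" and W :: "nat \<Rightarrow> 'a::finite pmf \<Rightarrow> complex mat"
  assumes av: "avcq_wiretap d d' \<theta> W V" and \<theta>: "finite \<theta>" "\<theta> \<noteq> {}"
  shows "corr_achievable d d' \<theta> W V p 0"
  unfolding corr_achievable_def
proof (intro conjI allI impI always_eventually)
  fix \<epsilon> \<delta> \<zeta> :: real and n :: nat assume pos: "\<epsilon> > 0" "\<delta> > 0" "\<zeta> > 0"
  obtain a0 :: 'a where True by simp
  define E where "E = (\<lambda>j\<in>{1..1 :: nat}. return_pmf (replicate n a0))"
  define D where "D = (\<lambda>j\<in>{1..1 :: nat}. 1\<^sub>m (d ^ n) :: complex mat)"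
  have E: "E \<in> encoders n 1" by (auto simp: E_def encoders_def in_nlists_UNIV)
  have D: "D \<in> decoders d n 1"
  proof -
    have "mat_lincomb (d ^ n) {1..1} (\<lambda>_. 1) D = 1\<^sub>m (d ^ n)"
      by (rule eq_matI) (auto simp: D_def)
    thus ?thesis by (auto simp: decoders_def D_def positive_op_one)
  qed
  have code: "corr_code d n 1 (\<lambda>_ :: 'x list. E) (\<lambda>_ :: 'y list. D)" using E D by (simp add: corr_code_def)
  have err: "code_error d W 1 ts E D = 0" if "ts \<in> nlists n \<theta>" for ts
  proof -
    have "mat_trace (word_channel d W ts (E 1) * 1\<^sub>m (d ^ n)) = 1"
      using mat_trace_word_channel_one[of \<theta> d W, OF avcq_wiretapD(1)[OF av] that encodersD[OF E]] by simp
    thus ?thesis by (simp add: code_error_def D_def)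
  qed
  have leak: "code_leakage d' V 1 ts E = 0" if "ts \<in> nlists n \<theta>" for ts
  proof -
    have "density_op (d' ^ n) (word_channel d' V ts (E 1))"
      using word_channel_density[of \<theta> d' V, OF avcq_wiretapD(2)[OF av] that encodersD[OF E]] by simp
    hence c: "word_channel d' V ts (E 1) \<in> carrier_mat (d' ^ n) (d' ^ n)" by (auto simp: density_op_def dest: positive_op_carrier)
    have "mat_lincomb (d' ^ n) {1..1} (pmf (pmf_of_set {1..1})) (\<lambda>j. word_channel d' V ts (E j)) = word_channel d' V ts (E 1)"
      by (rule eq_matI) (use c in auto)
    thus ?thesis unfolding code_leakage_def holevo_def nlistsE_length[OF that] by simp
  qed
  have ne: "nlists n \<theta> \<noteq> {}" using nlists_nonempty \<theta>(2) .
  show "\<exists>J\<ge>1. \<exists>E D. corr_code d n J E D \<and> log 2 (real J) / real n > 0 - \<delta> \<and>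
        (MAX ts\<in>nlists n \<theta>. \<Sum>xs\<in>nlists n UNIV. \<Sum>ys\<in>nlists n UNIV. word_prob p xs ys * code_error d W J ts (E xs) (D ys)) < \<epsilon> \<and>
        (MAX ts\<in>nlists n \<theta>. \<Sum>xs\<in>nlists n UNIV. \<Sum>ys\<in>nlists n UNIV. word_prob p xs ys * code_leakage d' V J ts (E xs)) < \<zeta>"
    using pos code \<theta>(1) ne
    by (intro exI[of _ 1] exI[of _ "\<lambda>_. E"] exI[of _ "\<lambda>_. D"] conjI Max_image_less finite_nlists) (auto simp: err[simplified] leak[simplified])
qed simp

section \<open>Channels of positive randomness-assisted capacity\<close>

text \<open>For a probability vector \<open>q\<close>, the law of a jamming word with independent
  letters.\<close>

definition word_weight :: "(nat \<Rightarrow> real) \<Rightarrow> nat list \<Rightarrow> real" where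
  "word_weight q ts = (\<Prod>t\<leftarrow>ts. q t)"

lemma word_weight_nonneg: "(\<And>t. t \<in> \<theta> \<Longrightarrow> 0 \<le> q t) \<Longrightarrow> set ts \<subseteq> \<theta> \<Longrightarrow> 0 \<le> word_weight q ts"
  by (induction ts) (auto simp: word_weight_def)

lemma sum_word_weight:
  assumes "(\<Sum>t\<in>\<theta>. q t) = 1"
  shows "(\<Sum>ts\<in>nlists n \<theta>. word_weight q ts) = 1"
proof (induction n)
  case (Suc n)
  have "(\<Sum>ts\<in>nlists (Suc 0 + n) \<theta>. word_weight q ts) = (\<Sum>t\<in>\<theta>. q t * (\<Sum>ts\<in>nlists n \<theta>. word_weight q ts))"
    unfolding sum_nlists_add sum_nlists_one sum_distrib_left by (simp add: word_weight_def)
  thus ?case using Suc assms by simp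
qed (simp add: word_weight_def)

text \<open>A jammer who draws the letters independently according to \<open>q\<close> replaces each
  output by \<open>\<sigma>\<close>, so all input words of one length lead to the same
  state.\<close>

lemma averaged_word_state:
  assumes fin: "finite \<theta>" and d: "\<And>t a. t \<in> \<theta> \<Longrightarrow> density_op d (W t (return_pmf a))"
    and const: "\<And>a. mat_lincomb d \<theta> q (\<lambda>t. W t (return_pmf a)) = \<sigma>" and as: "length as = n"
  shows "mat_lincomb (d ^ n) (nlists n \<theta>) (word_weight q) (\<lambda>ts. word_state W ts as) = kron_list (replicate n \<sigma>)"
  using as
proof (induction n arbitrary: as)
  case 0
  thus ?case by (intro eq_matI) (auto simp: word_weight_def word_state_def)
next
  case (Suc n)
  then obtain a as' where as: "as = a # as'" "length as' = n" by (auto simp: length_Suc_conv)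
  have Wc: "W t (return_pmf a) \<in> carrier_mat d d" if "t \<in> \<theta>" for t using d[OF that] by (auto simp: density_op_def dest: positive_op_carrier)
  have "kron_list (replicate (Suc n) \<sigma>) = kron (mat_lincomb d \<theta> q (\<lambda>t. W t (return_pmf a)))
     (mat_lincomb (d ^ n) (nlists n \<theta>) (word_weight q) (\<lambda>ts. word_state W ts as'))"
    using Suc.IH[OF as(2)] const by simp
  also have "\<dots> = mat_lincomb (d * d ^ n) (\<theta> \<times> nlists n \<theta>) (\<lambda>(t, ts). q t * word_weight q ts) (\<lambda>(t, ts). kron (W t (return_pmf a)) (word_state W ts as'))"
    using word_state_carrier[of \<theta> d W, OF d _ as(2)] Wc by (intro kron_lincomb) auto
  also have "\<dots> = mat_lincomb (d * d ^ n) (\<theta> \<times> nlists n \<theta>) (word_weight q \<circ> (\<lambda>(t, ts). t # ts)) ((\<lambda>ts. word_state W ts as) \<circ> (\<lambda>(t, ts). t # ts))"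
    by (rule mat_lincomb_cong) (auto simp: word_weight_def word_state_def as)
  also have "\<dots> = mat_lincomb (d * d ^ n) ((\<lambda>(t, ts). t # ts) ` (\<theta> \<times> nlists n \<theta>)) (word_weight q) (\<lambda>ts. word_state W ts as)"
    by (rule mat_lincomb_reindex[symmetric]) (auto simp: inj_on_def)
  also have "(\<lambda>(t, ts). t # ts) ` (\<theta> \<times> nlists n \<theta>) = nlists (Suc n) \<theta>"
    by (auto simp: nlists_Suc image_iff)
  finally show ?case by simp
qed

lemma averaged_word_channel:
  fixes W :: "nat \<Rightarrow> 'a::finite pmf \<Rightarrow> complex mat"
  assumes fin: "finite \<theta>" and d: "\<And>t a. t \<in> \<theta> \<Longrightarrow> density_op d (W t (return_pmf a))"
    and const: "\<And>a. mat_lincomb d \<theta> q (\<lambda>t. W t (return_pmf a)) = \<sigma>"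
    and P: "set_pmf P \<subseteq> nlists n UNIV"
  shows "mat_lincomb (d ^ n) (nlists n \<theta>) (word_weight q) (\<lambda>ts. word_channel d W ts P) = kron_list (replicate n \<sigma>)"
proof (rule eq_matI)
  obtain a0 :: 'a where True by simp
  let ?\<tau> = "kron_list (replicate n \<sigma>)"
  have \<tau>: "mat_lincomb (d ^ n) (nlists n \<theta>) (word_weight q) (\<lambda>ts. word_state W ts as) = ?\<tau>" if "length as = n" for as
    by (rule averaged_word_state[where W = W and q = q and \<sigma> = \<sigma>, OF fin d const that])
  have \<tau>c: "?\<tau> \<in> carrier_mat (d ^ n) (d ^ n)"
    using \<tau>[of "replicate n a0"] by (metis length_replicate mat_lincomb_carrier)
  fix i j assume "i < dim_row ?\<tau>" "j < dim_col ?\<tau>"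
  hence ij: "i < d ^ n" "j < d ^ n" using \<tau>c by auto
  have "mat_lincomb (d ^ n) (nlists n \<theta>) (word_weight q) (\<lambda>ts. word_channel d W ts P) $$ (i, j) =
    (\<Sum>ts\<in>nlists n \<theta>. \<Sum>as\<in>nlists n UNIV. complex_of_real (pmf P as) * (complex_of_real (word_weight q ts) * word_state W ts as $$ (i, j)))"
    using ij by (auto simp: word_channel_alt sum_distrib_left mult_ac intro!: sum.cong)
  also have "\<dots> = (\<Sum>as\<in>nlists n UNIV. complex_of_real (pmf P as) * (\<Sum>ts\<in>nlists n \<theta>. complex_of_real (word_weight q ts) * word_state W ts as $$ (i, j)))"
    unfolding sum_distrib_left by (rule sum.swap)
  also have "\<dots> = (\<Sum>as\<in>nlists n UNIV. complex_of_real (pmf P as) * ?\<tau> $$ (i, j))"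
  proof (intro sum.cong refl)
    fix as :: "'a list" assume "as \<in> nlists n UNIV"
    hence "?\<tau> $$ (i, j) = (\<Sum>ts\<in>nlists n \<theta>. complex_of_real (word_weight q ts) * word_state W ts as $$ (i, j))"
      using \<tau>[of as] ij by (metis in_nlists_UNIV mat_lincomb_entry)
    thus "complex_of_real (pmf P as) * (\<Sum>ts\<in>nlists n \<theta>. complex_of_real (word_weight q ts) * word_state W ts as $$ (i, j)) =
       complex_of_real (pmf P as) * ?\<tau> $$ (i, j)" by simp
  qed
  also have "\<dots> = complex_of_real (\<Sum>as\<in>nlists n UNIV. pmf P as) * ?\<tau> $$ (i, j)"
    by (simp add: sum_distrib_right)
  also have "(\<Sum>as\<in>nlists n UNIV. pmf P as) = 1" using P by (intro sum_pmf_eq_1) auto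
  finally show "mat_lincomb (d ^ n) (nlists n \<theta>) (word_weight q) (\<lambda>ts. word_channel d W ts P) $$ (i, j) = ?\<tau> $$ (i, j)" by simp
next
  obtain a0 :: 'a where True by simp
  have "kron_list (replicate n \<sigma>) \<in> carrier_mat (d ^ n) (d ^ n)"
    using averaged_word_state[where W = W and q = q and \<sigma> = \<sigma>, OF fin d const, of "replicate n a0" n] by (metis length_replicate mat_lincomb_carrier)
  thus "dim_row (mat_lincomb (d ^ n) (nlists n \<theta>) (word_weight q) (\<lambda>ts. word_channel d W ts P)) = dim_row (kron_list (replicate n \<sigma>))"
   "dim_col (mat_lincomb (d ^ n) (nlists n \<theta>) (word_weight q) (\<lambda>ts. word_channel d W ts P)) = dim_col (kron_list (replicate n \<sigma>))"
    by auto
qed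

text \<open>The averaged output is the same for all messages, so the receiver can only guess: the
  success terms add up to the trace of that state, which is 1, before division by
  \<open>J\<close>.\<close>

lemma averaged_code_error:
  fixes W :: "nat \<Rightarrow> 'a::finite pmf \<Rightarrow> complex mat"
  assumes fin: "finite \<theta>" and d: "\<And>t a. t \<in> \<theta> \<Longrightarrow> density_op d (W t (return_pmf a))"
    and const: "\<And>a. mat_lincomb d \<theta> q (\<lambda>t. W t (return_pmf a)) = \<sigma>" and q: "(\<Sum>t\<in>\<theta>. q t) = 1"
    and E: "E \<in> encoders n J" and D: "D \<in> decoders d n J" and J: "J \<ge> 1"
  shows "(\<Sum>ts\<in>nlists n \<theta>. word_weight q ts * code_error d W J ts E D) = 1 - 1 / real J"
proof -
  let ?\<tau> = "kron_list (replicate n \<sigma>)"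
  have wc: "word_channel d W ts (E j) \<in> carrier_mat (d ^ n) (d ^ n)" "mat_trace (word_channel d W ts (E j)) = 1"
    if "ts \<in> nlists n \<theta>" "j \<in> {1..J}" for ts j
    using word_channel_density[of \<theta> d W, OF d that(1) encodersD[OF E that(2)]] by (auto simp: density_op_def dest: positive_op_carrier)
  have \<tau>: "mat_lincomb (d ^ n) (nlists n \<theta>) (word_weight q) (\<lambda>ts. word_channel d W ts (E j)) = ?\<tau>" if "j \<in> {1..J}" for j
    by (rule averaged_word_channel[where W = W and q = q and \<sigma> = \<sigma>, OF fin d const encodersD[OF E that]])
  have 1: "1 \<in> {1..J}" using J by simp
  have \<tau>c: "?\<tau> \<in> carrier_mat (d ^ n) (d ^ n)" using \<tau>[OF 1] by (metis mat_lincomb_carrier)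
  have tr\<tau>: "mat_trace ?\<tau> = 1"
  proof -
    have "mat_trace ?\<tau> = (\<Sum>ts\<in>nlists n \<theta>. complex_of_real (word_weight q ts) * 1)"
      unfolding \<tau>[OF 1, symmetric] using wc[OF _ 1] by (subst mat_trace_lincomb) auto
    also have "\<dots> = complex_of_real (\<Sum>ts\<in>nlists n \<theta>. word_weight q ts)" by simp
    finally show ?thesis using sum_word_weight[OF q] by simp
  qed
  have Dc: "D j \<in> carrier_mat (d ^ n) (d ^ n)" if "j \<in> {1..J}" for j
    using decodersD(1)[OF D that] by (rule positive_op_carrier)
  have j: "(\<Sum>ts\<in>nlists n \<theta>. complex_of_real (word_weight q ts) * mat_trace (word_channel d W ts (E j) * D j)) = mat_trace (?\<tau> * D j)"
    if "j \<in> {1..J}" for j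
    unfolding \<tau>[OF that, symmetric] using wc[OF _ that] Dc[OF that] by (intro mat_trace_lincomb_mult[symmetric]) auto
  have "(\<Sum>ts\<in>nlists n \<theta>. word_weight q ts * (\<Sum>j\<in>{1..J}. Re (mat_trace (word_channel d W ts (E j) * D j)))) =
    (\<Sum>j\<in>{1..J}. \<Sum>ts\<in>nlists n \<theta>. word_weight q ts * Re (mat_trace (word_channel d W ts (E j) * D j)))"
    unfolding sum_distrib_left by (rule sum.swap)
  also have "\<dots> = (\<Sum>j\<in>{1..J}. Re (mat_trace (?\<tau> * D j)))"
    by (intro sum.cong refl) (simp flip: j)
  also have "\<dots> = Re (\<Sum>j\<in>{1..J}. mat_trace (?\<tau> * D j))" by simp
  also have "(\<Sum>j\<in>{1..J}. mat_trace (?\<tau> * D j)) = mat_trace (?\<tau> * 1\<^sub>m (d ^ n))"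
    using mat_trace_mult_lincomb[of "{1..J}" D "d ^ n" ?\<tau> "\<lambda>_. 1"] Dc \<tau>c unfolding decodersD(2)[OF D] by simp
  also have "\<dots> = 1" using \<tau>c tr\<tau> by (simp add: right_mult_one_mat[of _ "d ^ n" "d ^ n"])
  finally have S: "(\<Sum>ts\<in>nlists n \<theta>. word_weight q ts * (\<Sum>j\<in>{1..J}. Re (mat_trace (word_channel d W ts (E j) * D j)))) = 1" by simp
  have "(\<Sum>ts\<in>nlists n \<theta>. word_weight q ts * code_error d W J ts E D) =
    (\<Sum>ts\<in>nlists n \<theta>. word_weight q ts) - 1 / real J * (\<Sum>ts\<in>nlists n \<theta>. word_weight q ts * (\<Sum>j\<in>{1..J}. Re (mat_trace (word_channel d W ts (E j) * D j))))"
  proof -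
    have "(\<Sum>ts\<in>nlists n \<theta>. word_weight q ts * (1 - x * g ts)) = (\<Sum>ts\<in>nlists n \<theta>. word_weight q ts) - x * (\<Sum>ts\<in>nlists n \<theta>. word_weight q ts * g ts)" for x g
      unfolding sum_distrib_left sum_subtractf[symmetric] by (intro sum.cong refl) (simp add: algebra_simps)
    thus ?thesis unfolding code_error_def .
  qed
  thus ?thesis using S sum_word_weight[OF q] by simp
qed

lemma rand_code_integrable:
  assumes G: "rand_code d d' \<theta> W V n J G" and av: "avcq_wiretap d d' \<theta> W V" and J: "J \<ge> 1" and ts: "ts \<in> nlists n \<theta>"
  shows "integrable G (\<lambda>(E, D). code_error d W J ts E D)"
proof -
  interpret prob_space G using G by (simp add: rand_code_def)
  show ?thesis
  proof (rule integrable_const_bound)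
    show "AE c in G. norm (case c of (E, D) \<Rightarrow> code_error d W J ts E D) \<le> 1"
    proof (intro AE_I2)
      fix c assume "c \<in> space G"
      hence "fst c \<in> encoders n J" "snd c \<in> decoders d n J" using G by (auto simp: rand_code_def)
      thus "norm (case c of (E, D) \<Rightarrow> code_error d W J ts E D) \<le> 1"
        using code_error_bounds[of \<theta> d W, OF avcq_wiretapD(1)[OF av] ts _ _ J, of "fst c" "snd c"] by (simp add: case_prod_unfold)
    qed
  qed (use G ts in \<open>auto simp: rand_code_def\<close>)
qed

text \<open>A useless mixture would let an independent jammer force the error
  \<open>1 - 1 / J\<close> on every code, hence on every distribution over codes. A single block
  length with rate above \<open>R / 2\<close> already has \<open>J \<ge> 2\<close>, so some fixed
  jamming word causes an error of at least 1/2, contrary to the error bound 1/2 chosen here.\<close>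

lemma rand_achievable_nontrivial:
  fixes W :: "nat \<Rightarrow> 'a::finite pmf \<Rightarrow> complex mat"
  assumes av: "avcq_wiretap d d' \<theta> W V" and \<theta>: "finite \<theta>" and R: "rand_achievable d d' \<theta> W V R" "R > 0"
    and q: "\<And>s. s \<in> \<theta> \<Longrightarrow> 0 \<le> q s" "(\<Sum>s\<in>\<theta>. q s) = (1 :: real)"
  shows "\<exists>a a' i j. i < d \<and> j < d \<and> (\<Sum>t\<in>\<theta>. complex_of_real (q t) * W t (return_pmf a) $$ (i, j)) \<noteq> (\<Sum>t\<in>\<theta>. complex_of_real (q t) * W t (return_pmf a') $$ (i, j))"
proof (rule ccontr)
  assume "\<not> ?thesis"
  hence eq: "\<And>a a' i j. i < d \<Longrightarrow> j < d \<Longrightarrow> (\<Sum>t\<in>\<theta>. complex_of_real (q t) * W t (return_pmf a) $$ (i, j)) = (\<Sum>t\<in>\<theta>. complex_of_real (q t) * W t (return_pmf a') $$ (i, j))"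
    by blast
  obtain a0 :: 'a where True by simp
  have const: "mat_lincomb d \<theta> q (\<lambda>t. W t (return_pmf a)) = mat_lincomb d \<theta> q (\<lambda>t. W t (return_pmf a0))" for a
    by (rule eq_matI) (simp_all add: eq[of _ _ a a0])
  have "\<forall>\<^sub>F n in sequentially. \<exists>J\<ge>1. \<exists>G. rand_code d d' \<theta> W V n J G \<and> log 2 (real J) / real n > R - R / 2 \<and>
        (MAX ts\<in>nlists n \<theta>. \<integral>(E, D). code_error d W J ts E D \<partial>G) < 1 / 2 \<and>
        (MAX ts\<in>nlists n \<theta>. \<integral>(E, D). code_leakage d' V J ts E \<partial>G) < 1"
    using R(1)[unfolded rand_achievable_def, THEN conjunct2, rule_format, of "1 / 2" "R / 2" 1] R(2) by simp
  then obtain n J G where J: "J \<ge> 1" and G: "rand_code d d' \<theta> W V n J G" and rate: "log 2 (real J) / real n > R - R / 2"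
    and err: "(MAX ts\<in>nlists n \<theta>. \<integral>(E, D). code_error d W J ts E D \<partial>G) < 1 / 2"
    using eventually_happens'[OF sequentially_bot] by blast
  have "J \<noteq> 1" using rate R(2) by auto
  hence J2: "real J \<ge> 2" using J by simp
  interpret prob_space G using G by (simp add: rand_code_def)
  let ?X = "\<lambda>ts c. case c of (E, D) \<Rightarrow> code_error d W J ts E D"
  have int: "integrable G (?X ts)" if "ts \<in> nlists n \<theta>" for ts
    by (rule rand_code_integrable[OF G av J that])
  have "(\<Sum>ts\<in>nlists n \<theta>. word_weight q ts * expectation (?X ts)) = expectation (\<lambda>c. \<Sum>ts\<in>nlists n \<theta>. word_weight q ts * ?X ts c)"
    using int by (subst Bochner_Integration.integral_sum) auto
  also have "\<dots> = expectation (\<lambda>c. 1 - 1 / real J)"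
  proof (rule Bochner_Integration.integral_cong[OF refl])
    fix c assume "c \<in> space G"
    hence "fst c \<in> encoders n J" "snd c \<in> decoders d n J" using G by (auto simp: rand_code_def)
    thus "(\<Sum>ts\<in>nlists n \<theta>. word_weight q ts * ?X ts c) = 1 - 1 / real J"
      using averaged_code_error[where W = W and q = q and \<sigma> = "mat_lincomb d \<theta> q (\<lambda>t. W t (return_pmf a0))", OF \<theta> avcq_wiretapD(1)[OF av] const q(2) _ _ J, of "fst c" n "snd c"]
      by (simp add: case_prod_unfold)
  qed
  also have "\<dots> = 1 - 1 / real J" by (simp add: prob_space)
  finally have "(\<Sum>ts\<in>nlists n \<theta>. word_weight q ts * expectation (?X ts)) = 1 - 1 / real J" .
  moreover have "1 / real J \<le> 1 / 2" using J2 by (simp add: field_simps)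
  moreover have "(\<Sum>ts\<in>nlists n \<theta>. word_weight q ts * expectation (?X ts)) \<le>
     (\<Sum>ts\<in>nlists n \<theta>. word_weight q ts * (MAX ts\<in>nlists n \<theta>. expectation (?X ts)))"
    using \<theta> q(1) by (intro sum_mono mult_left_mono le_Max_image) (auto intro!: word_weight_nonneg[of \<theta>] dest: nlistsE_set)
  moreover have "\<dots> = (MAX ts\<in>nlists n \<theta>. expectation (?X ts))"
    unfolding sum_distrib_right[symmetric] sum_word_weight[OF q(2)] by simp
  ultimately show False using err by linarith
qed

section \<open>From randomness-assisted to correlation-assisted codes\<close>

lemma card_nlists: "finite A \<Longrightarrow> card (nlists n A) = card A ^ n"
  unfolding nlists_def using card_lists_length_eq[of A n] by (simp add: conj_commute)

text \<open>Error and leakage for all jamming words are handled by one derandomization: a Boolean in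
  the index set \<open>I\<close> tells them apart, which gives the factor 2 under the logarithm, and
  \<open>1 + real n * log 2 (real d')\<close> bounds both in modulus.\<close>

lemma corr_code_from_rand_code:
  fixes p :: "('x::finite \<times> 'y::finite) pmf" and W V :: "nat \<Rightarrow> 'a::finite pmf \<Rightarrow> complex mat"
  assumes av: "avcq_wiretap d d' \<theta> W V" and \<theta>: "finite \<theta>" "\<theta> \<noteq> {}"
    and key: "key_protocol d \<theta> W p m k s q u Q N"
    and G: "rand_code d d' \<theta> W V n J G" and J: "J \<ge> 1"
    and err: "\<And>ts. ts \<in> nlists n \<theta> \<Longrightarrow> (\<integral>(E, D). code_error d W J ts E D \<partial>G) \<le> e"
    and leak: "\<And>ts. ts \<in> nlists n \<theta> \<Longrightarrow> (\<integral>(E, D). code_leakage d' V J ts E \<partial>G) \<le> f"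
    and \<eta>: "\<eta> > 0" "2 * (ln (2 * real (card \<theta>) ^ n) + 1) * (1 + real n * log 2 (real d'))\<^sup>2 * q \<le> \<eta>\<^sup>2"
  shows "\<exists>E D. corr_code d (m + n) J E D \<and> (\<forall>ts\<in>nlists (m + n) \<theta>.
     corr_exp p (m + n) (\<lambda>xs ys. code_error d W J ts (E xs) (D ys)) \<le> (1 - s) + e + \<eta> \<and>
     corr_exp p (m + n) (\<lambda>xs ys. code_leakage d' V J ts (E xs)) \<le> f + \<eta>)"
proof -
  note dW = avcq_wiretapD(1)[OF av] and dV = avcq_wiretapD(2)[OF av]
  interpret prob_space G using G by (simp add: rand_code_def)
  have sp: "space G = encoders n J \<times> decoders d n J" using G by (simp add: rand_code_def)
  let ?L = "log 2 (real d')"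
  have "d' > 0" using density_op_dim_pos dV \<theta>(2) by blast
  hence L: "0 \<le> ?L" by simp
  define I where "I = (UNIV :: bool set) \<times> nlists n \<theta>"
  define X where "X = (\<lambda>(b, ts) (E, D). if b then code_error d W J ts E D else code_leakage d' V J ts E)"
  define \<omega> where "\<omega> v = corr_exp p m (\<lambda>xs ys. of_bool (u xs = v))" for v
  have I: "finite I" "I \<noteq> {}" using \<theta> nlists_nonempty[of \<theta> n] by (auto simp: I_def)
  have cI: "real (card I) = 2 * real (card \<theta>) ^ n" using \<theta>(1) by (simp add: I_def card_cartesian_product card_nlists)
  have X_meas: "X i \<in> borel_measurable G" if "i \<in> I" for i
    using that G by (cases "fst i") (auto simp: X_def I_def rand_code_def)
  have X_bound: "\<bar>X i c\<bar> \<le> 1 + real n * ?L" if "i \<in> I" "c \<in> space G" for i c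
  proof -
    obtain b ts E D where [simp]: "i = (b, ts)" "c = (E, D)" by (metis surj_pair)
    have *: "ts \<in> nlists n \<theta>" "E \<in> encoders n J" "D \<in> decoders d n J" using that by (auto simp: I_def sp)
    have "0 \<le> real n * ?L" using L by simp
    thus ?thesis using code_error_bounds[of \<theta> d W, OF dW * J] code_leakage_bound[of \<theta> d' V, OF dV *(1,2) J]
      by (auto simp: X_def)
  qed
  have \<omega>: "0 \<le> \<omega> v" "(\<Sum>v\<in>nlists k UNIV. \<omega> v) = 1" "(\<Sum>v\<in>nlists k UNIV. (\<omega> v)\<^sup>2) \<le> q" for v
  proof -
    show "0 \<le> \<omega> v" by (auto simp: \<omega>_def intro!: corr_exp_nonneg)
    show "(\<Sum>v\<in>nlists k UNIV. (\<omega> v)\<^sup>2) \<le> q" using key by (simp add: key_protocol_def \<omega>_def)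
    show "(\<Sum>v\<in>nlists k UNIV. \<omega> v) = 1" using key_protocol_expectation[OF key, of "\<lambda>_. 1"] by (simp add: \<omega>_def)
  qed
  obtain c where c: "\<And>v. v \<in> nlists k UNIV \<Longrightarrow> c v \<in> encoders n J \<times> decoders d n J"
    and cX: "\<And>i. i \<in> I \<Longrightarrow> (\<Sum>v\<in>nlists k UNIV. \<omega> v * X i (c v)) \<le> expectation (X i) + \<eta>"
    using derandomize[of "nlists k (UNIV :: bool set)" I X "1 + real n * ?L" \<omega> q \<eta>, OF _ I X_meas X_bound \<omega> \<eta>(1)] \<eta>(2)
    by (auto simp: cI sp)
  let ?E = "keyed_encoder m J u Q c" and ?D = "keyed_decoder d m n k J N c"
  have "corr_code d (m + n) J ?E ?D"
    by (rule keyed_code[where \<theta> = \<theta> and W = W and d' = d' and V = V, OF dW dV key c J])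
  moreover have "corr_exp p (m + n) (\<lambda>xs ys. code_error d W J ts (?E xs) (?D ys)) \<le> (1 - s) + e + \<eta> \<and>
     corr_exp p (m + n) (\<lambda>xs ys. code_leakage d' V J ts (?E xs)) \<le> f + \<eta>" if ts0: "ts \<in> nlists (m + n) \<theta>" for ts
  proof -
    obtain t t' where ts: "ts = t @ t'" "t \<in> nlists m \<theta>" "t' \<in> nlists n \<theta>"
      using take_drop_nlists[OF ts0] by (metis append_take_drop_id)
    have i: "(b, t') \<in> I" for b using ts by (simp add: I_def)
    have "(\<Sum>v\<in>nlists k UNIV. \<omega> v * code_error d W J t' (fst (c v)) (snd (c v))) \<le> e + \<eta>"
      using cX[OF i[of True]] err[OF ts(3)] by (simp add: X_def case_prod_unfold)
    moreover have "corr_exp p (m + n) (\<lambda>xs ys. code_error d W J ts (?E xs) (?D ys)) \<le>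
       (1 - s) + (\<Sum>v\<in>nlists k UNIV. \<omega> v * code_error d W J t' (fst (c v)) (snd (c v)))"
      unfolding ts(1) \<omega>_def by (rule keyed_code_error[where \<theta> = \<theta> and W = W and d' = d' and V = V, OF dW dV key c J ts(2,3)])
    moreover have "(\<Sum>v\<in>nlists k UNIV. \<omega> v * code_leakage d' V J t' (fst (c v))) \<le> f + \<eta>"
      using cX[OF i[of False]] leak[OF ts(3)] by (simp add: X_def case_prod_unfold)
    moreover have "corr_exp p (m + n) (\<lambda>xs ys. code_leakage d' V J ts (?E xs)) =
       (\<Sum>v\<in>nlists k UNIV. \<omega> v * code_leakage d' V J t' (fst (c v)))"
      unfolding ts(1) \<omega>_def by (rule keyed_code_leakage[where \<theta> = \<theta> and W = W and d' = d' and V = V, OF dW dV key c J ts(2,3)])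
    ultimately show ?thesis by linarith
  qed
  ultimately show ?thesis by blast
qed

section \<open>Growth rates and the choice of the key length\<close>

lemma power_times_geometric_tendsto_0:
  fixes q :: real
  assumes "0 < q" "q < 1"
  shows "(\<lambda>n. real n ^ j * q ^ n) \<longlonglongrightarrow> 0"
proof (cases "j = 0")
  case True
  thus ?thesis using assms by (simp add: LIMSEQ_power_zero)
next
  case False
  \<comment> \<open>With this root, \<open>real n ^ j * q ^ n\<close> is the j-th power of
    \<open>real n * r ^ n\<close>, which tends to 0.\<close>
  define r where "r = root j q"
  have r: "r ^ j = q" "0 < r" "r < 1" using assms False by (auto simp: r_def)
  have "(\<lambda>n. (real n * r ^ n) ^ j) \<longlonglongrightarrow> 0 ^ j"
    using r by (intro tendsto_power powser_times_n_limit_0) auto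
  moreover have "(real n * r ^ n) ^ j = real n ^ j * q ^ n" for n
    by (simp add: power_mult_distrib r(1)[symmetric] flip: power_mult) (simp add: mult.commute)
  ultimately show ?thesis using False by (simp add: power_0_left)
qed

definition fourth_root :: "nat \<Rightarrow> nat" where "fourth_root n = nat \<lfloor>sqrt (sqrt (real n))\<rfloor>"

text \<open>These make \<open>n\<close> comparable with the fourth power of the key length: the
  bound on \<open>n\<close> from above converts powers of \<open>n\<close> into powers of the key
  length, the one from below makes the prefix negligible.\<close>

lemma fourth_root_bounds: "fourth_root n ^ 4 \<le> n" "n \<le> Suc (fourth_root n) ^ 4"
proof -
  let ?r = "sqrt (sqrt (real n))"
  have r: "?r ^ 4 = real n" 
    by (simp add: power4_eq_xxxx) (metis mult.assoc of_nat_0_le_iff real_sqrt_ge_0_iff real_sqrt_mult_self abs_of_nonneg)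
  have k: "real (fourth_root n) \<le> ?r" "?r \<le> real (Suc (fourth_root n))"
    by (simp_all add: fourth_root_def) linarith+
  have "real (fourth_root n) ^ 4 \<le> ?r ^ 4" using k by (intro power_mono) auto
  thus "fourth_root n ^ 4 \<le> n" unfolding r by (metis of_nat_le_iff of_nat_power)
  have "?r ^ 4 \<le> real (Suc (fourth_root n)) ^ 4" using k by (intro power_mono) auto
  thus "n \<le> Suc (fourth_root n) ^ 4" unfolding r by (metis of_nat_le_iff of_nat_power)
qed

lemma fourth_root_at_top: "filterlim fourth_root at_top sequentially"
  unfolding filterlim_at_top
proof
  fix Z
  show "\<forall>\<^sub>F n in sequentially. Z \<le> fourth_root n"
  proof (rule eventually_sequentiallyI[of "Suc Z ^ 4"])
    fix n assume n: "Suc Z ^ 4 \<le> n"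
    show "Z \<le> fourth_root n"
    proof (rule ccontr)
      assume "\<not> Z \<le> fourth_root n"
      hence "Suc (fourth_root n) ^ 4 \<le> Z ^ 4" by (intro power_mono) auto
      also have "Z ^ 4 < Suc Z ^ 4" by (intro power_strict_mono) auto
      finally show False using fourth_root_bounds(2)[of n] n by simp
    qed
  qed
qed

text \<open>With as many detector blocks per bit as there are bits, Bernoulli's inequality bounds
  the failure probability by \<open>real (Suc k) * \<rho> ^ Suc k\<close>.\<close>

lemma key_success_eventually:
  fixes \<rho> :: real
  assumes "0 \<le> \<rho>" "\<rho> < 1" "\<epsilon> > 0"
  shows "\<forall>\<^sub>F k in sequentially. 1 - (1 - \<rho> ^ Suc k) ^ Suc k < \<epsilon>"
proof -
  have "(\<lambda>k. real (Suc k) * \<rho> ^ Suc k) \<longlonglongrightarrow> 0"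
    using powser_times_n_limit_0[of \<rho>] assms by (intro LIMSEQ_Suc[of "\<lambda>k. real k * \<rho> ^ k"]) auto
  hence "\<forall>\<^sub>F k in sequentially. real (Suc k) * \<rho> ^ Suc k < \<epsilon>"
    using assms(3) by (rule order_tendstoD)
  thus ?thesis
  proof eventually_elim
    case (elim k)
    have "\<rho> ^ Suc k \<le> 1" using assms by (intro power_le_one) auto
    hence "1 + real (Suc k) * (- (\<rho> ^ Suc k)) \<le> (1 + - (\<rho> ^ Suc k)) ^ Suc k"
      by (intro Bernoulli_inequality) simp
    thus ?case using elim by simp
  qed
qed

text \<open>The prefactor is cubic in \<open>n\<close>: one power from the logarithm of the number
  of words, two from the squared range of the leakage. With \<open>n \<le> Suc k ^ 4\<close> it has
  order \<open>Suc k ^ 12\<close>, against the geometric \<open>q ^ Suc k\<close>.\<close>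

lemma derandomization_cost_eventually:
  fixes q L T \<eta> :: real
  assumes q: "0 < q" "q < 1" and L: "0 \<le> L" and T: "1 \<le> T" and \<eta>: "\<eta> > 0"
  shows "\<forall>\<^sub>F k in sequentially. \<forall>n::nat. n \<le> Suc k ^ 4 \<longrightarrow>
    2 * (ln (2 * T ^ n) + 1) * (1 + real n * L)\<^sup>2 * q ^ Suc k \<le> \<eta>\<^sup>2"
proof -
  define C where "C = 2 * (ln 2 + ln T + 1) * (1 + L)\<^sup>2"
  have lnT: "0 \<le> ln T" using T by simp
  have "(\<lambda>k. C * (real (Suc k) ^ 12 * q ^ Suc k)) \<longlonglongrightarrow> C * 0"
    using power_times_geometric_tendsto_0[OF q, of 12] by (intro tendsto_intros LIMSEQ_Suc[of "\<lambda>k. real k ^ 12 * q ^ k"])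
  moreover have "C * 0 < \<eta>\<^sup>2" using \<eta> by simp
  ultimately have "\<forall>\<^sub>F k in sequentially. C * (real (Suc k) ^ 12 * q ^ Suc k) < \<eta>\<^sup>2"
    by (rule order_tendstoD)
  thus ?thesis
  proof eventually_elim
    case (elim k)
    show ?case
    proof (intro allI impI)
      fix n :: nat assume "n \<le> Suc k ^ 4"
      hence n: "real n \<le> real (Suc k) ^ 4" by (metis of_nat_le_iff of_nat_power)
      define Z where "Z = real (Suc k) ^ 4"
      have Z: "1 \<le> Z" "real n \<le> Z" using n one_le_power[of "real (Suc k)" 4] by (simp_all add: Z_def)
      have "ln (2 * T ^ n) = ln 2 + real n * ln T" using T by (simp add: ln_mult ln_realpow)
      also have "\<dots> \<le> Z * ln 2 + Z * ln T" using Z lnT mult_right_mono[of 1 Z "ln 2"] by (intro add_mono mult_right_mono) auto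
      finally have 1: "ln (2 * T ^ n) + 1 \<le> Z * (ln 2 + ln T + 1)" using Z by (simp add: algebra_simps)
      have "1 + real n * L \<le> Z + Z * L" using Z L by (intro add_mono mult_right_mono) auto
      hence 2: "(1 + real n * L)\<^sup>2 \<le> (Z * (1 + L))\<^sup>2" using L by (intro power_mono) (auto simp: algebra_simps)
      have "0 \<le> ln (2 * T ^ n) + 1" using T by (intro add_nonneg_nonneg ln_ge_zero) (auto intro: order_trans[of _ 2] simp: one_le_power)
      hence "2 * (ln (2 * T ^ n) + 1) * (1 + real n * L)\<^sup>2 * q ^ Suc k \<le> 2 * (Z * (ln 2 + ln T + 1)) * (Z * (1 + L))\<^sup>2 * q ^ Suc k"
        using 1 2 q lnT Z by (intro mult_right_mono mult_mono) auto
      also have "\<dots> = C * (real (Suc k) ^ 12 * q ^ Suc k)"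
      proof -
        have "2 * (Z * (ln 2 + ln T + 1)) * (Z * (1 + L))\<^sup>2 = C * Z ^ 3"
          by (simp add: C_def power2_eq_square power3_eq_cube)
        moreover have "Z ^ 3 = real (Suc k) ^ 12" by (simp add: Z_def flip: power_mult)
        ultimately show ?thesis by simp
      qed
      finally show "2 * (ln (2 * T ^ n) + 1) * (1 + real n * L)\<^sup>2 * q ^ Suc k \<le> \<eta>\<^sup>2" using elim by linarith
    qed
  qed
qed

text \<open>The prefix is at most \<open>4 * Suc K * k ^ 2\<close>, while \<open>n\<close> is at
  least \<open>k ^ 4\<close>. Keeping \<open>N0 + 1\<close> letters in reserve makes the inner block
  nonempty and long enough for the randomness-assisted codes to be available.\<close>

lemma prefix_length_eventually:
  fixes K N0 :: nat and c :: real
  assumes c: "c > 0"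
  shows "\<forall>\<^sub>F k in sequentially. \<forall>n. k ^ 4 \<le> n \<longrightarrow>
    Suc k * Suc (Suc k * K) + N0 + 1 \<le> n \<and> real (Suc k * Suc (Suc k * K)) \<le> c * real n"
proof -
  obtain k0 :: nat where k0: "4 * real (Suc K) / c \<le> real k0" using real_arch_simple by blast
  show ?thesis
  proof (rule eventually_sequentiallyI[of "max (max 1 k0) (4 * Suc K + N0 + 1)"], intro allI impI)
    fix k n assume "max (max 1 k0) (4 * Suc K + N0 + 1) \<le> k" and n: "k ^ 4 \<le> n"
    hence k: "1 \<le> k" "k0 \<le> k" "4 * Suc K + N0 + 1 \<le> k" by auto
    have kk: "k \<le> k ^ 2" "1 \<le> k ^ 2" using k(1) by (auto simp: power2_eq_square)
    have m: "Suc k * Suc (Suc k * K) \<le> 4 * Suc K * k ^ 2"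
    proof -
      have "Suc k * Suc (Suc k * K) \<le> Suc k * (Suc k * Suc K)" by (intro mult_le_mono2) simp
      also have "\<dots> \<le> (2 * k) * ((2 * k) * Suc K)" using k(1) by (intro mult_mono) auto
      finally show ?thesis by (simp add: power2_eq_square algebra_simps)
    qed
    have k4: "k ^ 2 * k ^ 2 = k ^ 4" by (simp flip: power_add)
    have "Suc k * Suc (Suc k * K) + N0 + 1 = Suc k * Suc (Suc k * K) + (N0 + 1) * 1" by simp
    also have "\<dots> \<le> 4 * Suc K * k ^ 2 + (N0 + 1) * k ^ 2"
      by (rule add_mono[OF m mult_le_mono2[OF kk(2)]])
    also have "\<dots> = (4 * Suc K + N0 + 1) * k ^ 2" by (simp add: algebra_simps)
    also have "\<dots> \<le> k ^ 2 * k ^ 2" using k(3) kk(1) by (intro mult_right_mono) auto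
    finally have 1: "Suc k * Suc (Suc k * K) + N0 + 1 \<le> n" using n k4 by linarith
    have "real (Suc k * Suc (Suc k * K)) \<le> real (4 * Suc K * k ^ 2)" using m by (simp only: of_nat_le_iff)
    also have "\<dots> = 4 * real (Suc K) * real (k ^ 2)" by simp
    also have "\<dots> \<le> (c * real (k ^ 2)) * real (k ^ 2)"
    proof (rule mult_right_mono)
      have "4 * real (Suc K) \<le> c * real k0" using k0 c by (simp add: field_simps)
      also have "\<dots> \<le> c * real (k ^ 2)" using c k(2) kk(1) by (intro mult_left_mono) (auto simp del: of_nat_power)
      finally show "4 * real (Suc K) \<le> c * real (k ^ 2)" .
    qed simp
    also have "\<dots> = c * real (k ^ 4)" unfolding k4[symmetric] by simp
    also have "\<dots> \<le> c * real n" using n c by (intro mult_left_mono) (auto simp del: of_nat_power)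
    finally show "Suc k * Suc (Suc k * K) + N0 + 1 \<le> n \<and> real (Suc k * Suc (Suc k * K)) \<le> c * real n" using 1 by blast
  qed
qed

text \<open>The error budget has three shares of \<open>\<epsilon> / 3\<close>: wrong key, error of
  the randomness-assisted code, derandomization. The leakage has two shares of
  \<open>\<zeta> / 2\<close>, for the code and its derandomization, since the key prefix leaks
  nothing about the message.\<close>

lemma rand_achievable_imp_corr_achievable:
  fixes p :: "('x::finite \<times> 'y::finite) pmf" and W V :: "nat \<Rightarrow> 'a::finite pmf \<Rightarrow> complex mat"
  assumes av: "avcq_wiretap d d' \<theta> W V" and \<theta>: "finite \<theta>" "\<theta> \<noteq> {}" and I: "mutual_info p > 0"
    and R: "rand_achievable d d' \<theta> W V R" "R > 0"
  shows "corr_achievable d d' \<theta> W V p R"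
  unfolding corr_achievable_def
proof (intro conjI allI impI)
  show "0 \<le> R" using R by simp
  fix \<epsilon> \<delta> \<zeta> :: real assume pos: "\<epsilon> > 0" "\<delta> > 0" "\<zeta> > 0"
  obtain \<rho> q where \<rho>: "0 \<le> \<rho>" "\<rho> < 1" and q: "0 < q" "q < 1"
    and keys: "\<And>k l. \<exists>u Q N. key_protocol d \<theta> W p (Suc k * Suc (Suc l * CARD('a))) (Suc k) ((1 - \<rho> ^ Suc l) ^ Suc k) (q ^ Suc k) u Q N"
    using key_protocols_exist[where W = W and p = p, OF \<theta> avcq_wiretapD(1)[OF av] rand_achievable_nontrivial[OF av \<theta>(1) R] I] by blast
  let ?m = "\<lambda>k. Suc k * Suc (Suc k * CARD('a))"
  \<comment> \<open>At most half of the admissible rate loss goes to the inner code; the other half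
    is left for the prefix.\<close>
  define \<delta>' where "\<delta>' = min (\<delta> / 2) (R / 2)"
  have \<delta>': "\<delta>' > 0" "\<delta>' \<le> \<delta> / 2" "\<delta>' < R" using pos R by (auto simp: \<delta>'_def)
  define \<eta> where "\<eta> = min (\<epsilon> / 3) (\<zeta> / 2)"
  have \<eta>: "\<eta> > 0" "\<eta> \<le> \<epsilon> / 3" "\<eta> \<le> \<zeta> / 2" using pos by (auto simp: \<eta>_def)
  have e3: "\<epsilon> / 3 > 0" and z2: "\<zeta> / 2 > 0" using pos by auto
  obtain N0 where N0: "\<And>n. n \<ge> N0 \<Longrightarrow> \<exists>J\<ge>1. \<exists>G. rand_code d d' \<theta> W V n J G \<and>
        log 2 (real J) / real n > R - \<delta>' \<and>
        (MAX ts\<in>nlists n \<theta>. \<integral>(E, D). code_error d W J ts E D \<partial>G) < \<epsilon> / 3 \<and>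
        (MAX ts\<in>nlists n \<theta>. \<integral>(E, D). code_leakage d' V J ts E \<partial>G) < \<zeta> / 2"
    using R(1)[unfolded rand_achievable_def, THEN conjunct2, rule_format, OF e3 \<delta>'(1) z2]
    unfolding eventually_sequentially by blast
  have "d' > 0" using density_op_dim_pos avcq_wiretapD(2)[OF av] \<theta>(2) by blast
  hence L: "0 \<le> log 2 (real d')" by simp
  have T: "1 \<le> real (card \<theta>)" using \<theta> by (simp add: Suc_leI card_gt_0_iff)
  \<comment> \<open>A prefix that takes up this fraction of \<open>n\<close> costs at most
    \<open>\<delta> / 2\<close> in rate.\<close>
  have cR: "\<delta> / (2 * R) > 0" using pos R by simp
  \<comment> \<open>Three eventual properties of the key length are pulled back along
    \<open>fourth_root\<close>. The last two are uniform in a block length \<open>n'\<close>,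
    because they are applied to different lengths: the cost to the inner block, the prefix bound to
    the whole word.\<close>
  have "\<forall>\<^sub>F n in sequentially. 1 - (1 - \<rho> ^ Suc (fourth_root n)) ^ Suc (fourth_root n) < \<epsilon> / 3 \<and>
     (\<forall>n'. n' \<le> Suc (fourth_root n) ^ 4 \<longrightarrow>
       2 * (ln (2 * real (card \<theta>) ^ n') + 1) * (1 + real n' * log 2 (real d'))\<^sup>2 * q ^ Suc (fourth_root n) \<le> \<eta>\<^sup>2) \<and>
     (\<forall>n'. fourth_root n ^ 4 \<le> n' \<longrightarrow> ?m (fourth_root n) + N0 + 1 \<le> n' \<and> real (?m (fourth_root n)) \<le> \<delta> / (2 * R) * real n')"
    using eventually_compose_filterlim[OF eventually_conj[OF key_success_eventually[OF \<rho> e3] eventually_conj[OF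
        derandomization_cost_eventually[OF q L T \<eta>(1)] prefix_length_eventually[OF cR, of "CARD('a)" N0]]] fourth_root_at_top] .
  thus "\<forall>\<^sub>F n in sequentially. \<exists>J\<ge>1. \<exists>E D. corr_code d n J E D \<and> log 2 (real J) / real n > R - \<delta> \<and>
        (MAX ts\<in>nlists n \<theta>. \<Sum>xs\<in>nlists n UNIV. \<Sum>ys\<in>nlists n UNIV. word_prob p xs ys * code_error d W J ts (E xs) (D ys)) < \<epsilon> \<and>
        (MAX ts\<in>nlists n \<theta>. \<Sum>xs\<in>nlists n UNIV. \<Sum>ys\<in>nlists n UNIV. word_prob p xs ys * code_leakage d' V J ts (E xs)) < \<zeta>"
  proof eventually_elim
    case (elim n)
    define k where "k = fourth_root n"
    define m where "m = ?m k"
    have succ: "1 - (1 - \<rho> ^ Suc k) ^ Suc k < \<epsilon> / 3" using elim by (simp add: k_def)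
    have m: "m + N0 + 1 \<le> n" "real m \<le> \<delta> / (2 * R) * real n"
      using elim fourth_root_bounds(1)[of n] unfolding m_def k_def by blast+
    \<comment> \<open>The inner code works on the letters left after the prefix; its rate is
      converted to the full length \<open>n\<close> below.\<close>
    define n' where "n' = n - m"
    have n': "n = m + n'" "n' \<ge> N0" "n' \<ge> 1" using m by (auto simp: n'_def)
    have "n' \<le> Suc k ^ 4" using fourth_root_bounds(2)[of n] n' by (simp add: k_def)
    hence cost: "2 * (ln (2 * real (card \<theta>) ^ n') + 1) * (1 + real n' * log 2 (real d'))\<^sup>2 * q ^ Suc k \<le> \<eta>\<^sup>2"
      using elim unfolding k_def by blast
    obtain J G where J: "J \<ge> 1" and G: "rand_code d d' \<theta> W V n' J G" and rate: "log 2 (real J) / real n' > R - \<delta>'"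
      and err: "(MAX ts\<in>nlists n' \<theta>. \<integral>(E, D). code_error d W J ts E D \<partial>G) < \<epsilon> / 3"
      and leak: "(MAX ts\<in>nlists n' \<theta>. \<integral>(E, D). code_leakage d' V J ts E \<partial>G) < \<zeta> / 2"
      using N0[OF n'(2)] by blast
    \<comment> \<open>Repetition number and key length are both \<open>Suc k\<close>, as in
      \<open>key_success_eventually\<close>.\<close>
    obtain u Q N where key: "key_protocol d \<theta> W p m (Suc k) ((1 - \<rho> ^ Suc k) ^ Suc k) (q ^ Suc k) u Q N"
      using keys[of k k] unfolding m_def by blast
    have err': "(\<integral>(E, D). code_error d W J ts E D \<partial>G) \<le> (MAX ts\<in>nlists n' \<theta>. \<integral>(E, D). code_error d W J ts E D \<partial>G)"
      and leak': "(\<integral>(E, D). code_leakage d' V J ts E \<partial>G) \<le> (MAX ts\<in>nlists n' \<theta>. \<integral>(E, D). code_leakage d' V J ts E \<partial>G)"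
      if "ts \<in> nlists n' \<theta>" for ts
      by (rule le_Max_image[OF finite_nlists[OF \<theta>(1)] that])+
    obtain E D where code: "corr_code d n J E D"
      and b: "\<And>ts. ts \<in> nlists n \<theta> \<Longrightarrow> corr_exp p n (\<lambda>xs ys. code_error d W J ts (E xs) (D ys)) \<le>
         (1 - (1 - \<rho> ^ Suc k) ^ Suc k) + (MAX ts\<in>nlists n' \<theta>. \<integral>(E, D). code_error d W J ts E D \<partial>G) + \<eta>"
       "\<And>ts. ts \<in> nlists n \<theta> \<Longrightarrow> corr_exp p n (\<lambda>xs ys. code_leakage d' V J ts (E xs)) \<le>
         (MAX ts\<in>nlists n' \<theta>. \<integral>(E, D). code_leakage d' V J ts E \<partial>G) + \<eta>"
      using corr_code_from_rand_code[OF av \<theta> key G J err' leak' \<eta>(1) cost] unfolding n'(1) by blast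
    have "R - \<delta> < log 2 (real J) / real n"
    proof -
      have n0: "real n > 0" "real n' > 0" using n' by auto
      have "(R - \<delta>') * real n' < log 2 (real J)" using rate n0(2) by (simp add: field_simps)
      moreover have "(R - \<delta>) * real n \<le> (R - \<delta>') * real n'"
      proof -
        have "(R - \<delta>') * real m \<le> R * real m" using \<delta>' by (intro mult_right_mono) auto
        also have "\<dots> \<le> R * (\<delta> / (2 * R) * real n)" using m(2) R by (intro mult_left_mono) auto
        also have "\<dots> = \<delta> / 2 * real n" using R by simp
        finally have "(R - \<delta>') * real m \<le> \<delta> / 2 * real n" .
        moreover have "\<delta>' * real n \<le> \<delta> / 2 * real n" using \<delta>' by (intro mult_right_mono) auto
        ultimately show ?thesis unfolding n'(1) by (simp add: algebra_simps)
      qed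
      ultimately show ?thesis using n0 by (simp add: field_simps)
    qed
    moreover have "(MAX ts\<in>nlists n \<theta>. corr_exp p n (\<lambda>xs ys. code_error d W J ts (E xs) (D ys))) < \<epsilon>"
    proof (rule Max_image_less[OF finite_nlists[OF \<theta>(1)] nlists_nonempty[OF \<theta>(2)]])
      fix ts assume "ts \<in> nlists n \<theta>"
      thus "corr_exp p n (\<lambda>xs ys. code_error d W J ts (E xs) (D ys)) < \<epsilon>"
        using b(1)[of ts] succ err \<eta>(2) by linarith
    qed
    moreover have "(MAX ts\<in>nlists n \<theta>. corr_exp p n (\<lambda>xs ys. code_leakage d' V J ts (E xs))) < \<zeta>"
    proof (rule Max_image_less[OF finite_nlists[OF \<theta>(1)] nlists_nonempty[OF \<theta>(2)]])
      fix ts assume "ts \<in> nlists n \<theta>"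
      thus "corr_exp p n (\<lambda>xs ys. code_leakage d' V J ts (E xs)) < \<zeta>"
        using b(2)[of ts] leak \<eta>(3) by linarith
    qed
    ultimately show ?case using J code unfolding corr_exp_def by blast
  qed
qed

theorem theorem4p1:
  fixes d d' T :: nat
    and W V :: "nat \<Rightarrow> 'a::finite pmf \<Rightarrow> complex mat"
    and p :: "('x::finite \<times> 'y::finite) pmf"
  assumes "T \<ge> 1"
    and "avcq_wiretap d d' {1..T} W V"
    and "mutual_info p > 0"
  shows "rand_secrecy_capacity d d' {1..T} W V = corr_secrecy_capacity d d' {1..T} W V p"
proof -
  have \<theta>: "finite {1..T}" "{1..T} \<noteq> {}" using assms(1) by auto
  have "rand_achievable d d' {1..T} W V R \<longleftrightarrow> corr_achievable d d' {1..T} W V p R" for R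
  proof
    assume R: "rand_achievable d d' {1..T} W V R"
    hence "R \<ge> 0" by (simp add: rand_achievable_def)
    thus "corr_achievable d d' {1..T} W V p R"
      using corr_achievable_zero[OF assms(2) \<theta>, of p]
        rand_achievable_imp_corr_achievable[OF assms(2) \<theta> assms(3) R] by (cases "R = 0") auto
  qed (rule corr_achievable_imp_rand_achievable)
  thus ?thesis by (simp add: rand_secrecy_capacity_def corr_secrecy_capacity_def)
qed

end
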